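(* Let $T$ be a real matrix transformation of $[0,1]^d$. Suppose that $T$ is diagonal with all eigenvalues $\beta_1,\dots,\beta_d$ of modulus strictly larger than $1$. For $1\le i\le d$, let $\psi_i\colon\mathbb R_{\ge0}\to\mathbb R_{\ge0}$ be a positive and non-increasing function, put $\Psi=(\psi_1,\dots,\psi_d)$, and let $$\mathcal R(\Psi)=\{\mathbf x\in[0,1]^d:|T_{\beta_i}^nx_i-x_i|<\psi_i(n)\ (1\le i\le d)\text{ for infinitely many }n\in\mathbb N\}.$$ Let $\mathcal U(\Psi)$ be the set of accumulation points $\mathbf t=(t_1,\dots,t_d)$ of the sequence $\big\{\big(-\frac{\log\psi_1(n)}n,\dots,-\frac{\log\psi_d(n)}n\big)\big\}_{n\ge1}$, and assume that $\mathcal U(\Psi)$ is bounded. Then $$\dim_{\mathrm H}\mathcal R(\Psi)=\sup_{\mathbf t\in\mathcal U(\Psi)}\min_{1\le i\le d}\theta_i(\mathbf t),$$ where $$\theta_i(\mathbf t)=\sum_{k\in\mathcal K_1(i)}1+\sum_{k\in\mathcal K_2(i)}\Big(1-\frac{t_k}{\log|\beta_i|+t_i}\Big)+\sum_{k\in\mathcal K_3(i)}\frac{\log|\beta_k|}{\log|\beta_i|+t_i}$$ and, in turn, $$\mathcal K_1(i)=\{1\le k\le d:\log|\beta_k|>\log|\beta_i|+t_i\},$$ $$\mathcal K_2(i)=\{1\le k\le d:\log|\beta_k|+t_k\le\log|\beta_i|+t_i\},$$ $$\mathcal K_3(i)=\{1,\dots,d\}\setminus(\mathcal K_1(i)\cup\mathcal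 K_2(i)).$$
   Context: A $d\times d$ non-singular real matrix $T$ determines the transformation $\mathbf x\mapsto T\mathbf x \bmod 1$. For $|\beta|>1$, $T_\beta x=\beta x-\lfloor\beta x\rfloor$ is the $\beta$-transformation, where $\lfloor\cdot\rfloor$ is the integer part, and $T_\beta^n$ is its $n$-th iterate; the diagonal matrix $T=\mathrm{diag}(\beta_1,\dots,\beta_d)$ acts by $T_{\beta_i}$ on the $i$-th coordinate. $\dim_{\mathrm H}$ is Hausdorff dimension.
   Formalization: The set U(Ψ) is assumed nonempty as well as bounded; if it is empty the supremum is over the empty set and the formula fails, e.g. d=2, β=(2,2), ψ_1=1, ψ_2(n)=exp(-n²), where R(Ψ) contains [0,1)×{0}. *)

theory Defs
  imports "HOL-Analysis.Analysis"
begin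

text \<open>
  The \<open>s\<close>-th power of the diameter, with the usual conventions \<open>0\<^sup>0 = 1\<close> for nonempty sets
  and value \<open>0\<close> for the empty set (in HOL, \<open>0 powr 0 = 0\<close>).
\<close>

definition diam_pow :: "real \<Rightarrow> 'a::metric_space set \<Rightarrow> ennreal" where
  "diam_pow s A =
     (if A = {} then 0 else if s = 0 then 1 else ennreal (diameter A powr s))"

text \<open>
  Covering sets are required to be bounded because \<^const>\<open>diameter\<close> is unspecified on
  unbounded sets. Finite covers are included by padding with empty sets.
\<close>

definition delta_covers :: "real \<Rightarrow> 'a::metric_space set \<Rightarrow> (nat \<Rightarrow> 'a set) set" where
  "delta_covers \<delta> A =
     {C. A \<subseteq> (\<Union>n. C n) \<and> (\<forall>n. bounded (C n) \<and> diameter (C n) \<le> \<delta>)}"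

definition hausdorff_premeasure :: "real \<Rightarrow> real \<Rightarrow> 'a::metric_space set \<Rightarrow> ennreal" where
  "hausdorff_premeasure s \<delta> A = (INF C\<in>delta_covers \<delta> A. \<Sum>n. diam_pow s (C n))"

definition hausdorff_measure :: "real \<Rightarrow> 'a::metric_space set \<Rightarrow> ennreal" where
  "hausdorff_measure s A = (SUP \<delta>\<in>{0<..}. hausdorff_premeasure s \<delta> A)"

definition hausdorff_dim :: "'a::metric_space set \<Rightarrow> ereal" where
  "hausdorff_dim A = (INF s\<in>{s. 0 \<le> s \<and> hausdorff_measure s A = 0}. ereal s)"

definition beta_map :: "real \<Rightarrow> real \<Rightarrow> real" where
  "beta_map \<beta> x = \<beta> * x - of_int \<lfloor>\<beta> * x\<rfloor>"

definition recurrent_set ::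
  "('n::finite \<Rightarrow> real) \<Rightarrow> ('n \<Rightarrow> real \<Rightarrow> real) \<Rightarrow> (real^'n) set" where
  "recurrent_set \<beta> \<psi> =
     {x. (\<forall>i. x $ i \<in> {0..1}) \<and>
         (\<exists>\<^sub>\<infinity>n::nat. \<forall>i. \<bar>(beta_map (\<beta> i) ^^ n) (x $ i) - x $ i\<bar> < \<psi> i (real n))}"

text \<open>
  Accumulation points of a sequence: every neighbourhood contains infinitely many terms, counted
  by index, so that a constant sequence accumulates at its value.
\<close>

definition seq_acc_points :: "(nat \<Rightarrow> 'a::topological_space) \<Rightarrow> 'a set" where
  "seq_acc_points u = {t. \<forall>S. open S \<longrightarrow> t \<in> S \<longrightarrow> (\<exists>\<^sub>\<infinity>n. u n \<in> S)}"

text \<open>The term with index \<open>0\<close> (junk, by division by zero) does not affect accumulation points.\<close>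

definition exponent_acc_points :: "('n::finite \<Rightarrow> real \<Rightarrow> real) \<Rightarrow> (real^'n) set" where
  "exponent_acc_points \<psi> =
     seq_acc_points (\<lambda>n::nat. \<chi> i. - ln (\<psi> i (real n)) / real n)"

definition K1 :: "('n::finite \<Rightarrow> real) \<Rightarrow> real^'n \<Rightarrow> 'n \<Rightarrow> 'n set" where
  "K1 \<beta> t i = {k. ln \<bar>\<beta> k\<bar> > ln \<bar>\<beta> i\<bar> + t $ i}"

definition K2 :: "('n::finite \<Rightarrow> real) \<Rightarrow> real^'n \<Rightarrow> 'n \<Rightarrow> 'n set" where
  "K2 \<beta> t i = {k. ln \<bar>\<beta> k\<bar> + t $ k \<le> ln \<bar>\<beta> i\<bar> + t $ i}"

definition K3 :: "('n::finite \<Rightarrow> real) \<Rightarrow> real^'n \<Rightarrow> 'n \<Rightarrow> 'n set" where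
  "K3 \<beta> t i = UNIV - (K1 \<beta> t i \<union> K2 \<beta> t i)"

definition theta :: "('n::finite \<Rightarrow> real) \<Rightarrow> real^'n \<Rightarrow> 'n \<Rightarrow> real" where
  "theta \<beta> t i =
     (\<Sum>k\<in>K1 \<beta> t i. 1)
     + (\<Sum>k\<in>K2 \<beta> t i. 1 - t $ k / (ln \<bar>\<beta> i\<bar> + t $ i))
     + (\<Sum>k\<in>K3 \<beta> t i. ln \<bar>\<beta> k\<bar> / (ln \<bar>\<beta> i\<bar> + t $ i))"

end

theory Submission
  imports Defs
begin

text \<open>
  Upper bound: the \<open>n\<close>-th iterate of \<open>beta_map \<beta>\<close> has \<open>O(\<bar>\<beta>\<bar>\<^sup>n)\<close> affine pieces, so in coordinate
  \<open>k\<close> the near returns at time \<open>n\<close> lie in \<open>O(exp (n l\<^sub>k))\<close> intervals of length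
  \<open>O(exp (- n (l\<^sub>k + t\<^sub>k)))\<close>, where \<open>l\<^sub>k = ln \<bar>\<beta>\<^sub>k\<bar>\<close>. Covering by cubes of side
  \<open>exp (- n (l\<^sub>i + t\<^sub>i))\<close> for the best \<open>i\<close> gives the exponent \<open>min\<^sub>i \<theta>\<^sub>i\<close>.

  Lower bound: up to an arbitrarily small loss of entropy, an iterate of each \<open>beta_map \<beta>\<^sub>k\<close>
  contains a full shift. In these shifts, symbols are free except that after each time \<open>N\<^sub>j\<close> of a
  very sparse sequence the initial word is repeated for a time proportional to \<open>t\<^sub>k N\<^sub>j / l\<^sub>k\<close>,
  which forces recurrence. Since \<open>\<psi>\<close> is non-increasing, only multiples of the chosen iterate need
  to be considered, so no mixing of the maps is needed. Counting words shows that the product of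
  these Cantor sets has dimension at least \<open>min\<^sub>i \<theta>\<^sub>i\<close> up to the loss.
\<close>

section \<open>Counting the pieces of monotonicity\<close>

text \<open>Origin of the minimum: at time \<open>n\<close>, cubes of side
  \<open>exp (- n * \<rho>)\<close> cover the near returns with about
  \<open>exp (n * rate \<beta> t \<rho>)\<close> members, so every scale \<rho> > 0 yields the
  exponent \<open>rate \<beta> t \<rho> / \<rho>\<close>. Its least value is attained at some \<rho>
  = \<open>ln \<bar>\<beta> i\<bar> + t $ i\<close>, and there the quotient is
  \<open>theta \<beta> t i\<close>. The Cantor sets lead to the same function: for balls of radius
  \<open>exp (- m * Z)\<close> and the last relevant return time \<open>N\<close>, the number of
  free symbols is governed by \<open>rate\<close> at \<rho> = \<open>Z / N\<close>. The obstacle is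
  that a general beta transformation, possibly with negative slope, has no Markov partition, and its
  branches are seldom full. Counting discontinuities replaces a coding: over the whole unit interval
  it bounds the number of branches, and over a short interval it shows that enough of the branches
  are long, which is the raw material for horseshoes. Boundedness of the accumulation points does
  not by itself bound the exponents; monotonicity of \<psi> excludes an escape to infinity, and
  compactness can then be used.\<close>

lemma card_separated:
  fixes A :: "real set"
  assumes "A \<subseteq> {a..b}" "L > 0" "a \<le> b"
    and sep: "\<And>x y. x \<in> A \<Longrightarrow> y \<in> A \<Longrightarrow> x \<noteq> y \<Longrightarrow> L \<le> \<bar>x - y\<bar>"
  shows "finite A" "real (card A) \<le> (b - a) / L + 1"
proof -
  let ?f = "\<lambda>x. \<lfloor>(x - a) / L\<rfloor>"
  have inj: "inj_on ?f A"
  proof (rule inj_onI, rule ccontr)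
    fix x y assume xy: "x \<in> A" "y \<in> A" "?f x = ?f y" "x \<noteq> y"
    have "\<bar>(x - a) / L - (y - a) / L\<bar> < 1" using xy(3) by linarith
    then have "\<bar>x - y\<bar> < L"
      using \<open>L > 0\<close> by (simp add: diff_divide_distrib [symmetric] abs_divide)
    then show False using sep[OF xy(1,2,4)] by simp
  qed
  have sub: "?f ` A \<subseteq> {0..\<lfloor>(b - a) / L\<rfloor>}"
    using assms(1,2) by (auto simp: floor_mono divide_right_mono)
  show fin: "finite A"
    using inj sub finite_imageD finite_subset by blast
  have "card A \<le> card {0..\<lfloor>(b - a) / L\<rfloor>}"
    using card_inj_on_le[OF inj sub] by simp
  then have "real (card A) \<le> real (nat (\<lfloor>(b - a) / L\<rfloor> + 1))" by simp
  also have "\<dots> = of_int \<lfloor>(b - a) / L\<rfloor> + 1"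
    using assms by (simp add: of_nat_nat)
  finally show "real (card A) \<le> (b - a) / L + 1" by linarith
qed

text \<open>The number of points of \<open>X\<close> to the left of \<open>y\<close> increases
  strictly along \<open>Y\<close>, and it takes at most \<open>card X + 1\<close> values.\<close>

lemma card_interlaced:
  fixes X Y :: "real set"
  assumes "finite X"
    and btw: "\<And>y z. y \<in> Y \<Longrightarrow> z \<in> Y \<Longrightarrow> y < z \<Longrightarrow> \<exists>x\<in>X. y < x \<and> x < z"
  shows "finite Y" "card Y \<le> card X + 1"
proof -
  let ?f = "\<lambda>y. card {x\<in>X. x < y}"
  have mono: "?f y < ?f z" if yz: "y \<in> Y" "z \<in> Y" "y < z" for y z
  proof (rule psubset_card_mono)
    show "finite {x\<in>X. x < z}" using assms(1) by simp
    obtain x where "x \<in> X" "y < x" "x < z" using btw[OF yz] by blast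
    then have "x \<in> {x\<in>X. x < z}" "x \<notin> {x\<in>X. x < y}" by simp_all
    moreover have "{x\<in>X. x < y} \<subseteq> {x\<in>X. x < z}" using yz(3) by auto
    ultimately show "{x\<in>X. x < y} \<subset> {x\<in>X. x < z}" by blast
  qed
  have inj: "inj_on ?f Y"
  proof (rule inj_onI)
    fix y z assume yz: "y \<in> Y" "z \<in> Y" "?f y = ?f z"
    then show "y = z"
      using mono[of y z] mono[of z y] by (cases y z rule: linorder_cases) simp_all
  qed
  have sub: "?f ` Y \<subseteq> {..card X}"
    using assms(1) by (auto intro: card_mono)
  show "finite Y" using inj sub finite_imageD finite_subset by blast
  show "card Y \<le> card X + 1" using card_inj_on_le[OF inj sub] by simp
qed

lemma finite_min_separation:
  fixes Z :: "real set"
  assumes "finite Z"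
  obtains d where "0 < d" "d \<le> 1" "\<And>x y. x \<in> Z \<Longrightarrow> y \<in> Z \<Longrightarrow> x \<noteq> y \<Longrightarrow> d \<le> \<bar>x - y\<bar>"
proof -
  \<comment> \<open>The inserted 1 keeps the minimum meaningful when \<open>Z\<close> has at most
    one point.\<close>
  let ?D = "insert 1 ((\<lambda>(x, y). \<bar>x - y\<bar>) ` {(x, y). x \<in> Z \<and> y \<in> Z \<and> x \<noteq> y})"
  have fin: "finite ?D"
    by (intro finite.insertI finite_imageI finite_subset[OF _ finite_cartesian_product[OF assms assms]]) auto
  show ?thesis
  proof
    show "0 < Min ?D" using fin by (subst Min_gr_iff) auto
    show "Min ?D \<le> 1" using fin by simp
    show "Min ?D \<le> \<bar>x - y\<bar>" if "x \<in> Z" "y \<in> Z" "x \<noteq> y" for x y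
      using fin that by (intro Min_le) auto
  qed
qed

section \<open>Iterates of a beta transformation and their cut points\<close>

lemma beta_map_ge_0: "0 \<le> beta_map \<beta> x" and beta_map_lt_1: "beta_map \<beta> x < 1"
  unfolding beta_map_def by linarith+

lemma beta_map_iter_bounds:
  assumes "0 < n"
  shows "0 \<le> (beta_map \<beta> ^^ n) x" "(beta_map \<beta> ^^ n) x < 1"
  using assms beta_map_ge_0 beta_map_lt_1 by (auto simp: gr0_conv_Suc)

lemma beta_map_iter_unit:
  assumes "x \<in> {0..1}"
  shows "(beta_map \<beta> ^^ n) x \<in> {0..1}"
  using assms beta_map_iter_bounds[of n \<beta> x] by (cases "n = 0") auto

text \<open>Off these points no floor taken during the first \<open>n\<close> steps can jump, so
  they delimit the affine pieces of the \<open>n\<close>-th iterate.\<close>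

definition cuts :: "real \<Rightarrow> nat \<Rightarrow> real set" where
  "cuts \<beta> n = {x\<in>{0..1}. \<exists>k<n. \<beta> * (beta_map \<beta> ^^ k) x \<in> \<int>}"

lemma cuts_mono: "m \<le> n \<Longrightarrow> cuts \<beta> m \<subseteq> cuts \<beta> n"
  unfolding cuts_def by (blast intro: order_less_le_trans)

text \<open>At each step the values to which the floor is applied form a connected set without
  integers. If the floor increased between two points of \<open>X\<close>, the larger floor would be
  an integer in that set; so the floor is constant.\<close>

lemma beta_map_iter_affine:
  assumes conn: "connected X" and "X \<subseteq> {0..1}" "X \<inter> cuts \<beta> n = {}"
  obtains s where "\<And>x. x \<in> X \<Longrightarrow> (beta_map \<beta> ^^ n) x = \<beta> ^ n * x - s"
proof -
  have "\<exists>s. \<forall>x\<in>X. (beta_map \<beta> ^^ n) x = \<beta> ^ n * x - s"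
    using assms(3)
  proof (induction n)
    case 0 show ?case by (intro exI[of _ 0]) simp
  next
    case (Suc n)
    have "X \<inter> cuts \<beta> n = {}" using Suc.prems cuts_mono[of n "Suc n" \<beta>] by auto
    then obtain s where s: "\<And>x. x \<in> X \<Longrightarrow> (beta_map \<beta> ^^ n) x = \<beta> ^ n * x - s"
      using Suc.IH by auto
    let ?f = "\<lambda>x. \<beta> * (\<beta> ^ n * x - s)"
    have conn_im: "connected (?f ` X)"
      by (intro connected_continuous_image conn continuous_intros)
    have noint: "z \<notin> \<int>" if "z \<in> ?f ` X" for z
      using that Suc.prems s assms(2) unfolding cuts_def by fastforce
    have le: "\<lfloor>?f y\<rfloor> \<le> \<lfloor>?f x\<rfloor>" if "x \<in> X" "y \<in> X" for x y
    proof (rule ccontr)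
      assume "\<not> ?thesis"
      then have "?f x \<le> of_int \<lfloor>?f y\<rfloor>" "of_int \<lfloor>?f y\<rfloor> \<le> ?f y" by linarith+
      then have "of_int \<lfloor>?f y\<rfloor> \<in> ?f ` X"
        using connectedD_interval[OF conn_im] that by blast
      then show False using noint by (metis Ints_of_int)
    qed
    show ?case
    proof (cases "X = {}")
      case False
      then obtain a where a: "a \<in> X" by auto
      have "(beta_map \<beta> ^^ Suc n) x = \<beta> ^ Suc n * x - (\<beta> * s + of_int \<lfloor>?f a\<rfloor>)" if "x \<in> X" for x
      proof -
        have "\<lfloor>?f x\<rfloor> = \<lfloor>?f a\<rfloor>" using le[OF a that] le[OF that a] by simp
        then have "beta_map \<beta> (\<beta> ^ n * x - s) = ?f x - of_int \<lfloor>?f a\<rfloor>"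
          by (simp add: beta_map_def)
        then show ?thesis
          by (simp only: funpow.simps comp_apply s[OF that]) (simp add: algebra_simps)
      qed
      then show ?thesis by blast
    qed auto
  qed
  then show ?thesis using that by auto
qed

lemma finite_beta_map_vimage:
  assumes "\<beta> \<noteq> 0" "finite F"
  shows "finite {x\<in>{0..1}. beta_map \<beta> x \<in> F}"
proof (rule finite_subset)
  let ?B = "\<lceil>\<bar>\<beta>\<bar>\<rceil>"
  show "{x\<in>{0..1}. beta_map \<beta> x \<in> F} \<subseteq> (\<lambda>(y, j). (y + of_int j) / \<beta>) ` (F \<times> {- ?B .. ?B})"
  proof
    fix x assume x: "x \<in> {x\<in>{0..1}. beta_map \<beta> x \<in> F}"
    have "\<bar>\<beta> * x\<bar> \<le> \<bar>\<beta>\<bar> * 1" unfolding abs_mult using x by (intro mult_left_mono) auto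
    then have "- ?B \<le> \<lfloor>\<beta> * x\<rfloor> \<and> \<lfloor>\<beta> * x\<rfloor> \<le> ?B" by linarith
    moreover have "x = (beta_map \<beta> x + of_int \<lfloor>\<beta> * x\<rfloor>) / \<beta>"
      using assms(1) by (simp add: beta_map_def)
    ultimately show "x \<in> (\<lambda>(y, j). (y + of_int j) / \<beta>) ` (F \<times> {- ?B .. ?B})"
      using x by (intro image_eqI[where x = "(beta_map \<beta> x, \<lfloor>\<beta> * x\<rfloor>)"]) auto
  qed
qed (use assms in auto)

lemma finite_beta_map_iter_vimage:
  assumes "\<beta> \<noteq> 0" "finite F"
  shows "finite {x\<in>{0..1}. (beta_map \<beta> ^^ n) x \<in> F}"
proof (induction n)
  case 0
  then show ?case using assms(2) by simp
next
  case (Suc n)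
  have "{x\<in>{0..1}. (beta_map \<beta> ^^ Suc n) x \<in> F}
      = {x\<in>{0..1}. beta_map \<beta> x \<in> {y\<in>{0..1}. (beta_map \<beta> ^^ n) y \<in> F}}"
    using beta_map_ge_0 beta_map_lt_1 by (auto simp: funpow_Suc_right less_imp_le simp del: funpow.simps)
  then show ?case using finite_beta_map_vimage[OF assms(1) Suc.IH] by simp
qed

lemma finite_cuts:
  assumes "\<beta> \<noteq> 0"
  shows "finite (cuts \<beta> n)"
proof -
  let ?Z = "{y\<in>{0..1}. \<beta> * y \<in> \<int>}"
  have "?Z \<subseteq> {y\<in>{0..1}. beta_map \<beta> y \<in> {0}}" by (auto simp: beta_map_def)
  then have Z: "finite ?Z"
    using finite_beta_map_vimage[OF assms, of "{0}"] finite_subset by blast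
  have "cuts \<beta> n \<subseteq> (\<Union>k<n. {x\<in>{0..1}. (beta_map \<beta> ^^ k) x \<in> ?Z})"
    using beta_map_iter_unit unfolding cuts_def by auto
  moreover have "finite \<dots>" using finite_beta_map_iter_vimage[OF assms Z] by auto
  ultimately show ?thesis using finite_subset by blast
qed

text \<open>Cuts created after time \<open>n\<close> are preimages of the fixed finite set
  \<open>cuts \<beta> m\<close>, which permits counting in blocks of \<open>m\<close> steps.\<close>

lemma cuts_add:
  assumes "x \<in> cuts \<beta> (n + m)" "x \<notin> cuts \<beta> n"
  shows "(beta_map \<beta> ^^ n) x \<in> cuts \<beta> m"
proof -
  obtain k where k: "k < n + m" "\<beta> * (beta_map \<beta> ^^ k) x \<in> \<int>" and x: "x \<in> {0..1}"
    using assms(1) unfolding cuts_def by auto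
  have "\<not> k < n" using assms(2) k x unfolding cuts_def by auto
  then have "k = (k - n) + n" "k - n < m" using k by auto
  then have "\<beta> * (beta_map \<beta> ^^ (k - n)) ((beta_map \<beta> ^^ n) x) \<in> \<int>"
    using k by (metis comp_apply funpow_add)
  then show ?thesis using beta_map_iter_unit[OF x] \<open>k - n < m\<close> unfolding cuts_def by auto
qed

text \<open>
  Adding the points of a grid of mesh \<open>\<delta> / \<Lambda> ^ k\<close> to the cut points makes every gap so short
  that its image contains at most one cut point of the next iterate. Hence the number of gaps
  at most doubles, up to the new grid points, which is less than the factor \<open>\<Lambda>\<close>.
\<close>

lemma card_cuts_interval:
  assumes \<beta>: "\<bar>\<beta>\<bar> > 1" and \<Lambda>: "\<Lambda> = \<bar>\<beta>\<bar> ^ m" "4 \<le> \<Lambda>"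
    and \<delta>: "0 < \<delta>" "\<And>x y. x \<in> cuts \<beta> m \<Longrightarrow> y \<in> cuts \<beta> m \<Longrightarrow> x \<noteq> y \<Longrightarrow> \<delta> \<le> \<bar>x - y\<bar>"
    and pq: "0 \<le> p" "p \<le> q" "q \<le> 1"
  shows "real (card (cuts \<beta> (m * k) \<inter> {p..q})) \<le> 3 * 2 ^ k + 2 * (q - p) * \<Lambda> ^ k / \<delta>"
proof -
  have \<beta>0: "\<beta> \<noteq> 0" using \<beta> by auto
  define G where "G k = {x\<in>{p..q}. \<exists>j::int. x = of_int j * (\<delta> / \<Lambda> ^ k)}" for k
  define X where "X k = (cuts \<beta> (m * k) \<inter> {p..q}) \<union> G k" for k
  have mesh: "0 < \<delta> / \<Lambda> ^ k" for k using \<delta>(1) \<Lambda>(2) by simp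
  have G: "finite (G k)" "real (card (G k)) \<le> (q - p) * \<Lambda> ^ k / \<delta> + 1" for k
  proof -
    have sep: "\<delta> / \<Lambda> ^ k \<le> \<bar>x - y\<bar>" if xy: "x \<in> G k" "y \<in> G k" "x \<noteq> y" for x y
    proof -
      define c where "c = \<delta> / \<Lambda> ^ k"
      have "0 < c" using mesh c_def by simp
      obtain i j :: int where ij: "x = of_int i * c" "y = of_int j * c"
        using xy unfolding G_def c_def by auto
      then have "i \<noteq> j" using xy by auto
      then have "1 \<le> \<bar>real_of_int i - of_int j\<bar>" by linarith
      then have "1 * c \<le> \<bar>real_of_int i - of_int j\<bar> * c"
        using \<open>0 < c\<close> by (intro mult_right_mono) auto
      also have "\<dots> = \<bar>x - y\<bar>"
        using \<open>0 < c\<close> by (simp add: ij left_diff_distrib[symmetric] abs_mult)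
      finally show ?thesis by (simp add: c_def)
    qed
    have sub: "G k \<subseteq> {p..q}" unfolding G_def by auto
    show "finite (G k)" "real (card (G k)) \<le> (q - p) * \<Lambda> ^ k / \<delta> + 1"
      using card_separated[OF sub mesh pq(2) sep] by simp_all
  qed
  have finX: "finite (X k)" for k using G finite_cuts[OF \<beta>0] unfolding X_def by auto
  define A where "A k = (q - p) * \<Lambda> ^ k / \<delta>" for k
  \<comment> \<open>The summand 2 absorbs the two additive constants of the recursion: one from
    interlacing, one from counting grid points.\<close>
  have bound: "real (card (X k)) + 2 \<le> 3 * 2 ^ k + 2 * A k"
  proof (induction k)
    case 0
    have X0: "X 0 = G 0" by (auto simp: X_def cuts_def)
    have "0 \<le> (q - p) / \<delta>" using pq \<delta>(1) by simp
    moreover have "real (card (G 0)) \<le> (q - p) / \<delta> + 1" using G(2)[of 0] by simp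
    ultimately have "real (card (X 0)) + 2 \<le> 3 + 2 * ((q - p) / \<delta>)"
      unfolding X0 by linarith
    then show ?case by (simp add: A_def)
  next
    case (Suc k)
    define Y where "Y = {x\<in>{p..q}. x \<notin> X k \<and> (beta_map \<beta> ^^ (m * k)) x \<in> cuts \<beta> m}"
    have Y: "finite Y" "card Y \<le> card (X k) + 1"
    proof -
      have btw: "\<exists>x\<in>X k. y < x \<and> x < z" if yz: "y \<in> Y" "z \<in> Y" "y < z" for y z
      proof (rule ccontr)
        assume no: "\<not> ?thesis"
        have I: "{y..z} \<subseteq> {p..q}" "{y..z} \<subseteq> {0..1}" using yz pq unfolding Y_def by auto
        have disj: "{y..z} \<inter> X k = {}"
        proof -
          have "x \<notin> X k" if "x \<in> {y..z}" for x
            using no yz that unfolding Y_def by (cases "x = y"; cases "x = z") auto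
          then show ?thesis by blast
        qed
        have "{y..z} \<inter> cuts \<beta> (m * k) = {}" using disj I unfolding X_def by auto
        then obtain s where s: "\<And>x. x \<in> {y..z} \<Longrightarrow> (beta_map \<beta> ^^ (m * k)) x = \<beta> ^ (m * k) * x - s"
          using beta_map_iter_affine[OF connected_Icc I(2)] by blast
        have short: "z - y < \<delta> / \<Lambda> ^ k"
        proof (rule ccontr)
          assume long: "\<not> z - y < \<delta> / \<Lambda> ^ k"
          define c where "c = \<delta> / \<Lambda> ^ k"
          have c: "c > 0" "c \<le> z - y" using mesh long c_def by auto
          \<comment> \<open>The last grid point not exceeding \<open>z\<close>; a gap as long as the
            mesh would contain it.\<close>
          define x where "x = of_int \<lfloor>z / c\<rfloor> * c"
          have "of_int \<lfloor>z / c\<rfloor> \<le> z / c" "z / c - 1 < of_int \<lfloor>z / c\<rfloor>" by linarith+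
          then have "of_int \<lfloor>z / c\<rfloor> * c \<le> z / c * c" "(z / c - 1) * c < of_int \<lfloor>z / c\<rfloor> * c"
            using c(1) by (simp_all only: mult_right_mono mult_strict_right_mono less_imp_le)
          then have "x \<le> z" "z - c < x"
            using c(1) unfolding x_def by (simp_all add: left_diff_distrib)
          then have "x \<in> {y..z}" using c by auto
          then have "x \<in> G k" using I(1) unfolding G_def x_def c_def by blast
          then show False using disj \<open>x \<in> {y..z}\<close> unfolding X_def by auto
        qed
        have "\<bar>(beta_map \<beta> ^^ (m * k)) z - (beta_map \<beta> ^^ (m * k)) y\<bar> = \<bar>\<beta> ^ (m * k) * (z - y)\<bar>"
          using s[of y] s[of z] yz by (simp add: algebra_simps)
        also have "\<dots> = \<Lambda> ^ k * (z - y)"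
          using yz by (simp add: abs_mult \<Lambda>(1) power_abs power_mult)
        also have "\<dots> < \<delta>" using short \<Lambda>(2) by (simp add: field_simps)
        finally have "(beta_map \<beta> ^^ (m * k)) z = (beta_map \<beta> ^^ (m * k)) y"
          using \<delta>(2) yz unfolding Y_def by fastforce
        then show False using s[of y] s[of z] yz \<beta>0 by simp
      qed
      show "finite Y" "card Y \<le> card (X k) + 1" using card_interlaced[OF finX btw] by auto
    qed
    have "X (Suc k) \<subseteq> X k \<union> Y \<union> G (Suc k)"
      using cuts_add[of _ \<beta> "m * k" m] unfolding X_def Y_def by (auto simp: add.commute)
    then have "card (X (Suc k)) \<le> card (X k \<union> Y \<union> G (Suc k))"
      using finX Y(1) G(1) by (intro card_mono) auto
    also have "\<dots> \<le> card (X k) + card Y + card (G (Suc k))"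
      by (meson card_Un_le add_le_mono le_refl order_trans)
    finally have "real (card (X (Suc k))) \<le> real (card (X k)) + real (card Y) + real (card (G (Suc k)))"
      by (metis of_nat_add of_nat_le_iff)
    also have "\<dots> \<le> 2 * real (card (X k)) + 1 + ((q - p) * \<Lambda> ^ Suc k / \<delta> + 1)"
      using Y(2) G(2)[of "Suc k"] by linarith
    finally have 1: "real (card (X (Suc k))) + 2
        \<le> 2 * (real (card (X k)) + 2) + A (Suc k)" unfolding A_def by simp
    \<comment> \<open>Doubling turns \<open>2 * A k\<close> into \<open>4 * A k\<close>, which the
      growth of \<open>A\<close> pays for; the other \<open>A (Suc k)\<close> stands for the new
      grid points.\<close>
    have "4 * A k \<le> \<Lambda> * A k"
      using \<Lambda>(2) pq \<delta>(1) unfolding A_def by (intro mult_right_mono) auto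
    also have "\<dots> = A (Suc k)" unfolding A_def by simp
    finally show ?case using Suc.IH 1 by simp
  qed
  have "card (cuts \<beta> (m * k) \<inter> {p..q}) \<le> card (X k)"
    using finX unfolding X_def by (intro card_mono) auto
  moreover have "2 * (q - p) * \<Lambda> ^ k / \<delta> = 2 * A k" by (simp add: A_def)
  ultimately show ?thesis using bound by linarith
qed

lemma power_ge_4:
  fixes b :: real
  assumes "b > 1"
  obtains m where "m > 0" "4 \<le> b ^ m"
proof -
  obtain m where "4 < b ^ m" using real_arch_pow[OF assms] by blast
  then show ?thesis using that[of m] by (cases "m = 0") auto
qed

text \<open>With blocks of growth at least 4 the term \<open>2 ^ k\<close> is dominated by the main
  term. Rounding \<open>n\<close> up to a multiple of the block length costs one more constant
  factor.\<close>

lemma card_cuts_le: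
  assumes \<beta>: "\<bar>\<beta>\<bar> > 1"
  obtains C where "C > 0" "\<And>n. real (card (cuts \<beta> n)) \<le> C * \<bar>\<beta>\<bar> ^ n"
proof -
  obtain m where m: "m > 0" "4 \<le> \<bar>\<beta>\<bar> ^ m" using power_ge_4[OF \<beta>] .
  have \<beta>0: "\<beta> \<noteq> 0" using \<beta> by auto
  obtain d where d: "0 < d" "d \<le> 1" "\<And>x y. x \<in> cuts \<beta> m \<Longrightarrow> y \<in> cuts \<beta> m \<Longrightarrow> x \<noteq> y \<Longrightarrow> d \<le> \<bar>x - y\<bar>"
    using finite_min_separation[OF finite_cuts[OF \<beta>0]] by metis
  let ?\<Lambda> = "\<bar>\<beta>\<bar> ^ m"
  show ?thesis
  proof
    show "(3 + 2 / d) * ?\<Lambda> > 0" using d \<beta> by (intro mult_pos_pos add_pos_pos) auto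
    fix n
    let ?k = "n div m + 1"
    have mk: "n \<le> m * ?k" "m * ?k \<le> n + m"
      using dividend_less_times_div[OF m(1), of n] by simp_all
    have "real (card (cuts \<beta> n)) \<le> real (card (cuts \<beta> (m * ?k) \<inter> {0..1}))"
      using cuts_mono[OF mk(1), of \<beta>] finite_cuts[OF \<beta>0]
      by (intro of_nat_mono card_mono) (auto simp: cuts_def)
    also have "\<dots> \<le> 3 * 2 ^ ?k + 2 * (1 - 0) * ?\<Lambda> ^ ?k / d"
      by (rule card_cuts_interval[OF \<beta> refl m(2) d(1,3)]) auto
    also have "\<dots> \<le> 3 * ?\<Lambda> ^ ?k + 2 * (1 - 0) * ?\<Lambda> ^ ?k / d"
      using m(2) by (intro add_right_mono mult_left_mono power_mono) auto
    also have "\<dots> = (3 + 2 / d) * \<bar>\<beta>\<bar> ^ (m * ?k)"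
      by (simp only: power_mult distrib_right) simp
    also have "\<dots> \<le> (3 + 2 / d) * \<bar>\<beta>\<bar> ^ (n + m)"
      using mk(2) \<beta> d by (intro mult_left_mono power_increasing) auto
    finally show "real (card (cuts \<beta> n)) \<le> (3 + 2 / d) * ?\<Lambda> * \<bar>\<beta>\<bar> ^ n"
      by (simp add: power_add mult_ac)
  qed
qed

section \<open>Horseshoes\<close>

text \<open>
  Since all branches of the \<open>n\<close>-th iterate have slope \<open>\<beta> ^ n\<close>, a full branch over \<open>J\<close> is encoded
  by the offset \<open>s\<close> of its inverse \<open>y \<mapsto> (y + s) / \<beta> ^ n\<close>.
\<close>

definition branches :: "real \<Rightarrow> nat \<Rightarrow> real set \<Rightarrow> real set \<Rightarrow> real set" where
  "branches \<beta> n I J =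
     {s. \<forall>y\<in>J. (y + s) / \<beta> ^ n \<in> I \<and> (beta_map \<beta> ^^ n) ((y + s) / \<beta> ^ n) = y}"

text \<open>Otherwise the translates of \<open>{u..v}\<close> by \<open>s\<close> and
  \<open>s'\<close> overlap. At the left end \<open>u + max s s'\<close> of the overlap, divided by
  \<open>\<beta> ^ n\<close>, the iterate would have to take two different values.\<close>

lemma branches_separated:
  assumes "s \<in> branches \<beta> n I {u..v}" "s' \<in> branches \<beta> n I {u..v}" "s \<noteq> s'" "u \<le> v"
  shows "v - u \<le> \<bar>s - s'\<bar>"
proof (rule ccontr)
  assume "\<not> ?thesis"
  then have "\<exists>y\<in>{u..v}. \<exists>y'\<in>{u..v}. y + s = y' + s'"
    using \<open>u \<le> v\<close>
    by (intro bexI[of _ "u + max 0 (s' - s)"] bexI[of _ "u + max 0 (s - s')"]) (auto simp: max_def)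
  then obtain y y' where y: "y \<in> {u..v}" "y' \<in> {u..v}" "y + s = y' + s'" by auto
  have "(beta_map \<beta> ^^ n) ((y + s) / \<beta> ^ n) = y" "(beta_map \<beta> ^^ n) ((y' + s') / \<beta> ^ n) = y'"
    using y(1,2) assms(1,2) unfolding branches_def by blast+
  then show False using y(3) \<open>s \<noteq> s'\<close> by simp
qed

lemma finite_branches:
  assumes "\<beta> \<noteq> 0" "u < v" "I \<subseteq> {0..1}"
  shows "finite (branches \<beta> n I {u..v})"
proof (rule card_separated(1)[where L = "v - u"])
  let ?B = "\<bar>\<beta>\<bar> ^ n + \<bar>u\<bar>"
  show "branches \<beta> n I {u..v} \<subseteq> {- ?B .. ?B}"
  proof
    fix s assume "s \<in> branches \<beta> n I {u..v}"
    then have "(u + s) / \<beta> ^ n \<in> {0..1}" using assms unfolding branches_def by force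
    then have "\<bar>(u + s) / \<beta> ^ n\<bar> \<le> 1" by auto
    then have "\<bar>u + s\<bar> \<le> \<bar>\<beta>\<bar> ^ n"
      using assms(1) by (simp add: abs_divide power_abs field_simps)
    then show "s \<in> {- ?B .. ?B}" by auto
  qed
  show "v - u \<le> \<bar>s - s'\<bar>"
    if "s \<in> branches \<beta> n I {u..v}" "s' \<in> branches \<beta> n I {u..v}" "s \<noteq> s'" for s s'
    using branches_separated[OF that] assms(2) by simp
  have "0 \<le> \<bar>\<beta>\<bar> ^ n" by simp
  then show "- ?B \<le> ?B" by linarith
qed (use assms in auto)

text \<open>The composite of two inverse branches has offset \<open>s' + \<beta> ^ m * s\<close>.
  Both offsets can be read off from it, because \<open>n\<close> iterations bring the composite
  point back to \<open>(y + s') / \<beta> ^ m\<close>.\<close>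

lemma card_branches_compose:
  assumes "\<beta> \<noteq> 0" "u < v" "I \<subseteq> {0..1}"
  shows "card (branches \<beta> n I J) * card (branches \<beta> m J {u..v}) \<le> card (branches \<beta> (n + m) I {u..v})"
proof -
  let ?f = "\<lambda>(s, s'). s' + \<beta> ^ m * s"
  let ?A = "branches \<beta> n I J \<times> branches \<beta> m J {u..v}"
  have comp: "(y + (s' + \<beta> ^ m * s)) / \<beta> ^ (n + m) = ((y + s') / \<beta> ^ m + s) / \<beta> ^ n" for y s s'
    using assms(1) by (simp add: field_simps power_add)
  have fst: "(beta_map \<beta> ^^ n) ((y + (s' + \<beta> ^ m * s)) / \<beta> ^ (n + m)) = (y + s') / \<beta> ^ m"
    if "s \<in> branches \<beta> n I J" "s' \<in> branches \<beta> m J {u..v}" "y \<in> {u..v}" for s s' y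
    using that unfolding comp branches_def by blast
  have sub: "?f ` ?A \<subseteq> branches \<beta> (n + m) I {u..v}"
  proof clarsimp
    fix s s' assume s: "s \<in> branches \<beta> n I J" "s' \<in> branches \<beta> m J {u..v}"
    have "(beta_map \<beta> ^^ (n + m)) ((y + (s' + \<beta> ^ m * s)) / \<beta> ^ (n + m)) = y" if "y \<in> {u..v}" for y
      using s(2) that unfolding add.commute[of n m] funpow_add comp_apply
      unfolding add.commute[of m n] fst[OF s that] branches_def by blast
    moreover have "(y + (s' + \<beta> ^ m * s)) / \<beta> ^ (n + m) \<in> I" if "y \<in> {u..v}" for y
      using s that unfolding comp branches_def by blast
    ultimately show "s' + \<beta> ^ m * s \<in> branches \<beta> (n + m) I {u..v}"
      unfolding branches_def by blast
  qed
  have inj: "inj_on ?f ?A"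
  proof (rule inj_onI, clarsimp)
    fix s1 s1' s2 s2'
    assume s: "s1 \<in> branches \<beta> n I J" "s1' \<in> branches \<beta> m J {u..v}"
      "s2 \<in> branches \<beta> n I J" "s2' \<in> branches \<beta> m J {u..v}"
      and eq: "s1' + \<beta> ^ m * s1 = s2' + \<beta> ^ m * s2"
    have "u \<in> {u..v}" using assms(2) by simp
    then have "s1' = s2'"
      using fst[OF s(1,2), of u] fst[OF s(3,4), of u] assms(1) unfolding eq by simp
    then show "s1 = s2 \<and> s1' = s2'" using eq assms(1) by simp
  qed
  have "card ?A \<le> card (branches \<beta> (n + m) I {u..v})"
    using card_inj_on_le[OF inj sub finite_branches[OF assms]] .
  then show ?thesis by (simp add: card_cartesian_product)
qed

lemma card_int_interval_ge:
  fixes a b :: real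
  shows "b - a - 2 \<le> real (card {\<lceil>a\<rceil> ..< \<lfloor>b\<rfloor>})"
  by (simp; linarith)

text \<open>
  The cells of mesh \<open>\<eta> / \<Lambda> ^ k\<close> that contain no cut point are mapped onto intervals of length
  \<open>\<eta>\<close>, each of which contains one of the grid intervals of length \<open>\<eta> / 3\<close>.
\<close>

lemma many_branches_out:
  assumes \<beta>: "\<bar>\<beta>\<bar> > 1" and \<Lambda>: "\<Lambda> = \<bar>\<beta>\<bar> ^ m" "4 \<le> \<Lambda>" "0 < m"
    and \<delta>: "0 < \<delta>" "\<And>x y. x \<in> cuts \<beta> m \<Longrightarrow> y \<in> cuts \<beta> m \<Longrightarrow> x \<noteq> y \<Longrightarrow> \<delta> \<le> \<bar>x - y\<bar>"
    and \<eta>: "\<eta> = \<delta> / 4" and D: "\<And>b. D b = {of_int b * (\<eta> / 3) .. (of_int b + 1) * (\<eta> / 3)}"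
    and B: "B = {b::int. 0 \<le> b \<and> (of_int b + 1) * (\<eta> / 3) \<le> 1}"
    and a: "a \<in> B" and k: "6 \<le> k"
  shows "\<Lambda> ^ k / 12 \<le> (\<Sum>b\<in>B. real (card (branches \<beta> (m * k) (D a) (D b))))"
proof -
  have \<beta>0: "\<beta> \<noteq> 0" using \<beta> by auto
  have \<eta>0: "0 < \<eta>" using \<eta> \<delta> by simp
  define c where "c = \<eta> / \<Lambda> ^ k"
  have c0: "0 < c" using \<eta>0 \<Lambda>(2) c_def by simp
  define p q where "p = of_int a * (\<eta> / 3)" and "q = (of_int a + 1) * (\<eta> / 3)"
  have Da: "D a = {p..q}" using D p_def q_def by simp
  have qp: "q - p = \<eta> / 3" by (simp add: p_def q_def algebra_simps)
  have pq: "0 \<le> p" "p \<le> q" "q \<le> 1" using a \<eta>0 qp unfolding B p_def q_def by auto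
  define cell where "cell j = {of_int j * c <..< (of_int j + 1) * c}" for j :: int
  define All where "All = {\<lceil>p / c\<rceil> ..< \<lfloor>q / c\<rfloor>}"
  define Bad where "Bad = {j\<in>All. cell j \<inter> cuts \<beta> (m * k) \<noteq> {}}"
  have cell_pq: "cell j \<subseteq> {p..q}" if "j \<in> All" for j
  proof -
    have "p / c \<le> of_int j" "of_int j + 1 \<le> q / c" using that unfolding All_def by (auto simp: ceiling_le_iff less_floor_iff)
    then have "p \<le> of_int j * c" "(of_int j + 1) * c \<le> q" using c0 by (simp_all add: field_simps)
    then show ?thesis unfolding cell_def by auto
  qed
  have cell_disj: "i = j" if "x \<in> cell i" "x \<in> cell j" for x i j
  proof -
    have "of_int i * c < (of_int j + 1) * c" "of_int j * c < (of_int i + 1) * c"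
      using that unfolding cell_def by auto
    then have "real_of_int i < of_int j + 1" "real_of_int j < of_int i + 1"
      using c0 by (simp_all only: mult_less_cancel_right_pos)
    then show ?thesis by linarith
  qed
  have "card Bad \<le> card (cuts \<beta> (m * k) \<inter> {p..q})"
  proof -
    have "\<forall>j\<in>Bad. \<exists>x. x \<in> cell j \<and> x \<in> cuts \<beta> (m * k)" unfolding Bad_def by auto
    then obtain g where g: "\<And>j. j \<in> Bad \<Longrightarrow> g j \<in> cell j \<and> g j \<in> cuts \<beta> (m * k)" by metis
    have "inj_on g Bad" using g cell_disj by (metis inj_onI)
    moreover have "g ` Bad \<subseteq> cuts \<beta> (m * k) \<inter> {p..q}"
      using g cell_pq unfolding Bad_def by blast
    ultimately show ?thesis using card_inj_on_le finite_cuts[OF \<beta>0] by blast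
  qed
  then have "real (card Bad) \<le> real (card (cuts \<beta> (m * k) \<inter> {p..q}))" by simp
  also have "\<dots> \<le> 3 * 2 ^ k + 2 * (q - p) * \<Lambda> ^ k / \<delta>"
    by (rule card_cuts_interval[OF \<beta> \<Lambda>(1,2) \<delta> pq])
  \<comment> \<open>Here \<open>q - p = \<delta> / 12\<close>. The choice \<eta> =
    \<open>\<delta> / 4\<close> makes the main term of the number of cuts half of the
    \<open>\<Lambda> ^ k / 3\<close> cells.\<close>
  also have "2 * (q - p) * \<Lambda> ^ k / \<delta> = \<Lambda> ^ k / 6" using \<delta>(1) by (simp add: qp \<eta>)
  finally have bad: "real (card Bad) \<le> 3 * 2 ^ k + \<Lambda> ^ k / 6" .
  have "(q - p) / c = \<Lambda> ^ k / 3"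
    unfolding qp c_def using \<eta>0 \<Lambda>(2) by simp
  then have "q / c - p / c = \<Lambda> ^ k / 3" by (simp add: diff_divide_distrib)
  then have all: "\<Lambda> ^ k / 3 - 2 \<le> real (card All)"
    using card_int_interval_ge[of "q / c" "p / c"] unfolding All_def by linarith
  \<comment> \<open>The surplus of cells over cuts is \<open>\<Lambda> ^ k / 6\<close> up to these
    lower order terms. From \<open>k = 6\<close> on they take at most half of it, which leaves
    \<open>\<Lambda> ^ k / 12\<close>.\<close>
  have growth: "3 * 2 ^ k + 2 \<le> \<Lambda> ^ k / 12"
  proof -
    have "(2::real) ^ 6 \<le> 2 ^ k" using k by (intro power_increasing) auto
    then have "(60::real) * 2 ^ k \<le> 2 ^ k * 2 ^ k" by (intro mult_right_mono) auto
    also have "\<dots> = 4 ^ k" by (simp flip: power_mult_distrib)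
    also have "\<dots> \<le> \<Lambda> ^ k" using \<Lambda>(2) by (intro power_mono) auto
    finally have "60 * 2 ^ k \<le> \<Lambda> ^ k" .
    moreover have "(1::real) \<le> 2 ^ k" by simp
    ultimately show ?thesis by linarith
  qed
  define Good where "Good = All - Bad"
  have finAll: "finite All" unfolding All_def by simp
  have "real (card Good) = real (card All) - real (card Bad)"
    unfolding Good_def using finAll
    by (subst card_Diff_subset) (auto simp: Bad_def intro: card_mono of_nat_diff finite_subset)
  then have good: "\<Lambda> ^ k / 12 \<le> real (card Good)" using bad all growth by linarith
  have br: "\<exists>b s. b \<in> B \<and> s \<in> branches \<beta> (m * k) (D a) (D b) \<and> (\<forall>y\<in>D b. (y + s) / \<beta> ^ (m * k) \<in> cell j)"
    if j: "j \<in> Good" for j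
  proof -
    have sub: "cell j \<subseteq> {p..q}" using cell_pq j unfolding Good_def by auto
    have "connected (cell j)" unfolding cell_def by simp
    moreover have "cell j \<subseteq> {0..1}" using sub pq by auto
    moreover have "cell j \<inter> cuts \<beta> (m * k) = {}" using j unfolding Good_def Bad_def by auto
    ultimately obtain s where s: "\<And>x. x \<in> cell j \<Longrightarrow> (beta_map \<beta> ^^ (m * k)) x = \<beta> ^ (m * k) * x - s"
      using beta_map_iter_affine by blast
    define x0 where "x0 = (of_int j + 1 / 2) * c"
    define z0 where "z0 = \<beta> ^ (m * k) * x0 - s"
    \<comment> \<open>The first grid interval that starts beyond \<open>z0 - \<eta> / 2\<close>.
      Having length \<open>\<eta> / 3\<close>, it stays inside the image of the cell, the open
      interval of radius \<open>\<eta> / 2\<close> about \<open>z0\<close>.\<close>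
    define b where "b = \<lfloor>(z0 - \<eta> / 2) / (\<eta> / 3)\<rfloor> + 1"
    have 1: "(z0 - \<eta> / 2) / (\<eta> / 3) < of_int b" "of_int b \<le> (z0 - \<eta> / 2) / (\<eta> / 3) + 1"
      unfolding b_def by linarith+
    have cancel: "(z0 - \<eta> / 2) / (\<eta> / 3) * (\<eta> / 3) = z0 - \<eta> / 2" using \<eta>0 by simp
    from 1 have "(z0 - \<eta> / 2) / (\<eta> / 3) * (\<eta> / 3) < of_int b * (\<eta> / 3)"
      "of_int b * (\<eta> / 3) \<le> ((z0 - \<eta> / 2) / (\<eta> / 3) + 1) * (\<eta> / 3)"
      using \<eta>0 by (simp_all only: mult_less_cancel_right_pos mult_le_cancel_right_pos)
    then have b: "z0 - \<eta> / 2 < of_int b * (\<eta> / 3)" "of_int b * (\<eta> / 3) \<le> z0 - \<eta> / 6"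
      using cancel unfolding distrib_right cancel by linarith+
    have Db: "\<bar>y - z0\<bar> < \<eta> / 2" if "y \<in> D b" for y
      using that b \<eta>0 unfolding D distrib_right atLeastAtMost_iff by linarith
    have inv: "(y + s) / \<beta> ^ (m * k) \<in> cell j" if "y \<in> D b" for y
    proof -
      have "(y + s) / \<beta> ^ (m * k) - x0 = (y - z0) / \<beta> ^ (m * k)"
        using \<beta>0 by (simp add: z0_def field_simps)
      then have "\<bar>(y + s) / \<beta> ^ (m * k) - x0\<bar> = \<bar>y - z0\<bar> / \<Lambda> ^ k"
        by (simp add: abs_divide \<Lambda>(1) power_abs power_mult)
      also have "\<dots> < c / 2"
        using divide_strict_right_mono[OF Db[OF that], of "\<Lambda> ^ k"] \<Lambda>(2) unfolding c_def by (simp add: mult.commute)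
      finally have "x0 - c / 2 < (y + s) / \<beta> ^ (m * k)" "(y + s) / \<beta> ^ (m * k) < x0 + c / 2"
        by linarith+
      then show ?thesis unfolding cell_def x0_def by (simp add: algebra_simps)
    qed
    have iter: "(beta_map \<beta> ^^ (m * k)) ((y + s) / \<beta> ^ (m * k)) = y" if "y \<in> D b" for y
      using s[OF inv[OF that]] \<beta>0 by simp
    \<comment> \<open>At least one step has been taken, so the values lie in [0,1); this forces the
      grid interval found above to be one of those indexed by \<open>B\<close>.\<close>
    have "0 < m * k" using \<Lambda>(3) k by simp
    then have unit: "0 \<le> y \<and> y < 1" if "y \<in> D b" for y
      using beta_map_iter_bounds iter[OF that] by metis
    have "b \<in> B"
    proof -
      have ends: "of_int b * (\<eta> / 3) \<in> D b" "(of_int b + 1) * (\<eta> / 3) \<in> D b"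
        using \<eta>0 unfolding D by (auto intro: mult_right_mono)
      have "0 \<le> b" using unit[OF ends(1)] \<eta>0 by (simp add: zero_le_mult_iff)
      then show ?thesis using unit[OF ends(2)] unfolding B by simp
    qed
    moreover have "s \<in> branches \<beta> (m * k) (D a) (D b)"
      using inv iter sub unfolding branches_def Da by blast
    ultimately show ?thesis using inv by blast
  qed
  obtain fb fs where f: "\<And>j. j \<in> Good \<Longrightarrow> fb j \<in> B \<and> fs j \<in> branches \<beta> (m * k) (D a) (D (fb j)) \<and>
      (\<forall>y\<in>D (fb j). (y + fs j) / \<beta> ^ (m * k) \<in> cell j)"
    using br by metis
  have finB: "finite B"
  proof (rule finite_subset)
    show "B \<subseteq> {0..\<lfloor>3 / \<eta>\<rfloor>}" using \<eta>0 unfolding B by (auto simp: le_floor_iff field_simps)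
  qed simp
  have "D a \<subseteq> {0..1}" using Da pq by auto
  then have fin: "finite (branches \<beta> (m * k) (D a) (D b))" for b
    unfolding D[of b] using \<eta>0 by (intro finite_branches[OF \<beta>0]) (auto simp: algebra_simps)
  \<comment> \<open>The pair determines the cell: the inverse branch sends the left end of
    \<open>D b\<close> into it, and cells are disjoint.\<close>
  have "inj_on (\<lambda>j. (fb j, fs j)) Good"
  proof (rule inj_onI, clarsimp)
    fix i j assume ij: "i \<in> Good" "j \<in> Good" "fb i = fb j" "fs i = fs j"
    have "of_int (fb i) * (\<eta> / 3) \<in> D (fb i)" using \<eta>0 unfolding D by (auto intro: mult_right_mono)
    then show "i = j" using f[OF ij(1)] f[OF ij(2)] ij(3,4) cell_disj by metis
  qed
  moreover have "(\<lambda>j. (fb j, fs j)) ` Good \<subseteq> (SIGMA b:B. branches \<beta> (m * k) (D a) (D b))"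
    using f by auto
  ultimately have "card Good \<le> card (SIGMA b:B. branches \<beta> (m * k) (D a) (D b))"
    using finB fin by (intro card_inj_on_le) auto
  also have "\<dots> = (\<Sum>b\<in>B. card (branches \<beta> (m * k) (D a) (D b)))"
    using finB fin by (simp add: card_SigmaI)
  finally have "real (card Good) \<le> (\<Sum>b\<in>B. real (card (branches \<beta> (m * k) (D a) (D b))))"
    by (metis of_nat_le_iff of_nat_sum)
  then show ?thesis using good by linarith
qed

lemma funpow_cycle:
  fixes f :: "'a \<Rightarrow> 'a"
  assumes "finite B" "f ` B \<subseteq> B" "a \<in> B"
  obtains b p where "b \<in> B" "0 < p" "(f ^^ p) b = b"
proof -
  have inB: "(f ^^ i) a \<in> B" for i by (induction i) (use assms in auto)
  then have "\<not> inj (\<lambda>i. (f ^^ i) a)"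
    using finite_subset[OF _ assms(1)] finite_imageD by (metis image_subsetI infinite_UNIV_nat)
  then obtain i j where ij: "i < j" "(f ^^ i) a = (f ^^ j) a"
    unfolding inj_def by (metis linorder_neqE_nat)
  show ?thesis
  proof (rule that[of "(f ^^ i) a" "j - i"])
    show "(f ^^ (j - i)) ((f ^^ i) a) = (f ^^ i) a"
      using ij by (metis comp_apply funpow_add le_add_diff_inverse2 less_imp_le)
  qed (use inB ij in auto)
qed

lemma exists_ge_average:
  fixes g :: "'a \<Rightarrow> real"
  assumes "finite B" "B \<noteq> {}" "S \<le> sum g B"
  shows "\<exists>b\<in>B. S / real (card B) \<le> g b"
proof (rule ccontr)
  assume "\<not> ?thesis"
  then have "sum g B < (\<Sum>b\<in>B. S / real (card B))"
    using assms by (intro sum_strict_mono) auto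
  then show False using assms by simp
qed

text \<open>
  Every grid interval has at least \<open>\<kappa> \<Lambda> ^ k\<close> branches onto some other grid interval \<open>D (f a)\<close>;
  a horseshoe is found on a cycle of \<open>f\<close>.
\<close>

lemma horseshoe_exists:
  assumes \<beta>: "\<bar>\<beta>\<bar> > 1" and \<epsilon>: "\<epsilon> > 0"
  obtains m u v where "0 < m" "0 \<le> u" "u < v" "v \<le> 1"
    "exp (real m * (ln \<bar>\<beta>\<bar> - \<epsilon>)) \<le> real (card (branches \<beta> m {u..v} {u..v}))"
proof -
  have \<beta>0: "\<beta> \<noteq> 0" using \<beta> by auto
  obtain m where m: "m > 0" "4 \<le> \<bar>\<beta>\<bar> ^ m" using power_ge_4[OF \<beta>] .
  obtain \<delta> where \<delta>: "0 < \<delta>" "\<delta> \<le> 1" "\<And>x y. x \<in> cuts \<beta> m \<Longrightarrow> y \<in> cuts \<beta> m \<Longrightarrow> x \<noteq> y \<Longrightarrow> \<delta> \<le> \<bar>x - y\<bar>"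
    using finite_min_separation[OF finite_cuts[OF \<beta>0]] by metis
  define \<eta> where "\<eta> = \<delta> / 4"
  have \<eta>0: "0 < \<eta>" using \<delta> \<eta>_def by simp
  define D where "D b = {of_int b * (\<eta> / 3) .. (of_int b + 1) * (\<eta> / 3)}" for b :: int
  define B where "B = {b::int. 0 \<le> b \<and> (of_int b + 1) * (\<eta> / 3) \<le> 1}"
  have B0: "0 \<in> B" using \<delta> unfolding B_def \<eta>_def by simp
  have finB: "finite B"
  proof (rule finite_subset)
    show "B \<subseteq> {0..\<lfloor>3 / \<eta>\<rfloor>}" using \<eta>0 unfolding B_def by (auto simp: le_floor_iff field_simps)
  qed simp
  have D: "D b \<subseteq> {0..1}" if "b \<in> B" for b
  proof -
    have "0 \<le> of_int b * (\<eta> / 3)" using that \<eta>0 unfolding B_def by simp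
    then show ?thesis using that unfolding B_def D_def by auto
  qed
  define \<kappa> where "\<kappa> = 1 / 12 / real (card B)"
  have \<kappa>0: "\<kappa> > 0" using finB B0 unfolding \<kappa>_def by (auto simp: card_gt_0_iff)
  \<comment> \<open>The loss \<kappa> per block comes from choosing the best of
    \<open>card B\<close> targets. It does not depend on the block length, so long blocks push it
    below \<open>exp (- m * \<epsilon> * k)\<close>.\<close>
  obtain k0 where k0: "- ln \<kappa> / (real m * \<epsilon>) < real k0" using reals_Archimedean2 by blast
  define k where "k = max 6 k0"
  have k: "6 \<le> k" "- ln \<kappa> \<le> real m * \<epsilon> * real k"
  proof -
    have "- ln \<kappa> / (real m * \<epsilon>) \<le> real k" using k0 unfolding k_def by linarith
    then show "- ln \<kappa> \<le> real m * \<epsilon> * real k" using m \<epsilon> by (simp add: field_simps)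
  qed (simp add: k_def)
  have "\<exists>b\<in>B. \<kappa> * (\<bar>\<beta>\<bar> ^ m) ^ k \<le> real (card (branches \<beta> (m * k) (D a) (D b)))" if "a \<in> B" for a
    using exists_ge_average[OF finB _ many_branches_out[OF \<beta> refl m(2,1) \<delta>(1,3) \<eta>_def D_def B_def that k(1)]] B0
    unfolding \<kappa>_def by auto
  then obtain f where f: "\<And>a. a \<in> B \<Longrightarrow> f a \<in> B"
    "\<And>a. a \<in> B \<Longrightarrow> \<kappa> * (\<bar>\<beta>\<bar> ^ m) ^ k \<le> real (card (branches \<beta> (m * k) (D a) (D (f a))))"
    by metis
  obtain b p where b: "b \<in> B" "0 < p" "(f ^^ p) b = b"
    using funpow_cycle[OF finB _ B0, of f] f(1) by blast
  let ?\<mu> = "\<kappa> * (\<bar>\<beta>\<bar> ^ m) ^ k"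
  have \<mu>0: "0 \<le> ?\<mu>" using \<kappa>0 by simp
  have inB: "(f ^^ i) b \<in> B" for i by (induction i) (use f b in auto)
  have pow: "?\<mu> ^ i \<le> real (card (branches \<beta> (m * k * i) (D b) (D ((f ^^ i) b))))" for i
  proof (induction i)
    case 0
    have "branches \<beta> 0 (D b) (D b) = {0}"
    proof
      have "of_int b * (\<eta> / 3) \<in> D b" using \<eta>0 unfolding D_def by (auto intro: mult_right_mono)
      then show "branches \<beta> 0 (D b) (D b) \<subseteq> {0}" unfolding branches_def by force
    qed (auto simp: branches_def)
    then show ?case by simp
  next
    case (Suc i)
    let ?c = "(f ^^ i) b"
    have "of_int (f ?c) * (\<eta> / 3) < (of_int (f ?c) + 1) * (\<eta> / 3)"
      using \<eta>0 by (intro mult_strict_right_mono) auto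
    then have "card (branches \<beta> (m * k * i) (D b) (D ?c)) * card (branches \<beta> (m * k) (D ?c) (D (f ?c)))
        \<le> card (branches \<beta> (m * k * i + m * k) (D b) (D (f ?c)))"
      unfolding D_def[of "f ?c"] using D[OF b(1)] by (intro card_branches_compose[OF \<beta>0]) auto
    then have "real (card (branches \<beta> (m * k * i) (D b) (D ?c))) * real (card (branches \<beta> (m * k) (D ?c) (D (f ?c))))
        \<le> real (card (branches \<beta> (m * k * i + m * k) (D b) (D (f ?c))))"
      by (metis of_nat_le_iff of_nat_mult)
    moreover have "?\<mu> ^ i * ?\<mu> \<le> real (card (branches \<beta> (m * k * i) (D b) (D ?c))) * real (card (branches \<beta> (m * k) (D ?c) (D (f ?c))))"
      using Suc f(2)[OF inB] \<mu>0 by (intro mult_mono) auto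
    ultimately show ?case by (simp add: algebra_simps)
  qed
  show ?thesis
  proof
    show "0 < m * k * p" using m b k by simp
    show "0 \<le> of_int b * (\<eta> / 3)" "(of_int b + 1) * (\<eta> / 3) \<le> 1" using b(1) \<eta>0 unfolding B_def by auto
    show "of_int b * (\<eta> / 3) < (of_int b + 1) * (\<eta> / 3)" using \<eta>0 by (intro mult_strict_right_mono) auto
    have "exp (real (m * k) * (ln \<bar>\<beta>\<bar> - \<epsilon>)) = \<bar>\<beta>\<bar> ^ (m * k) * exp (- (real m * \<epsilon> * real k))"
    proof -
      have "exp (real (m * k) * ln \<bar>\<beta>\<bar>) = \<bar>\<beta>\<bar> ^ (m * k)"
        unfolding exp_of_nat_mult using \<beta> by simp
      moreover have "real (m * k) * (ln \<bar>\<beta>\<bar> - \<epsilon>) = real (m * k) * ln \<bar>\<beta>\<bar> + - (real m * \<epsilon> * real k)"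
        by (simp add: algebra_simps)
      ultimately show ?thesis by (simp only: exp_add)
    qed
    also have "\<dots> \<le> \<bar>\<beta>\<bar> ^ (m * k) * exp (ln \<kappa>)" using k(2) by (intro mult_left_mono) auto
    also have "\<dots> = ?\<mu>" using \<kappa>0 by (simp only: power_mult exp_ln) (simp only: mult.commute)
    finally have "exp (real (m * k) * (ln \<bar>\<beta>\<bar> - \<epsilon>)) \<le> ?\<mu>" .
    then have "exp (real (m * k) * (ln \<bar>\<beta>\<bar> - \<epsilon>)) ^ p \<le> ?\<mu> ^ p" by (intro power_mono) auto
    also have "\<dots> \<le> real (card (branches \<beta> (m * k * p) (D b) (D b)))" using pow[of p] b(3) by simp
    finally show "exp (real (m * k * p) * (ln \<bar>\<beta>\<bar> - \<epsilon>)) \<le> real (card (branches \<beta> (m * k * p)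
        {of_int b * (\<eta> / 3) .. (of_int b + 1) * (\<eta> / 3)} {of_int b * (\<eta> / 3) .. (of_int b + 1) * (\<eta> / 3)}))"
      by (simp add: exp_of_nat_mult[symmetric] D_def mult_ac)
  qed
qed

text \<open>Needed to replace the periods found for the separate coordinates by a common
  multiple.\<close>

lemma card_branches_power:
  assumes "\<beta> \<noteq> 0" "u < v" "0 \<le> u" "v \<le> 1"
  shows "card (branches \<beta> m {u..v} {u..v}) ^ q \<le> card (branches \<beta> (m * q) {u..v} {u..v})"
proof (induction q)
  case 0
  have "branches \<beta> 0 {u..v} {u..v} = {0}"
    using assms(2) by (force simp: branches_def)
  then show ?case by simp
next
  case (Suc q)
  have "card (branches \<beta> m {u..v} {u..v}) ^ Suc q
      \<le> card (branches \<beta> m {u..v} {u..v}) * card (branches \<beta> (m * q) {u..v} {u..v})"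
    using Suc by simp
  also have "\<dots> \<le> card (branches \<beta> (m + m * q) {u..v} {u..v})"
    using assms by (intro card_branches_compose) auto
  finally show ?case by simp
qed

section \<open>Covering the set of near returns\<close>

text \<open>The Hausdorff-Cantelli lemma. Every tail of the sequence of covers covers the limsup set
  \<open>A\<close>, and tails of a convergent series are small. The finite covers are merged into
  one sequence by \<open>prod_decode\<close> and padded with empty sets, which have weight
  0.\<close>

lemma hausdorff_measure_eq_0I:
  fixes A :: "'a::metric_space set" and \<C> :: "nat \<Rightarrow> 'a set set"
  assumes A: "\<And>x. x \<in> A \<Longrightarrow> \<exists>\<^sub>\<infinity>n. x \<in> E n"
    and cover: "\<And>n. M \<le> n \<Longrightarrow> E n \<subseteq> \<Union>(\<C> n)"
    and fin: "\<And>n. M \<le> n \<Longrightarrow> finite (\<C> n)"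
    and small: "\<And>n X. M \<le> n \<Longrightarrow> X \<in> \<C> n \<Longrightarrow> bounded X \<and> diameter X \<le> r n"
    and r: "r \<longlonglongrightarrow> 0" and s: "0 < s"
    and a: "\<And>n. M \<le> n \<Longrightarrow> real (card (\<C> n)) * r n powr s \<le> a n" "summable a" "\<And>n. 0 \<le> a n"
  shows "hausdorff_measure s A = 0"
proof -
  have "hausdorff_premeasure s \<delta> A \<le> ennreal e" if \<delta>: "0 < \<delta>" and e: "0 < e" for \<delta> e :: real
  proof -
    obtain N1 where N1: "\<And>n. N1 \<le> n \<Longrightarrow> norm (\<Sum>i. a (i + n)) < e"
      using suminf_exist_split[OF e a(2)] by blast
    have "eventually (\<lambda>n. r n < \<delta>) sequentially" using order_tendstoD(2)[OF r \<delta>] .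
    then obtain N2 where N2: "\<And>n. N2 \<le> n \<Longrightarrow> r n < \<delta>" unfolding eventually_sequentially by blast
    define N where "N = Max {M, N1, N2}"
    have N: "M \<le> N" "N1 \<le> N" "N2 \<le> N" unfolding N_def by auto
    have "\<exists>h. bij_betw h {0..<card (\<C> (n + N))} (\<C> (n + N))" for n
      using ex_bij_betw_nat_finite fin N(1) by (meson trans_le_add2)
    then obtain h where h: "\<And>n. bij_betw (h n) {0..<card (\<C> (n + N))} (\<C> (n + N))" by metis
    define f where "f = (\<lambda>(n, j). if j < card (\<C> (n + N)) then h n j else {})"
    have f_in: "f (n, j) \<in> \<C> (n + N)" if "j < card (\<C> (n + N))" for n j
      using h[of n] that unfolding f_def bij_betw_def by auto
    have MnN: "M \<le> n + N" for n using N(1) by simp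
    have "(\<lambda>i. f (prod_decode i)) \<in> delta_covers \<delta> A"
      unfolding delta_covers_def
    proof (intro CollectI conjI allI subsetI)
      fix x assume "x \<in> A"
      then obtain n where n: "N \<le> n" "x \<in> E n" using A unfolding INFM_nat_le by blast
      then obtain X where X: "X \<in> \<C> n" "x \<in> X" using cover[of n] N(1) by (meson UnionE order_trans subsetD)
      have nN: "n - N + N = n" using n by simp
      have im: "h (n - N) ` {0..<card (\<C> n)} = \<C> n" using h[of "n - N"] unfolding bij_betw_def nN by simp
      have "X \<in> h (n - N) ` {0..<card (\<C> n)}" using X(1) by (simp only: im)
      then obtain j where "j < card (\<C> n)" "h (n - N) j = X" by auto
      then have "x \<in> f (prod_decode (prod_encode (n - N, j)))" using X nN by (simp add: f_def)
      then show "x \<in> (\<Union>i. f (prod_decode i))" by blast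
    next
      fix i
      obtain n j where nj: "prod_decode i = (n, j)" by fastforce
      have *: "r (n + N) < \<delta>" using N2 N(3) by simp
      have "bounded (f (n, j)) \<and> diameter (f (n, j)) \<le> \<delta>"
      proof (cases "j < card (\<C> (n + N))")
        case True
        then show ?thesis using small[OF MnN f_in[OF True]] * by simp
      next
        case False
        then have "f (n, j) = {}" by (simp add: f_def)
        then show ?thesis using \<delta> by simp
      qed
      then show "bounded (f (prod_decode i))" "diameter (f (prod_decode i)) \<le> \<delta>"
        unfolding nj by auto
    qed
    then have "hausdorff_premeasure s \<delta> A \<le> (\<Sum>i. diam_pow s (f (prod_decode i)))"
      unfolding hausdorff_premeasure_def by (rule INF_lower)
    also have "\<dots> = (\<Sum>n. \<Sum>j. diam_pow s (f (n, j)))"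
      by (rule suminf_ennreal_2dimen[where f = "\<lambda>z. diam_pow s (f z)"]) simp
    also have "\<dots> \<le> (\<Sum>n. ennreal (a (n + N)))"
    proof (rule suminf_le)
      fix n
      have "(\<Sum>j. diam_pow s (f (n, j))) = (\<Sum>j<card (\<C> (n + N)). diam_pow s (f (n, j)))"
        by (rule suminf_finite) (auto simp: f_def diam_pow_def)
      also have "\<dots> \<le> (\<Sum>j<card (\<C> (n + N)). ennreal (r (n + N) powr s))"
      proof (rule sum_mono)
        fix j assume "j \<in> {..<card (\<C> (n + N))}"
        then have X: "bounded (f (n, j))" "diameter (f (n, j)) \<le> r (n + N)"
          using small[OF MnN f_in] by auto
        have "diameter (f (n, j)) powr s \<le> r (n + N) powr s"
          using X diameter_ge_0 s by (intro powr_mono2) auto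
        then show "diam_pow s (f (n, j)) \<le> ennreal (r (n + N) powr s)"
          using s by (auto simp: diam_pow_def intro: ennreal_leI)
      qed
      also have "\<dots> = ennreal (real (card (\<C> (n + N))) * r (n + N) powr s)"
        by (simp add: ennreal_mult ennreal_of_nat_eq_real_of_nat)
      also have "\<dots> \<le> ennreal (a (n + N))" using a(1)[OF MnN] by (rule ennreal_leI)
      finally show "(\<Sum>j. diam_pow s (f (n, j))) \<le> ennreal (a (n + N))" .
    qed auto
    also have "\<dots> = ennreal (\<Sum>n. a (n + N))"
      using a(2,3) by (intro suminf_ennreal2) (auto simp: summable_iff_shift)
    also have "\<dots> \<le> ennreal e" using N1[OF N(2)] by (intro ennreal_leI) auto
    finally show ?thesis .
  qed
  then have "hausdorff_premeasure s \<delta> A = 0" if "0 < \<delta>" for \<delta>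
    using that by (metis ennreal_le_epsilon add_0 le_zero_eq)
  then show ?thesis unfolding hausdorff_measure_def by simp
qed

lemma card_floor_image_le:
  assumes "0 < r" "0 \<le> w" and spread: "\<And>x y. x \<in> A \<Longrightarrow> y \<in> A \<Longrightarrow> \<bar>x - y\<bar> \<le> w"
  shows "finite ((\<lambda>x. \<lfloor>x / r\<rfloor>) ` A)" "real (card ((\<lambda>x. \<lfloor>x / r\<rfloor>) ` A)) \<le> w / r + 2"
proof -
  let ?f = "\<lambda>x. \<lfloor>x / r\<rfloor>"
  let ?F = "?f ` A"
  have w: "0 \<le> w / r" using assms by simp
  have near: "real_of_int i \<le> of_int j + w / r + 1" if ij: "i \<in> ?F" "j \<in> ?F" for i j
  proof -
    obtain x y where xy: "x \<in> A" "y \<in> A" "i = ?f x" "j = ?f y" using ij by auto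
    have "x / r - y / r \<le> w / r"
      using spread[OF xy(1,2)] assms(1) by (simp add: diff_divide_distrib[symmetric] divide_right_mono)
    then show ?thesis unfolding xy(3,4) by linarith
  qed
  show "finite ?F"
  proof (cases "A = {}")
    case False
    then obtain j where j: "j \<in> ?F" by auto
    have "?F \<subseteq> {j - \<lceil>w / r\<rceil> - 1 .. j + \<lceil>w / r\<rceil> + 1}"
    proof
      fix i assume "i \<in> ?F"
      then show "i \<in> {j - \<lceil>w / r\<rceil> - 1 .. j + \<lceil>w / r\<rceil> + 1}"
        using near[of i j] near[of j i] j unfolding atLeastAtMost_iff by linarith
    qed
    then show ?thesis using finite_subset by blast
  qed simp
  then have fin: "finite ?F" .
  show "real (card ?F) \<le> w / r + 2"
  proof (cases "?F = {}")
    case False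
    have Min: "Min ?F \<in> ?F" using fin False by (rule Min_in)
    have "?F \<subseteq> {Min ?F .. Min ?F + \<lfloor>w / r + 1\<rfloor>}"
    proof
      fix i assume i: "i \<in> ?F"
      then have "Min ?F \<le> i" using fin by simp
      moreover have "i \<le> Min ?F + \<lfloor>w / r + 1\<rfloor>" using near[OF i Min] by linarith
      ultimately show "i \<in> {Min ?F .. Min ?F + \<lfloor>w / r + 1\<rfloor>}" by simp
    qed
    then have "card ?F \<le> card {Min ?F .. Min ?F + \<lfloor>w / r + 1\<rfloor>}" by (intro card_mono) auto
    also have "\<dots> = nat (\<lfloor>w / r + 1\<rfloor> + 1)" by simp
    finally have "real (card ?F) \<le> real (nat (\<lfloor>w / r + 1\<rfloor> + 1))" by simp
    also have "\<dots> \<le> w / r + 2" using w by linarith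
    finally show ?thesis .
  next
    case True
    then have "card ?F = 0" by (simp only: card.empty)
    then show ?thesis using w by linarith
  qed
qed

text \<open>On a branch, the difference between iterate and identity is affine with slope
  \<open>\<beta> ^ n - 1\<close>, of size at least a constant times
  \<open>\<bar>\<beta>\<bar> ^ n\<close>. The near returns in one branch thus spread over at most
  \<open>w\<close> and meet at most \<open>w / r + 2\<close> cells; multiplying by the number of
  branches gives both terms.\<close>

lemma card_return_cells:
  assumes \<beta>: "\<bar>\<beta>\<bar> > 1"
  shows "\<exists>C>0. \<forall>n h r. 0 < n \<longrightarrow> 0 < h \<longrightarrow> 0 < r \<longrightarrow>
     real (card ((\<lambda>x. \<lfloor>x / r\<rfloor>) ` {x\<in>{0..1}. \<bar>(beta_map \<beta> ^^ n) x - x\<bar> < h})) \<le> C * (h / r + \<bar>\<beta>\<bar> ^ n)"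
proof -
  have \<beta>0: "\<beta> \<noteq> 0" using \<beta> by auto
  obtain C0 where C0: "C0 > 0" "\<And>n. real (card (cuts \<beta> n)) \<le> C0 * \<bar>\<beta>\<bar> ^ n"
    using card_cuts_le[OF \<beta>] by blast
  define c where "c = 1 - 1 / \<bar>\<beta>\<bar>"
  have c0: "0 < c" using \<beta> by (simp add: c_def)
  define C where "C = (C0 + 1) * (2 / c + 3)"
  show ?thesis
  proof (intro exI[of _ C] conjI allI impI)
    show "C > 0" using C0 c0 unfolding C_def by (intro mult_pos_pos add_pos_pos) auto
    fix n :: nat and h r :: real assume n: "0 < n" and h: "0 < h" and r: "0 < r"
    define E where "E = {x\<in>{0..1}. \<bar>(beta_map \<beta> ^^ n) x - x\<bar> < h}"
    let ?f = "\<lambda>x. \<lfloor>x / r\<rfloor>"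
    let ?Y = "cuts \<beta> n"
    have finY: "finite ?Y" using finite_cuts[OF \<beta>0] .
    define w where "w = 2 * h / (c * \<bar>\<beta>\<bar> ^ n)"
    have w0: "0 \<le> w" using h c0 unfolding w_def by simp
    \<comment> \<open>The number of cuts to the left of \<open>x\<close> serves as the label of its
      branch. The cuts themselves are counted separately.\<close>
    define P where "P i = {x\<in>E. x \<notin> ?Y \<and> card {y\<in>?Y. y < x} = i}" for i
    have slope: "c * \<bar>\<beta>\<bar> ^ n \<le> \<bar>\<beta> ^ n - 1\<bar>"
    proof -
      have "c * \<bar>\<beta>\<bar> ^ n = \<bar>\<beta>\<bar> ^ n - \<bar>\<beta>\<bar> ^ n / \<bar>\<beta>\<bar>" by (simp add: c_def left_diff_distrib)
      also have "\<bar>\<beta>\<bar> ^ n / \<bar>\<beta>\<bar> = \<bar>\<beta>\<bar> ^ (n - 1)"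
        using n \<beta> by (cases n) auto
      also have "1 \<le> \<bar>\<beta>\<bar> ^ (n - 1)" using \<beta> by simp
      then have "\<bar>\<beta>\<bar> ^ n - \<bar>\<beta>\<bar> ^ (n - 1) \<le> \<bar>\<beta> ^ n\<bar> - 1" by (simp add: power_abs)
      also have "\<dots> \<le> \<bar>\<beta> ^ n - 1\<bar>" by simp
      finally show ?thesis .
    qed
    have spread: "\<bar>x - x'\<bar> \<le> w" if x: "x \<in> P i" "x' \<in> P i" for i x x'
    proof -
      have *: "\<bar>x - x'\<bar> \<le> w" if "x \<in> P i" "x' \<in> P i" "x < x'" for x x'
      proof -
        have gap: "{x..x'} \<inter> ?Y = {}"
        proof (rule ccontr)
          assume "{x..x'} \<inter> ?Y \<noteq> {}"
          then obtain y where y: "y \<in> ?Y" "x \<le> y" "y \<le> x'" by auto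
          have "y \<noteq> x'" "y \<noteq> x" using y(1) \<open>x' \<in> P i\<close> \<open>x \<in> P i\<close> unfolding P_def by auto
          then have "y \<in> {y\<in>?Y. y < x'} - {y\<in>?Y. y < x}" using y by auto
          moreover have "{y\<in>?Y. y < x} \<subseteq> {y\<in>?Y. y < x'}" using \<open>x < x'\<close> by auto
          ultimately have "{y\<in>?Y. y < x} \<subset> {y\<in>?Y. y < x'}" by blast
          then have "card {y\<in>?Y. y < x} < card {y\<in>?Y. y < x'}"
            using finY by (intro psubset_card_mono) auto
          then show False using \<open>x \<in> P i\<close> \<open>x' \<in> P i\<close> unfolding P_def by simp
        qed
        have E: "x \<in> E" "x' \<in> E" using \<open>x \<in> P i\<close> \<open>x' \<in> P i\<close> unfolding P_def by auto
        then have unit: "{x..x'} \<subseteq> {0..1}" unfolding E_def by auto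
        obtain s where s: "\<And>z. z \<in> {x..x'} \<Longrightarrow> (beta_map \<beta> ^^ n) z = \<beta> ^ n * z - s"
          using beta_map_iter_affine[OF connected_Icc unit gap] by blast
        have Tx: "(beta_map \<beta> ^^ n) x = \<beta> ^ n * x - s" "(beta_map \<beta> ^^ n) x' = \<beta> ^ n * x' - s"
          using s \<open>x < x'\<close> by auto
        have "\<bar>\<beta> ^ n * x - s - x\<bar> < h" "\<bar>\<beta> ^ n * x' - s - x'\<bar> < h"
          using E unfolding E_def Tx[symmetric] by auto
        then have "\<bar>(\<beta> ^ n * x - s - x) - (\<beta> ^ n * x' - s - x')\<bar> \<le> 2 * h" by linarith
        also have "(\<beta> ^ n * x - s - x) - (\<beta> ^ n * x' - s - x') = (\<beta> ^ n - 1) * (x - x')"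
          by (simp add: algebra_simps)
        finally have "\<bar>\<beta> ^ n - 1\<bar> * \<bar>x - x'\<bar> \<le> 2 * h" by (simp add: abs_mult)
        moreover have "c * \<bar>\<beta>\<bar> ^ n * \<bar>x - x'\<bar> \<le> \<bar>\<beta> ^ n - 1\<bar> * \<bar>x - x'\<bar>"
          using slope by (intro mult_right_mono) auto
        ultimately have "\<bar>x - x'\<bar> * (c * \<bar>\<beta>\<bar> ^ n) \<le> 2 * h" by (simp add: mult.commute)
        moreover have "0 < c * \<bar>\<beta>\<bar> ^ n" using c0 \<beta> by simp
        ultimately show ?thesis unfolding w_def by (simp add: pos_le_divide_eq)
      qed
      show ?thesis using *[of x x'] *[of x' x] x w0 by (cases x x' rule: linorder_cases) (auto simp: abs_minus_commute)
    qed
    have cells: "finite (?f ` P i)" "real (card (?f ` P i)) \<le> w / r + 2" for i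
      using card_floor_image_le[OF r w0 spread[of _ i]] by auto
    have "?f ` E \<subseteq> ?f ` ?Y \<union> (\<Union>i\<le>card ?Y. ?f ` P i)"
    proof clarify
      fix x assume x: "x \<in> E" "\<lfloor>x / r\<rfloor> \<notin> (\<Union>i\<le>card ?Y. ?f ` P i)"
      have "card {y\<in>?Y. y < x} \<le> card ?Y" using finY by (intro card_mono) auto
      then show "\<lfloor>x / r\<rfloor> \<in> ?f ` ?Y" using x unfolding P_def by blast
    qed
    then have "card (?f ` E) \<le> card (?f ` ?Y \<union> (\<Union>i\<le>card ?Y. ?f ` P i))"
      using finY cells by (intro card_mono) auto
    also have "\<dots> \<le> card (?f ` ?Y) + card (\<Union>i\<le>card ?Y. ?f ` P i)" by (rule card_Un_le)
    also have "\<dots> \<le> card ?Y + (\<Sum>i\<le>card ?Y. card (?f ` P i))"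
      by (intro add_mono card_image_le finY card_UN_le) auto
    finally have "real (card (?f ` E)) \<le> real (card ?Y) + (\<Sum>i\<le>card ?Y. real (card (?f ` P i)))"
      by (metis of_nat_add of_nat_le_iff of_nat_sum)
    also have "\<dots> \<le> real (card ?Y) + (\<Sum>i\<le>card ?Y. w / r + 2)"
      using cells by (intro add_left_mono sum_mono) auto
    also have "\<dots> \<le> (real (card ?Y) + 1) * (w / r + 3)"
      using w0 r by (simp add: algebra_simps)
    also have "\<dots> \<le> ((C0 + 1) * \<bar>\<beta>\<bar> ^ n) * (w / r + 3)"
    proof (rule mult_right_mono)
      have "1 \<le> \<bar>\<beta>\<bar> ^ n" using \<beta> by simp
      then show "real (card ?Y) + 1 \<le> (C0 + 1) * \<bar>\<beta>\<bar> ^ n"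
        using C0(2)[of n] by (simp add: distrib_right)
    qed (use w0 r in simp)
    also have "\<dots> = (C0 + 1) * (2 / c * (h / r) + 3 * \<bar>\<beta>\<bar> ^ n)"
      using c0 \<beta>0 r unfolding w_def by (simp add: field_simps)
    also have "\<dots> \<le> (C0 + 1) * ((2 / c + 3) * (h / r) + (2 / c + 3) * \<bar>\<beta>\<bar> ^ n)"
      using c0 C0(1) h r by (intro mult_left_mono add_mono mult_right_mono) auto
    also have "\<dots> = C * (h / r + \<bar>\<beta>\<bar> ^ n)" by (simp only: C_def mult.assoc flip: distrib_left)
    finally show "real (card (?f ` {x\<in>{0..1}. \<bar>(beta_map \<beta> ^^ n) x - x\<bar> < h})) \<le> C * (h / r + \<bar>\<beta>\<bar> ^ n)"
      unfolding E_def .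
  qed
qed

text \<open>
  For \<open>t \<ge> 0\<close> the three cases in the definition of \<open>theta\<close> are subsumed by a minimum of a
  maximum, which makes the continuity in \<open>t\<close> evident.
\<close>

definition rate :: "('n::finite \<Rightarrow> real) \<Rightarrow> real^'n \<Rightarrow> real \<Rightarrow> real" where
  "rate \<beta> t \<rho> = (\<Sum>k\<in>UNIV. min \<rho> (max (ln \<bar>\<beta> k\<bar>) (\<rho> - t $ k)))"

text \<open>With \<rho> = \<open>ln \<bar>\<beta> i\<bar> + t $ i\<close>, the sets
  \<open>K1\<close>, \<open>K2\<close>, \<open>K3\<close> are the cases in which the summand of
  \<open>rate\<close> equals \<rho>, \<open>\<rho> - t $ k\<close> and
  \<open>ln \<bar>\<beta> k\<bar>\<close>. Nonnegativity of \<open>t\<close> makes the first two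
  disjoint.\<close>

lemma theta_eq_rate:
  assumes \<beta>: "\<And>i. \<bar>\<beta> i\<bar> > 1" and t: "\<And>i. 0 \<le> t $ i"
  shows "theta \<beta> t i = rate \<beta> t (ln \<bar>\<beta> i\<bar> + t $ i) / (ln \<bar>\<beta> i\<bar> + t $ i)"
proof -
  let ?s = "ln \<bar>\<beta> i\<bar> + t $ i"
  let ?g = "\<lambda>k. min ?s (max (ln \<bar>\<beta> k\<bar>) (?s - t $ k)) / ?s"
  have l: "0 < ln \<bar>\<beta> k\<bar>" for k using \<beta>[of k] by simp
  have s: "0 < ?s" using l[of i] t[of i] by simp
  have disj: "K1 \<beta> t i \<inter> K2 \<beta> t i = {}"
    using t unfolding K1_def K2_def by (auto simp: not_le) (smt (verit))
  have "(\<Sum>k\<in>UNIV. ?g k) = (\<Sum>k\<in>(K1 \<beta> t i \<union> K2 \<beta> t i) \<union> K3 \<beta> t i. ?g k)"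
    by (rule sum.cong) (auto simp: K3_def)
  also have "\<dots> = (\<Sum>k\<in>K1 \<beta> t i. ?g k) + (\<Sum>k\<in>K2 \<beta> t i. ?g k) + (\<Sum>k\<in>K3 \<beta> t i. ?g k)"
    using disj by (subst sum.union_disjoint; (subst sum.union_disjoint)?) (auto simp: K3_def)
  also have "(\<Sum>k\<in>K1 \<beta> t i. ?g k) = (\<Sum>k\<in>K1 \<beta> t i. 1)"
  proof (rule sum.cong)
    fix k assume "k \<in> K1 \<beta> t i"
    then have "min ?s (max (ln \<bar>\<beta> k\<bar>) (?s - t $ k)) = ?s"
      unfolding K1_def by (auto simp: min_def max_def)
    then show "?g k = 1" using s by simp
  qed simp
  also have "(\<Sum>k\<in>K2 \<beta> t i. ?g k) = (\<Sum>k\<in>K2 \<beta> t i. 1 - t $ k / ?s)"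
  proof (rule sum.cong)
    fix k assume "k \<in> K2 \<beta> t i"
    then have "min ?s (max (ln \<bar>\<beta> k\<bar>) (?s - t $ k)) = ?s - t $ k"
      using t[of k] unfolding K2_def by (auto simp: min_def max_def)
    then show "?g k = 1 - t $ k / ?s" using s by (simp add: diff_divide_distrib)
  qed simp
  also have "(\<Sum>k\<in>K3 \<beta> t i. ?g k) = (\<Sum>k\<in>K3 \<beta> t i. ln \<bar>\<beta> k\<bar> / ?s)"
  proof (rule sum.cong)
    fix k assume "k \<in> K3 \<beta> t i"
    then have "min ?s (max (ln \<bar>\<beta> k\<bar>) (?s - t $ k)) = ln \<bar>\<beta> k\<bar>"
      unfolding K1_def K2_def K3_def by (auto simp: min_def max_def)
    then show "?g k = ln \<bar>\<beta> k\<bar> / ?s" by simp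
  qed simp
  finally show ?thesis unfolding theta_def rate_def by (simp add: sum_divide_distrib)
qed

lemma rate_pos:
  assumes \<beta>: "\<And>i. \<bar>\<beta> i\<bar> > 1" and "0 < \<rho>"
  shows "0 < rate \<beta> t \<rho>"
  unfolding rate_def
proof (rule sum_pos)
  fix k
  have "0 < ln \<bar>\<beta> k\<bar>" using \<beta>[of k] by simp
  then show "0 < min \<rho> (max (ln \<bar>\<beta> k\<bar>) (\<rho> - t $ k))" using assms(2) by simp
qed auto

section \<open>The sequence of exponents and the upper bound\<close>

text \<open>Bolzano-Weierstrass for the subsequence of terms that lie in \<open>K\<close>.\<close>

lemma seq_acc_points_compact:
  fixes u :: "nat \<Rightarrow> 'a::first_countable_topology"
  assumes inf: "\<exists>\<^sub>\<infinity>n. u n \<in> K" and K: "compact K"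
  shows "\<exists>t\<in>K. t \<in> seq_acc_points u"
proof -
  obtain q :: "nat \<Rightarrow> nat" where q: "strict_mono q" "\<And>n. u (q n) \<in> K"
    using infinite_enumerate[of "{n. u n \<in> K}"] inf unfolding frequently_cofinite by auto
  have "\<forall>n. (u \<circ> q) n \<in> K" using q by simp
  then obtain l p where lp: "l \<in> K" "strict_mono p" "((u \<circ> q) \<circ> p) \<longlonglongrightarrow> l"
    using compact_imp_seq_compact[OF K] unfolding seq_compact_def by blast
  have "l \<in> seq_acc_points u"
    unfolding seq_acc_points_def
  proof (intro CollectI allI impI)
    fix S assume "open S" "l \<in> S"
    then obtain N where N: "\<And>n. N \<le> n \<Longrightarrow> u (q (p n)) \<in> S"
      using topological_tendstoD[OF lp(3)] unfolding eventually_sequentially by auto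
    show "\<exists>\<^sub>\<infinity>n. u n \<in> S"
      unfolding INFM_nat_le
    proof
      fix m
      have "strict_mono (q \<circ> p)" using q(1) lp(2) by (rule strict_mono_o)
      then have "max m N \<le> q (p (max m N))" using seq_suble[of "q \<circ> p" "max m N"] by simp
      then show "\<exists>n\<ge>m. u n \<in> S" using N[of "max m N"] by (intro exI[of _ "q (p (max m N))"]) auto
    qed
  qed
  then show ?thesis using lp(1) by blast
qed

text \<open>Serves twice: to locate where the exponents cross a level, and to find the return time
  that belongs to a given scale.\<close>

lemma last_before:
  assumes "P a" "\<not> P b" "a \<le> (b::nat)"
  shows "\<exists>n\<ge>a. P n \<and> \<not> P (Suc n)"
proof (rule ccontr)
  assume no: "\<not> ?thesis"
  have "P n" if "a \<le> n" for n using that by (induction rule: dec_induct) (use assms(1) no in auto)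
  then show False using assms by blast
qed

definition exponents :: "('n::finite \<Rightarrow> real \<Rightarrow> real) \<Rightarrow> nat \<Rightarrow> real^'n" where
  "exponents \<psi> n = (\<chi> i. - ln (\<psi> i (real n)) / real n)"

text \<open>Exponents at finite times may be negative, while \<open>rate\<close> represents
  \<open>theta\<close> for nonnegative vectors. Truncation also keeps the denominators positive, and
  it fixes the accumulation points, which are nonnegative.\<close>

definition pos_vec :: "real^'n \<Rightarrow> real^'n" where
  "pos_vec x = (\<chi> i. max 0 (x $ i))"

lemma exponent_acc_points_eq: "exponent_acc_points \<psi> = seq_acc_points (exponents \<psi>)"
  unfolding exponent_acc_points_def exponents_def ..

locale recurrence =
  fixes \<beta> :: "'n::finite \<Rightarrow> real" and \<psi> :: "'n \<Rightarrow> real \<Rightarrow> real"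
  assumes expanding: "\<And>i. \<bar>\<beta> i\<bar> > 1"
    and psi_pos: "\<And>i x. 0 \<le> x \<Longrightarrow> \<psi> i x > 0"
    and psi_noninc: "\<And>i. antimono_on {0..} (\<psi> i)"
begin

lemma psi_mono: "m \<le> n \<Longrightarrow> \<psi> i (real n) \<le> \<psi> i (real m)"
  using monotone_onD[OF psi_noninc[of i], of "real m" "real n"] by simp

lemma log_expanding: "0 < ln \<bar>\<beta> i\<bar>"
  using expanding[of i] by simp

lemma psi_eq_exp: "0 < n \<Longrightarrow> \<psi> i (real n) = exp (- real n * exponents \<psi> n $ i)"
  using psi_pos[of "real n" i] by (simp add: exponents_def)

text \<open>Monotonicity bounds \<psi> by its value at 0, whose logarithm divided by
  \<open>n\<close> tends to 0.\<close>

lemma exponents_lower: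
  assumes "0 < \<epsilon>"
  shows "\<exists>N>0. \<forall>n\<ge>N. \<forall>i. - \<epsilon> \<le> exponents \<psi> n $ i"
proof (intro exI conjI allI impI)
  let ?N = "nat \<lceil>(\<Sum>i\<in>UNIV. \<bar>ln (\<psi> i 0)\<bar>) / \<epsilon>\<rceil> + 1"
  fix n i assume n: "?N \<le> n"
  have "\<bar>ln (\<psi> i 0)\<bar> \<le> (\<Sum>i\<in>UNIV. \<bar>ln (\<psi> i 0)\<bar>)" by (intro member_le_sum) auto
  then have "\<bar>ln (\<psi> i 0)\<bar> / \<epsilon> \<le> (\<Sum>i\<in>UNIV. \<bar>ln (\<psi> i 0)\<bar>) / \<epsilon>" using assms by (simp add: divide_right_mono)
  also have "\<dots> \<le> real n" using n by linarith
  finally have "\<bar>ln (\<psi> i 0)\<bar> \<le> \<epsilon> * real n" using assms by (simp add: field_simps)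
  moreover have "ln (\<psi> i (real n)) \<le> ln (\<psi> i 0)"
    using psi_mono[of 0 n i] psi_pos[of "real n" i] by simp
  ultimately have "- \<epsilon> * real n \<le> - ln (\<psi> i (real n))" by (simp; linarith)
  moreover have "0 < real n" using n by simp
  ultimately show "- \<epsilon> \<le> exponents \<psi> n $ i"
    unfolding exponents_def vec_lambda_beta by (simp only: pos_le_divide_eq)
qed simp

lemma acc_point_nonneg:
  assumes "t \<in> exponent_acc_points \<psi>"
  shows "0 \<le> t $ i"
proof (rule ccontr)
  assume neg: "\<not> 0 \<le> t $ i"
  then have "0 < - (t $ i / 2)" by simp
  from exponents_lower[OF this] obtain N
    where N: "\<And>n j. N \<le> n \<Longrightarrow> - (- (t $ i / 2)) \<le> exponents \<psi> n $ j"
    by blast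
  have "open {x::real^'n. x $ i < t $ i / 2}" by (intro open_Collect_less continuous_intros)
  moreover have "t \<in> {x. x $ i < t $ i / 2}" using neg by simp
  ultimately have "\<exists>\<^sub>\<infinity>n. exponents \<psi> n \<in> {x. x $ i < t $ i / 2}"
    using assms unfolding exponent_acc_points_eq seq_acc_points_def by blast
  then obtain n where "N \<le> n" "exponents \<psi> n $ i < t $ i / 2" unfolding INFM_nat_le by blast
  then show False using N[of n i] by simp
qed

text \<open>
  The maximum of the exponents decreases slowly, because \<open>n\<close> times it is non-decreasing. So if it
  were large infinitely often, it would cross any high level slowly, producing an accumulation
  point of large norm.
\<close>

lemma exponents_upper:
  assumes bdd: "bounded (exponent_acc_points \<psi>)" and ne: "exponent_acc_points \<psi> \<noteq> {}"
  shows "\<exists>R N. \<forall>n\<ge>N. \<forall>i. exponents \<psi> n $ i \<le> R"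
proof -
  let ?U = "exponent_acc_points \<psi>"
  let ?u = "exponents \<psi>"
  obtain L where L: "0 < L" "\<And>t. t \<in> ?U \<Longrightarrow> norm t \<le> L" using bdd unfolding bounded_pos by auto
  define P where "P n \<longleftrightarrow> (\<exists>i. L + 2 \<le> ?u n $ i)" for n
  have "\<not> (\<exists>\<^sub>\<infinity>n. P n)"
  proof
    assume inf: "\<exists>\<^sub>\<infinity>n. P n"
    obtain t0 where t0: "t0 \<in> ?U" using ne by auto
    have "\<exists>\<^sub>\<infinity>n. ?u n \<in> ball t0 1"
      using t0 open_ball[of t0 1] centre_in_ball[of t0 1]
      unfolding exponent_acc_points_eq seq_acc_points_def by (blast intro: zero_less_one)
    \<comment> \<open>The accumulation point \<open>t0\<close> keeps drawing the exponents back
      below the level, so crossings occur arbitrarily late.\<close>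
    then have inf': "\<exists>\<^sub>\<infinity>n. \<not> P n"
    proof (rule frequently_elim1)
      fix n assume "?u n \<in> ball t0 1"
      then have *: "norm (?u n - t0) < 1" by (simp add: dist_norm norm_minus_commute)
      have "?u n $ i < L + 2" for i
        using component_le_norm_cart[of "?u n - t0" i] component_le_norm_cart[of t0 i] L(2)[OF t0] *
        by (simp; linarith)
      then show "\<not> P n" unfolding P_def by (simp add: not_le)
    qed
    \<comment> \<open>A compact shell outside the ball of radius \<open>L\<close>, hence free of
      accumulation points.\<close>
    let ?K = "{x::real^'n. (\<forall>i. - 1 \<le> x $ i) \<and> (\<forall>i. x $ i \<le> L + 2) \<and> L + 1 \<le> norm x}"
    obtain N0 where N0: "\<And>n i. N0 \<le> n \<Longrightarrow> - 1 \<le> ?u n $ i" using exponents_lower[OF zero_less_one] by blast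
    have "\<exists>\<^sub>\<infinity>n. ?u n \<in> ?K"
      unfolding INFM_nat_le
    proof
      fix m
      define M where "M = max m (max N0 (nat \<lceil>L + 2\<rceil>))"
      obtain a where a: "M \<le> a" "P a" using inf unfolding INFM_nat_le by blast
      obtain b where b: "a \<le> b" "\<not> P b" using inf' unfolding INFM_nat_le by blast
      obtain n where n: "a \<le> n" "P n" "\<not> P (Suc n)" using last_before[OF a(2) b(2,1)] by blast
      have Mn: "M \<le> n" using a n by simp
      obtain i where i: "L + 2 \<le> ?u n $ i" using n(2) unfolding P_def by blast
      have n0: "0 < n" "L + 2 \<le> real n" using Mn L(1) unfolding M_def by linarith+
      \<comment> \<open>One step multiplies the exponent by at least \<open>n / (n + 1)\<close>.
        From the level \<open>L + 2\<close> this is a drop of at most 1, because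
        \<open>L + 2 \<le> n\<close>.\<close>
      have "L + 1 \<le> ?u (Suc n) $ i"
      proof -
        have "real n * (L + 2) \<le> - ln (\<psi> i (real n))"
          using i n0 unfolding exponents_def by (simp add: field_simps)
        also have "\<dots> \<le> - ln (\<psi> i (real (Suc n)))"
          using psi_mono[of n "Suc n" i] psi_pos[of "real (Suc n)" i] by simp
        also have "\<dots> = real (Suc n) * ?u (Suc n) $ i" unfolding exponents_def by simp
        finally have 1: "real n * (L + 2) \<le> real (Suc n) * ?u (Suc n) $ i" .
        have "(L + 1) * real (Suc n) \<le> real n * (L + 2)" using n0 by (simp add: algebra_simps)
        then have "(L + 1) * real (Suc n) \<le> ?u (Suc n) $ i * real (Suc n)"
          using 1 by (simp only: mult.commute[of "?u (Suc n) $ i"])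
        then show ?thesis by (simp only: mult_le_cancel_right_pos of_nat_0_less_iff zero_less_Suc)
      qed
      then have "L + 1 \<le> norm (?u (Suc n))" using component_le_norm_cart[of "?u (Suc n)" i] by linarith
      moreover have "\<forall>i. - 1 \<le> ?u (Suc n) $ i" using N0[of "Suc n"] Mn unfolding M_def by auto
      moreover have "\<forall>i. ?u (Suc n) $ i \<le> L + 2" using n(3) unfolding P_def by (auto simp: not_le less_imp_le)
      ultimately have "?u (Suc n) \<in> ?K" by blast
      moreover have "m \<le> Suc n" using Mn unfolding M_def by simp
      ultimately show "\<exists>n\<ge>m. ?u n \<in> ?K" by blast
    qed
    moreover have "compact ?K"
    proof -
      have "?K = cbox (\<chi> i. - 1) (\<chi> i. L + 2) \<inter> {x. L + 1 \<le> norm x}" by (auto simp: mem_box_cart)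
      moreover have "closed {x::real^'n. L + 1 \<le> norm x}" by (intro closed_Collect_le continuous_intros)
      ultimately show ?thesis by (simp only: compact_Int_closed compact_cbox)
    qed
    ultimately obtain t where "t \<in> ?K" "t \<in> ?U"
      using seq_acc_points_compact unfolding exponent_acc_points_eq by blast
    then show False using L(2)[of t] by simp
  qed
  then obtain N where N: "\<And>n. N \<le> n \<Longrightarrow> \<not> P n" unfolding INFM_nat_le by auto
  have "?u n $ i \<le> L + 2" if "N \<le> n" for n i
    using N[OF that] unfolding P_def by (meson nle_le)
  then show ?thesis by blast
qed

lemma continuous_rate_quotient:
  "continuous_on UNIV
     (\<lambda>x. rate \<beta> (pos_vec x) (ln \<bar>\<beta> i\<bar> + max 0 (x $ i)) / (ln \<bar>\<beta> i\<bar> + max 0 (x $ i)))"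
proof -
  have pos: "0 < ln \<bar>\<beta> i\<bar> + max 0 (x $ i)" for x :: "real^'n"
    using log_expanding[of i] by (simp add: add_pos_nonneg)
  have comp: "continuous_on UNIV (\<lambda>x::real^'n. max 0 (x $ k))" for k
    by (intro continuous_on_max continuous_on_const continuous_on_component continuous_on_id)
  have den: "continuous_on UNIV (\<lambda>x::real^'n. ln \<bar>\<beta> i\<bar> + max 0 (x $ i))"
    by (intro continuous_on_add continuous_on_const comp)
  have num: "continuous_on UNIV (\<lambda>x. rate \<beta> (pos_vec x) (ln \<bar>\<beta> i\<bar> + max 0 (x $ i)))"
    unfolding rate_def pos_vec_def vec_lambda_beta
    by (intro continuous_on_sum continuous_on_min continuous_on_max continuous_on_diff
        continuous_on_const den comp)
  show ?thesis
  proof (rule continuous_on_divide[OF num den], rule ballI)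
    fix x :: "real^'n"
    show "ln \<bar>\<beta> i\<bar> + max 0 (x $ i) \<noteq> 0" using pos[of x] by linarith
  qed
qed

text \<open>The vectors in a box whose quotients are all at least \<open>s\<close> form a compact
  set. If the exponents visited it infinitely often, it would contain an accumulation point, with
  all \<open>theta\<close> at least \<open>s\<close>. The index \<open>i\<close> found here may
  change with \<open>n\<close>.\<close>

lemma rate_below_eventually:
  assumes bdd: "bounded (exponent_acc_points \<psi>)" and ne: "exponent_acc_points \<psi> \<noteq> {}"
    and s: "\<And>t. t \<in> exponent_acc_points \<psi> \<Longrightarrow> \<exists>i. theta \<beta> t i < s"
  shows "\<exists>N>0. \<forall>n\<ge>N. \<exists>i. let \<sigma> = ln \<bar>\<beta> i\<bar> + max 0 (exponents \<psi> n $ i) in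
    rate \<beta> (pos_vec (exponents \<psi> n)) \<sigma> < s * \<sigma>"
proof -
  let ?u = "exponents \<psi>"
  let ?s = "\<lambda>x i. ln \<bar>\<beta> i\<bar> + max 0 (x $ i)"
  let ?q = "\<lambda>i x. rate \<beta> (pos_vec x) (?s x i) / ?s x i"
  obtain R N1 where R: "\<And>n i. N1 \<le> n \<Longrightarrow> ?u n $ i \<le> R" using exponents_upper[OF bdd ne] by blast
  obtain N2 where N2: "0 < N2" "\<And>n i. N2 \<le> n \<Longrightarrow> - 1 \<le> ?u n $ i" using exponents_lower[OF zero_less_one] by blast
  let ?K = "cbox (\<chi> i. - 1) (\<chi> i. R) \<inter> {x. \<forall>i. s \<le> ?q i x}"
  have "closed {x. \<forall>i. s \<le> ?q i x}"
    by (intro closed_Collect_all closed_Collect_le continuous_intros continuous_rate_quotient)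
  then have "compact ?K" by (intro compact_Int_closed compact_cbox)
  have "\<not> (\<exists>\<^sub>\<infinity>n. ?u n \<in> ?K)"
  proof
    assume "\<exists>\<^sub>\<infinity>n. ?u n \<in> ?K"
    then obtain t where t: "t \<in> ?K" "t \<in> exponent_acc_points \<psi>"
      using seq_acc_points_compact[OF _ \<open>compact ?K\<close>] unfolding exponent_acc_points_eq by blast
    have t0: "0 \<le> t $ i" for i using acc_point_nonneg[OF t(2)] .
    then have m: "max 0 (t $ i) = t $ i" for i by (simp add: max_absorb2)
    then have p: "pos_vec t = t" by (simp add: pos_vec_def vec_eq_iff)
    have "\<forall>i. s \<le> ?q i t" using t(1) by blast
    then have "s \<le> theta \<beta> t i" for i
      unfolding theta_eq_rate[OF expanding t0] m p by blast
    then show False using s[OF t(2)] by (meson not_le)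
  qed
  then obtain N3 where N3: "\<And>n. N3 \<le> n \<Longrightarrow> ?u n \<notin> ?K" unfolding INFM_nat_le by blast
  define N where "N = max N1 (max N2 N3)"
  have "\<exists>i. ?q i (?u n) < s" if "N \<le> n" for n
    using N3[of n] R[of n] N2(2)[of n] that unfolding N_def by (auto simp: mem_box_cart not_le)
  moreover have "rate \<beta> (pos_vec (?u n)) (?s (?u n) i) < s * ?s (?u n) i" if "?q i (?u n) < s" for n i
  proof -
    have "0 < ?s (?u n) i" using log_expanding[of i] by simp
    then show ?thesis using that by (simp add: pos_divide_less_eq)
  qed
  moreover have "0 < N" using N2(1) unfolding N_def by simp
  ultimately show ?thesis unfolding Let_def by blast
qed

text \<open>The minimum combines the trivial count of all cells in the unit interval with the count
  of cells that near returns meet. The constant is uniform in time, scale and coordinate.\<close>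

lemma cell_count:
  "\<exists>A>0. \<forall>n \<sigma> k. 0 < n \<longrightarrow> 0 \<le> \<sigma> \<longrightarrow>
    real (card ((\<lambda>x. \<lfloor>x / exp (- real n * \<sigma>)\<rfloor>) ` {x\<in>{0..1}. \<bar>(beta_map (\<beta> k) ^^ n) x - x\<bar> < \<psi> k (real n)}))
      \<le> A * exp (real n * min \<sigma> (max (ln \<bar>\<beta> k\<bar>) (\<sigma> - pos_vec (exponents \<psi> n) $ k)))"
proof -
  have "\<forall>k. \<exists>C>0. \<forall>n h r. 0 < n \<longrightarrow> 0 < h \<longrightarrow> 0 < r \<longrightarrow>
      real (card ((\<lambda>x. \<lfloor>x / r\<rfloor>) ` {x\<in>{0..1}. \<bar>(beta_map (\<beta> k) ^^ n) x - x\<bar> < h})) \<le> C * (h / r + \<bar>\<beta> k\<bar> ^ n)"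
    using card_return_cells[OF expanding] by blast
  from choice[OF this] obtain C where C0: "\<forall>k. C k > 0 \<and> (\<forall>n h r. 0 < n \<longrightarrow> 0 < h \<longrightarrow> 0 < r \<longrightarrow>
      real (card ((\<lambda>x. \<lfloor>x / r\<rfloor>) ` {x\<in>{0..1}. \<bar>(beta_map (\<beta> k) ^^ n) x - x\<bar> < h})) \<le> C k * (h / r + \<bar>\<beta> k\<bar> ^ n))" ..
  then have C: "\<And>k. 0 < C k" "\<And>k n h r. 0 < n \<Longrightarrow> 0 < h \<Longrightarrow> 0 < r \<Longrightarrow>
      real (card ((\<lambda>x. \<lfloor>x / r\<rfloor>) ` {x\<in>{0..1}. \<bar>(beta_map (\<beta> k) ^^ n) x - x\<bar> < h})) \<le> C k * (h / r + \<bar>\<beta> k\<bar> ^ n)"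
    by blast+
  define B where "B k = C k * (max 1 (\<psi> k 0) + 1)" for k
  have B0: "0 \<le> B k" for k using C(1)[of k] by (simp add: B_def)
  define A where "A = 3 + (\<Sum>k\<in>UNIV. B k)"
  have A: "3 \<le> A" "B k \<le> A" for k
  proof -
    show "3 \<le> A" using B0 by (simp add: A_def sum_nonneg)
    have "B k \<le> (\<Sum>k\<in>UNIV. B k)" using B0 by (intro member_le_sum) auto
    then show "B k \<le> A" by (simp add: A_def)
  qed
  show ?thesis
  proof (intro exI[of _ A] conjI allI impI)
    fix n :: nat and \<sigma> :: real and k assume n: "0 < n" and \<sigma>: "0 \<le> \<sigma>"
    let ?v = "pos_vec (exponents \<psi> n) $ k"
    let ?l = "ln \<bar>\<beta> k\<bar>"
    let ?c = "real (card ((\<lambda>x. \<lfloor>x / exp (- real n * \<sigma>)\<rfloor>) ` {x\<in>{0..1}. \<bar>(beta_map (\<beta> k) ^^ n) x - x\<bar> < \<psi> k (real n)}))"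
    have c1: "?c \<le> A * exp (real n * \<sigma>)"
    proof -
      have "?c \<le> 1 / exp (- real n * \<sigma>) + 2" by (rule card_floor_image_le) auto
      also have "\<dots> \<le> 3 * exp (real n * \<sigma>)"
      proof -
        have "1 / exp (- real n * \<sigma>) = exp (real n * \<sigma>)" by (simp add: exp_minus divide_inverse)
        moreover have "1 \<le> exp (real n * \<sigma>)" using \<sigma> by simp
        ultimately show ?thesis by linarith
      qed
      also have "\<dots> \<le> A * exp (real n * \<sigma>)" using A by (intro mult_right_mono) auto
      finally show ?thesis .
    qed
    have c2: "?c \<le> A * exp (real n * max ?l (\<sigma> - ?v))"
    proof -
      let ?e = "exp (real n * max ?l (\<sigma> - ?v))"
      \<comment> \<open>The factor \<open>max 1 (\<psi> k 0)\<close> covers the times at which the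
        exponent is negative and has been truncated to 0.\<close>
      have psi: "\<psi> k (real n) \<le> max 1 (\<psi> k 0) * exp (- real n * ?v)"
      proof (cases "0 \<le> exponents \<psi> n $ k")
        case True
        then have "\<psi> k (real n) = exp (- real n * ?v)" using psi_eq_exp[OF n] by (simp add: pos_vec_def)
        then show ?thesis by (simp add: mult_le_cancel_right1)
      next
        case False
        then show ?thesis using psi_mono[of 0 n k] by (simp add: pos_vec_def)
      qed
      have "?c \<le> C k * (\<psi> k (real n) / exp (- real n * \<sigma>) + \<bar>\<beta> k\<bar> ^ n)"
        by (rule C(2)) (use n psi_pos in auto)
      also have "\<dots> \<le> C k * (max 1 (\<psi> k 0) * ?e + ?e)"
      proof (intro mult_left_mono add_mono)
        have "\<psi> k (real n) / exp (- real n * \<sigma>) \<le> max 1 (\<psi> k 0) * exp (- real n * ?v) / exp (- real n * \<sigma>)"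
          using psi by (simp add: divide_right_mono)
        also have "\<dots> = max 1 (\<psi> k 0) * exp (real n * (\<sigma> - ?v))"
          by (simp add: right_diff_distrib exp_diff exp_minus field_simps)
        also have "\<dots> \<le> max 1 (\<psi> k 0) * ?e" by (intro mult_left_mono) (auto intro: mult_left_mono)
        finally show "\<psi> k (real n) / exp (- real n * \<sigma>) \<le> max 1 (\<psi> k 0) * ?e" .
        have "\<bar>\<beta> k\<bar> ^ n = exp (real n * ?l)" using expanding[of k] by (simp add: exp_of_nat_mult)
        also have "\<dots> \<le> ?e" by (auto intro: mult_left_mono)
        finally show "\<bar>\<beta> k\<bar> ^ n \<le> ?e" .
      qed (use C(1)[of k] in simp)
      also have "\<dots> = B k * ?e" by (simp add: B_def algebra_simps)
      also have "\<dots> \<le> A * ?e" using A by (intro mult_right_mono) auto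
      finally show ?thesis .
    qed
    show "?c \<le> A * exp (real n * min \<sigma> (max ?l (\<sigma> - ?v)))"
    proof (cases "\<sigma> \<le> max ?l (\<sigma> - ?v)")
      case True
      then have "min \<sigma> (max ?l (\<sigma> - ?v)) = \<sigma>" by simp
      then show ?thesis using c1 by simp
    next
      case False
      then have "min \<sigma> (max ?l (\<sigma> - ?v)) = max ?l (\<sigma> - ?v)" by simp
      then show ?thesis using c2 by simp
    qed
  qed (use A in simp)
qed

text \<open>At time \<open>n\<close> the side of the cubes is dictated by an index \<iota>
  \<open>n\<close> whose quotient is below \<open>s1\<close>. The covering sum at exponent
  \<open>s\<close> then decays geometrically, thanks to the gap \<open>s - s1\<close>.\<close>

lemma hausdorff_measure_recurrent_set:
  assumes bdd: "bounded (exponent_acc_points \<psi>)" and ne: "exponent_acc_points \<psi> \<noteq> {}"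
    and s1: "\<And>t. t \<in> exponent_acc_points \<psi> \<Longrightarrow> \<exists>i. theta \<beta> t i < s1" and s: "s1 < s" "0 < s"
  shows "hausdorff_measure s (recurrent_set \<beta> \<psi>) = 0"
proof -
  let ?u = "exponents \<psi>"
  obtain N where N: "0 < N" "\<forall>n\<ge>N. \<exists>i. let \<sigma> = ln \<bar>\<beta> i\<bar> + max 0 (?u n $ i) in
    rate \<beta> (pos_vec (?u n)) \<sigma> < s1 * \<sigma>"
    using rate_below_eventually[OF bdd ne s1] by blast
  then obtain \<iota> where \<iota>: "\<And>n. N \<le> n \<Longrightarrow> let \<sigma> = ln \<bar>\<beta> (\<iota> n)\<bar> + max 0 (?u n $ \<iota> n) in
    rate \<beta> (pos_vec (?u n)) \<sigma> < s1 * \<sigma>"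
    by metis
  define \<sigma> where "\<sigma> n = ln \<bar>\<beta> (\<iota> n)\<bar> + max 0 (?u n $ \<iota> n)" for n
  have rate: "rate \<beta> (pos_vec (?u n)) (\<sigma> n) < s1 * \<sigma> n" if "N \<le> n" for n
    using \<iota>[OF that] unfolding \<sigma>_def Let_def .
  obtain A where A: "0 < A" "\<And>n \<sigma> k. 0 < n \<Longrightarrow> 0 \<le> \<sigma> \<Longrightarrow>
    real (card ((\<lambda>x. \<lfloor>x / exp (- real n * \<sigma>)\<rfloor>) ` {x\<in>{0..1}. \<bar>(beta_map (\<beta> k) ^^ n) x - x\<bar> < \<psi> k (real n)}))
      \<le> A * exp (real n * min \<sigma> (max (ln \<bar>\<beta> k\<bar>) (\<sigma> - pos_vec (?u n) $ k)))"
    using cell_count by blast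
  define l where "l = (MIN i. ln \<bar>\<beta> i\<bar>)"
  have l: "0 < l" "\<And>i. l \<le> ln \<bar>\<beta> i\<bar>" using log_expanding unfolding l_def by auto
  have \<sigma>l: "l \<le> \<sigma> n" for n using l(2)[of "\<iota> n"] unfolding \<sigma>_def by linarith
  define d where "d = real CARD('n)"
  have d: "1 \<le> d" unfolding d_def by (simp add: Suc_leI)
  define r where "r n = exp (- real n * \<sigma> n)" for n
  have r0: "0 < r n" for n by (simp add: r_def)
  define S where "S n k = {x\<in>{0..1}. \<bar>(beta_map (\<beta> k) ^^ n) x - x\<bar> < \<psi> k (real n)}" for n k
  define F where "F n k = (\<lambda>x. \<lfloor>x / r n\<rfloor>) ` S n k" for n k
  define E where "E n = {x::real^'n. \<forall>k. x $ k \<in> S n k}" for n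
  define cell where "cell n c = {x::real^'n. \<forall>k. \<lfloor>x $ k / r n\<rfloor> = c k}" for n c
  define \<C> where "\<C> n = cell n ` (Pi\<^sub>E UNIV (F n))" for n
  have finF: "finite (F n k)" for n k
    unfolding F_def S_def by (rule card_floor_image_le(1)[OF r0, of 1]) auto
  have diam: "bounded X \<and> diameter X \<le> d * r n" if X: "X \<in> \<C> n" for X n
  proof -
    obtain c where c: "X = cell n c" using X unfolding \<C>_def by auto
    have close: "norm (x - y) \<le> d * r n" if "x \<in> X" "y \<in> X" for x y
    proof -
      have "\<bar>x $ k - y $ k\<bar> \<le> r n" for k
      proof -
        have "\<lfloor>x $ k / r n\<rfloor> = \<lfloor>y $ k / r n\<rfloor>" using that unfolding c cell_def by simp
        then have "\<bar>x $ k / r n - y $ k / r n\<bar> \<le> 1" by linarith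
        then show ?thesis
          using r0[of n] by (simp add: diff_divide_distrib[symmetric] abs_divide)
      qed
      then have "(\<Sum>k\<in>UNIV. \<bar>(x - y) $ k\<bar>) \<le> (\<Sum>k\<in>(UNIV::'n set). r n)" by (intro sum_mono) simp
      then show ?thesis using norm_le_l1_cart[of "x - y"] unfolding d_def by simp
    qed
    have "bounded X"
      unfolding bounded_two_points dist_norm using close by blast
    then show ?thesis using close r0[of n] d by (auto intro!: diameter_le)
  qed
  have card: "real (card (\<C> n)) \<le> A ^ CARD('n) * exp (real n * (s1 * \<sigma> n))" if n: "N \<le> n" for n
  proof -
    have n0: "0 < n" "0 \<le> \<sigma> n" using n N \<sigma>l[of n] l by auto
    have "card (\<C> n) \<le> card (Pi\<^sub>E UNIV (F n))"
      unfolding \<C>_def using finF by (intro card_image_le finite_PiE) auto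
    then have "real (card (\<C> n)) \<le> (\<Prod>k\<in>UNIV. real (card (F n k)))" by (simp add: card_PiE flip: of_nat_prod)
    also have "\<dots> \<le> (\<Prod>k\<in>UNIV. A * exp (real n * min (\<sigma> n) (max (ln \<bar>\<beta> k\<bar>) (\<sigma> n - pos_vec (?u n) $ k))))"
      using A(2)[OF n0] unfolding F_def S_def r_def by (intro prod_mono) auto
    also have "\<dots> = A ^ CARD('n) * exp (real n * rate \<beta> (pos_vec (?u n)) (\<sigma> n))"
      by (simp add: prod.distrib rate_def exp_sum sum_distrib_left)
    also have "\<dots> \<le> A ^ CARD('n) * exp (real n * (s1 * \<sigma> n))"
      using rate[OF n] A(1) n0 by (intro mult_left_mono) auto
    finally show ?thesis .
  qed
  \<comment> \<open>All \<sigma> \<open>n\<close> are at least \<open>l\<close>, so this single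
    ratio works although the chosen index varies.\<close>
  define q where "q = exp (- (l * (s - s1)))"
  have q: "0 < q" "q < 1" using l s by (auto simp: q_def)
  show ?thesis
  proof (rule hausdorff_measure_eq_0I[where E = E and \<C> = \<C> and r = "\<lambda>n. d * r n" and s = s
        and M = N and a = "\<lambda>n. A ^ CARD('n) * d powr s * q ^ n"])
    show "\<exists>\<^sub>\<infinity>n. x \<in> E n" if x: "x \<in> recurrent_set \<beta> \<psi>" for x
    proof -
      have "\<exists>\<^sub>\<infinity>n::nat. \<forall>i. \<bar>(beta_map (\<beta> i) ^^ n) (x $ i) - x $ i\<bar> < \<psi> i (real n)"
        using x unfolding recurrent_set_def by blast
      then show ?thesis
        by (rule frequently_elim1) (use x in \<open>auto simp: E_def S_def recurrent_set_def\<close>)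
    qed
    show "E n \<subseteq> \<Union>(\<C> n)" if "N \<le> n" for n
    proof
      fix x assume x: "x \<in> E n"
      have "x \<in> cell n (\<lambda>k. \<lfloor>x $ k / r n\<rfloor>)" unfolding cell_def by simp
      moreover have "(\<lambda>k. \<lfloor>x $ k / r n\<rfloor>) \<in> Pi\<^sub>E UNIV (F n)" using x unfolding E_def F_def by auto
      ultimately show "x \<in> \<Union>(\<C> n)" unfolding \<C>_def by blast
    qed
    show "finite (\<C> n)" if "N \<le> n" for n unfolding \<C>_def using finF by (intro finite_imageI finite_PiE) auto
    show "bounded X \<and> diameter X \<le> d * r n" if "N \<le> n" "X \<in> \<C> n" for n X using diam[OF that(2)] .
    show "(\<lambda>n. d * r n) \<longlonglongrightarrow> 0"
    proof -
      have "(\<lambda>n. exp (- l) ^ n) \<longlonglongrightarrow> 0" using l(1) by (intro LIMSEQ_power_zero) auto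
      moreover have "eventually (\<lambda>n. norm (r n) \<le> exp (- l) ^ n) sequentially"
      proof (rule eventually_sequentiallyI)
        fix n assume "N \<le> n"
        then have "real n * l \<le> real n * \<sigma> n" using \<sigma>l by (intro mult_left_mono) auto
        then show "norm (r n) \<le> exp (- l) ^ n" by (simp add: r_def exp_of_nat_mult[symmetric])
      qed
      ultimately have "r \<longlonglongrightarrow> 0" by (rule Lim_null_comparison[rotated])
      then show ?thesis by (rule tendsto_mult_right_zero)
    qed
    show "summable (\<lambda>n. A ^ CARD('n) * d powr s * q ^ n)"
      using q by (intro summable_mult summable_geometric) auto
    show "0 \<le> A ^ CARD('n) * d powr s * q ^ n" for n using A(1) q by simp
    fix n assume n: "N \<le> n"
    have dr: "(d * r n) powr s = d powr s * exp (- real n * \<sigma> n * s)"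
      using d r0[of n] by (simp add: powr_mult r_def exp_powr_real)
    have "real (card (\<C> n)) * (d * r n) powr s
        \<le> (A ^ CARD('n) * exp (real n * (s1 * \<sigma> n))) * (d * r n) powr s"
      using card[OF n] by (intro mult_right_mono) auto
    also have "(A ^ CARD('n) * exp (real n * (s1 * \<sigma> n))) * (d * r n) powr s
        = A ^ CARD('n) * d powr s * exp (- (real n * (\<sigma> n * (s - s1))))"
      unfolding dr by (simp add: exp_add[symmetric] algebra_simps)
    also have "\<dots> \<le> A ^ CARD('n) * d powr s * q ^ n"
    proof (rule mult_left_mono)
      have "real n * (l * (s - s1)) \<le> real n * (\<sigma> n * (s - s1))"
        using \<sigma>l[of n] s by (intro mult_left_mono mult_right_mono) auto
      then show "exp (- (real n * (\<sigma> n * (s - s1)))) \<le> q ^ n"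
        by (simp add: q_def exp_of_nat_mult[symmetric])
    qed (use A(1) in simp)
    finally show "real (card (\<C> n)) * (d * r n) powr s \<le> A ^ CARD('n) * d powr s * q ^ n" .
  qed (use s in auto)
qed

end

section \<open>Product Cantor sets\<close>

text \<open>A full shift inside the map \<open>g\<close>, presented by inverse branches of equal
  ratio. The last axiom makes the images of \<open>{u..v}\<close> under these branches pairwise
  disjoint.\<close>

locale horseshoe =
  fixes g :: "real \<Rightarrow> real" and b u v :: real and S :: "real set"
  assumes b: "1 < \<bar>b\<bar>" and uv: "0 \<le> u" "u < v" "v \<le> 1" and S: "finite S" "S \<noteq> {}"
    and branch_in: "\<And>s y. s \<in> S \<Longrightarrow> y \<in> {u..v} \<Longrightarrow> (y + s) / b \<in> {u..v}"
    and branch_inv: "\<And>s y. s \<in> S \<Longrightarrow> y \<in> {u..v} \<Longrightarrow> g ((y + s) / b) = y"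
begin

text \<open>The point that runs through the branches listed in \<open>w\<close>, from the head on,
  and arrives at \<open>y\<close> after \<open>length w\<close> steps.\<close>

primrec code :: "real list \<Rightarrow> real \<Rightarrow> real" where
  "code [] y = y"
| "code (s # w) y = (code w y + s) / b"

lemma code_in: "set w \<subseteq> S \<Longrightarrow> y \<in> {u..v} \<Longrightarrow> code w y \<in> {u..v}"
proof (induction w)
  case (Cons s w)
  then show ?case using branch_in[of s "code w y"] by simp
qed simp

lemma code_append: "code (w @ w') y = code w (code w' y)"
  by (induction w) auto

lemma iter_code:
  assumes "set w \<subseteq> S" "y \<in> {u..v}" "n \<le> length w"
  shows "(g ^^ n) (code w y) = code (drop n w) y"
  using assms
proof (induction n arbitrary: w)
  case (Suc n)
  then obtain s w' where w: "w = s # w'" by (cases w) auto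
  have "g (code w y) = code w' y"
    using branch_inv[of s "code w' y"] code_in[of w' y] Suc.prems unfolding w by simp
  then have "(g ^^ Suc n) (code w y) = (g ^^ n) (code w' y)" by (simp add: funpow_Suc_right del: funpow.simps)
  also have "\<dots> = code (drop n w') y" using Suc w by auto
  finally show ?case by (simp add: w)
qed simp

lemma code_diff: "code w y - code w y' = (y - y') / b ^ length w"
proof (induction w)
  case (Cons s w)
  have "code (s # w) y - code (s # w) y' = (code w y - code w y') / b"
    by (simp add: diff_divide_distrib add_divide_distrib)
  then show ?case by (simp add: Cons divide_divide_eq_left mult.commute)
qed simp

lemma code_eqD:
  assumes "set w \<subseteq> S" "set w' \<subseteq> S" "length w = length w'" "y \<in> {u..v}" "y' \<in> {u..v}"
    and "code w y = code w' y'"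
  shows "w = w'"
  using assms(3,1,2,6)
proof (induction w w' rule: list_induct2)
  case (Cons s w s' w')
  have 1: "g ((code w y + s) / b) = code w y" "g ((code w' y' + s') / b) = code w' y'"
    using branch_inv[of s "code w y"] branch_inv[of s' "code w' y'"] code_in[of w y] code_in[of w' y']
      Cons.prems(1,2) assms(4,5) by simp_all
  have "(code w y + s) / b = (code w' y' + s') / b" using Cons.prems(3) by (simp only: code.simps)
  then have "code w y = code w' y'" using 1 by metis
  then show ?case using Cons b by auto
qed simp

text \<open>The overlap argument of \<open>branches_separated\<close>, now for cylinders: two closer
  base points would give equally long cylinders with a common point, and \<open>code_eqD\<close>
  excludes this.\<close>

lemma code_separated:
  assumes w: "set w \<subseteq> S" "set w' \<subseteq> S" "length w = n" "length w' = n" "w \<noteq> w'"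
  shows "(v - u) / \<bar>b\<bar> ^ n \<le> \<bar>code w u - code w' u\<bar>"
proof (rule ccontr)
  define D where "D = (code w' u - code w u) * b ^ n"
  assume "\<not> ?thesis"
  then have "\<bar>code w u - code w' u\<bar> < (v - u) / \<bar>b\<bar> ^ n" by simp
  then have "\<bar>code w u - code w' u\<bar> * \<bar>b\<bar> ^ n < v - u" using b by (simp add: pos_less_divide_eq)
  then have D: "\<bar>D\<bar> < v - u" by (simp add: D_def abs_mult power_abs abs_minus_commute)
  define y y' where "y = u + max 0 D" and "y' = u + max 0 (- D)"
  have yy: "y \<in> {u..v}" "y' \<in> {u..v}" "y - y' = D" using D uv unfolding y_def y'_def by auto
  have "code w y = code w u + (y - u) / b ^ n" using code_diff[of w y u] w(3) by simp
  moreover have "code w' y' = code w' u + (y' - u) / b ^ n" using code_diff[of w' y' u] w(4) by simp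
  moreover have "(y - u) / b ^ n - (y' - u) / b ^ n = code w' u - code w u"
  proof -
    have "(y - u) / b ^ n - (y' - u) / b ^ n = D / b ^ n"
      using yy(3) by (simp add: diff_divide_distrib[symmetric])
    also have "\<dots> = code w' u - code w u" using b by (simp add: D_def)
    finally show ?thesis .
  qed
  ultimately have "code w y = code w' y'" by simp
  then show False using code_eqD[OF w(1,2) _ yy(1,2)] w by simp
qed

text \<open>\<open>F\<close> holds the freely chosen positions; a forced position copies the symbol
  at position \<sigma> \<open>i\<close>. In the applications \<sigma> \<open>i < i\<close>, so words
  can be built from left to right.\<close>

definition words :: "nat set \<Rightarrow> (nat \<Rightarrow> nat) \<Rightarrow> nat \<Rightarrow> real list set" where
  "words F \<sigma> n = {w. length w = n \<and> set w \<subseteq> S \<and> (\<forall>i<n. i \<notin> F \<longrightarrow> w ! i = w ! \<sigma> i)}"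

lemma finite_words: "finite (words F \<sigma> n)"
  by (rule finite_subset[OF _ finite_lists_length_eq[OF S(1), of n]]) (auto simp: words_def)

lemma take_words:
  assumes "\<forall>i. i \<notin> F \<longrightarrow> \<sigma> i < i" "w \<in> words F \<sigma> n" "p \<le> n"
  shows "take p w \<in> words F \<sigma> p"
proof -
  have "take p w ! i = take p w ! \<sigma> i" if i: "i < p" "i \<notin> F" for i
    using assms(1)[rule_format, OF i(2)] assms(2,3) i by (simp add: words_def)
  then show ?thesis using assms(2,3) set_take_subset[of p w] by (auto simp: words_def)
qed

lemma words_Suc:
  assumes \<sigma>: "\<forall>i. i \<notin> F \<longrightarrow> \<sigma> i < i"
  shows "w @ [a] \<in> words F \<sigma> (Suc n) \<longleftrightarrow> w \<in> words F \<sigma> n \<and> a \<in> S \<and> (n \<notin> F \<longrightarrow> a = w ! \<sigma> n)"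
proof -
  have 1: "(\<forall>i<Suc n. i \<notin> F \<longrightarrow> (w @ [a]) ! i = (w @ [a]) ! \<sigma> i) \<longleftrightarrow>
      (\<forall>i<n. i \<notin> F \<longrightarrow> w ! i = w ! \<sigma> i) \<and> (n \<notin> F \<longrightarrow> a = w ! \<sigma> n)" if "length w = n"
    unfolding All_less_Suc using that \<sigma> by (auto simp: nth_append dest: order.strict_trans)
  show ?thesis unfolding words_def using 1 by auto
qed

text \<open>Appending a symbol offers \<open>card S\<close> choices at a free position and one at a
  forced position. The count is the same for every prefix, so counting words can stand in for a
  uniform measure.\<close>

lemma card_words_extending:
  assumes \<sigma>: "\<forall>i. i \<notin> F \<longrightarrow> \<sigma> i < i" and w: "w \<in> words F \<sigma> p" and "p \<le> n"
  shows "card {w'\<in>words F \<sigma> n. take p w' = w} = card S ^ card (F \<inter> {p..<n})"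
  using \<open>p \<le> n\<close>
proof (induction n rule: dec_induct)
  case base
  have "{w'\<in>words F \<sigma> p. take p w' = w} = {w}" using w by (auto simp: words_def)
  then show ?case by simp
next
  case (step n)
  let ?D = "\<lambda>n. {w'\<in>words F \<sigma> n. take p w' = w}"
  have len: "length x = n" if "x \<in> ?D n" for x n using that by (auto simp: words_def)
  have snoc: "x @ [a] \<in> ?D (Suc n) \<longleftrightarrow> x \<in> ?D n \<and> a \<in> S \<and> (n \<notin> F \<longrightarrow> a = x ! \<sigma> n)" for x a
  proof (cases "length x = n")
    case True
    then have "take p (x @ [a]) = take p x" using step by simp
    then show ?thesis using words_Suc[of F \<sigma> x a n] \<sigma> by auto
  next
    case False
    then show ?thesis by (auto simp: words_def)
  qed
  have ex: "\<exists>x a. y = x @ [a]" if "y \<in> ?D (Suc n)" for y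
    using len[OF that] by (metis length_Suc_conv_rev)
  show ?case
  proof (cases "n \<in> F")
    case True
    have "?D (Suc n) = (\<lambda>(x, a). x @ [a]) ` (?D n \<times> S)"
    proof
      show "?D (Suc n) \<subseteq> (\<lambda>(x, a). x @ [a]) ` (?D n \<times> S)"
      proof
        fix y assume y: "y \<in> ?D (Suc n)"
        then obtain x a where "y = x @ [a]" using ex by blast
        then show "y \<in> (\<lambda>(x, a). x @ [a]) ` (?D n \<times> S)" using y snoc[of x a] by force
      qed
      show "(\<lambda>(x, a). x @ [a]) ` (?D n \<times> S) \<subseteq> ?D (Suc n)" using snoc True by force
    qed
    moreover have "inj_on (\<lambda>(x, a). x @ [a]) (?D n \<times> S)" by (rule inj_onI) auto
    ultimately have "card (?D (Suc n)) = card (?D n) * card S"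
      by (simp add: card_image card_cartesian_product)
    moreover have "F \<inter> {p..<Suc n} = insert n (F \<inter> {p..<n})" using True step by auto
    ultimately show ?thesis using step by simp
  next
    case False
    have "?D (Suc n) = (\<lambda>x. x @ [x ! \<sigma> n]) ` ?D n"
    proof
      show "?D (Suc n) \<subseteq> (\<lambda>x. x @ [x ! \<sigma> n]) ` ?D n"
      proof
        fix y assume y: "y \<in> ?D (Suc n)"
        then obtain x a where "y = x @ [a]" using ex by blast
        then show "y \<in> (\<lambda>x. x @ [x ! \<sigma> n]) ` ?D n" using y snoc[of x a] False by force
      qed
      show "(\<lambda>x. x @ [x ! \<sigma> n]) ` ?D n \<subseteq> ?D (Suc n)"
      proof clarify
        fix x assume x: "x \<in> words F \<sigma> n" "w = take p x"
        then have "x ! \<sigma> n \<in> S" using \<sigma>[rule_format, OF False] by (auto simp: words_def)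
        then show "x @ [x ! \<sigma> n] \<in> words F \<sigma> (Suc n) \<and> take p (x @ [x ! \<sigma> n]) = take p x"
          using snoc[of x "x ! \<sigma> n"] x by simp
      qed
    qed
    moreover have "inj_on (\<lambda>x. x @ [x ! \<sigma> n]) (?D n)" by (rule inj_onI) auto
    ultimately have "card (?D (Suc n)) = card (?D n)" by (simp add: card_image)
    moreover have "F \<inter> {p..<Suc n} = F \<inter> {p..<n}" using False step by (auto simp: less_Suc_eq)
    ultimately show ?thesis using step by simp
  qed
qed

lemma card_words:
  assumes \<sigma>: "\<forall>i. i \<notin> F \<longrightarrow> \<sigma> i < i"
  shows "card (words F \<sigma> n) = card S ^ card (F \<inter> {..<n})"
proof -
  have "[] \<in> words F \<sigma> 0" by (simp add: words_def)
  from card_words_extending[OF \<sigma> this, of n] show ?thesis by (simp add: lessThan_atLeast0)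
qed

text \<open>The ball estimate of the mass distribution principle: only boundedly many cylinders of
  order \<open>p\<close> come near the ball, and each carries the same share of the words. Their
  base points are at least \<open>L\<close> apart in an interval of length at most
  \<open>4 * L\<close>, whence the 5.\<close>

lemma card_words_hitting:
  assumes \<sigma>: "\<forall>i. i \<notin> F \<longrightarrow> \<sigma> i < i" and r: "0 < r" "r \<le> (v - u) / \<bar>b\<bar> ^ p" and pn: "p \<le> n"
  shows "card {w\<in>words F \<sigma> n. \<bar>code w u - x\<bar> < r} * card S ^ card (F \<inter> {..<p}) \<le> 5 * card (words F \<sigma> n)"
proof -
  define L where "L = (v - u) / \<bar>b\<bar> ^ p"
  have L0: "0 < L" using uv b by (simp add: L_def)
  \<comment> \<open>Cutting a word down to its first \<open>p\<close> symbols moves its base point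
    by at most \<open>L\<close>, so the radius grows by \<open>L\<close>.\<close>
  define V where "V = {w\<in>words F \<sigma> p. \<bar>code w u - x\<bar> < r + L}"
  define c where "c w = code w u" for w
  have finV: "finite V" unfolding V_def using finite_words by simp
  have u: "u \<in> {u..v}" using uv by simp
  have sep: "L \<le> \<bar>c w - c w'\<bar>" if "w \<in> V" "w' \<in> V" "w \<noteq> w'" for w w'
    using that code_separated[of w w' p] unfolding V_def words_def L_def c_def by simp
  then have inj: "inj_on c V"
    using L0 by (intro inj_onI) (metis abs_zero diff_self not_le)
  have cV: "c ` V \<subseteq> {x - (r + L) .. x + (r + L)}" unfolding V_def c_def by auto
  have "real (card (c ` V)) \<le> (x + (r + L) - (x - (r + L))) / L + 1"
    using r L0 sep by (intro card_separated(2)[OF cV L0]) (auto simp: inj_on_eq_iff)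
  also have "\<dots> \<le> 5"
  proof -
    have "r \<le> L" using r by (simp add: L_def)
    then have "x + (r + L) - (x - (r + L)) \<le> 4 * L" by simp
    then show ?thesis using L0 by (simp add: pos_divide_le_eq)
  qed
  finally have V5: "card V \<le> 5" by (simp add: card_image[OF inj])
  let ?hit = "{w\<in>words F \<sigma> n. \<bar>code w u - x\<bar> < r}"
  let ?e = "card (F \<inter> {p..<n})"
  have "?hit \<subseteq> (\<Union>w\<in>V. {w'\<in>words F \<sigma> n. take p w' = w})"
  proof
    fix w' assume w': "w' \<in> ?hit"
    let ?w = "take p w'"
    have w: "?w \<in> words F \<sigma> p" using take_words[of F \<sigma> w' n p] \<sigma> w' pn by blast
    have len: "length ?w = p" "set (drop p w') \<subseteq> S"
      using w w' set_drop_subset[of p w'] by (auto simp: words_def)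
    have y: "code (drop p w') u \<in> {u..v}" using code_in[OF len(2) u] .
    have "code w' u = code ?w (code (drop p w') u)" by (metis append_take_drop_id code_append)
    then have "\<bar>code w' u - code ?w u\<bar> = \<bar>code (drop p w') u - u\<bar> / \<bar>b\<bar> ^ p"
      using code_diff[of ?w "code (drop p w') u" u] len(1) by (simp add: abs_divide power_abs)
    also have "\<dots> \<le> L" unfolding L_def using y b by (intro divide_right_mono) auto
    finally have "\<bar>code ?w u - x\<bar> < r + L" using w' by auto
    then show "w' \<in> (\<Union>w\<in>V. {w'\<in>words F \<sigma> n. take p w' = w})" using w w' unfolding V_def by auto
  qed
  then have "card ?hit \<le> card (\<Union>w\<in>V. {w'\<in>words F \<sigma> n. take p w' = w})"
    using finV finite_words by (intro card_mono) auto
  also have "\<dots> \<le> (\<Sum>w\<in>V. card {w'\<in>words F \<sigma> n. take p w' = w})" by (rule card_UN_le[OF finV])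
  also have "\<dots> = card V * card S ^ ?e"
    using card_words_extending[OF \<sigma> _ pn] by (simp add: V_def)
  also have "\<dots> \<le> 5 * card S ^ ?e" using V5 by simp
  finally have "card ?hit * card S ^ card (F \<inter> {..<p}) \<le> 5 * (card S ^ ?e * card S ^ card (F \<inter> {..<p}))"
    by simp
  also have "card S ^ ?e * card S ^ card (F \<inter> {..<p}) = card (words F \<sigma> n)"
  proof -
    have "F \<inter> {..<n} = (F \<inter> {p..<n}) \<union> (F \<inter> {..<p})" using pn by auto
    moreover have "(F \<inter> {p..<n}) \<inter> (F \<inter> {..<p}) = {}" by auto
    ultimately have "card (F \<inter> {..<n}) = ?e + card (F \<inter> {..<p})"
      by (simp add: card_Un_disjoint)
    then show ?thesis using card_words[OF \<sigma>, of n] by (simp add: power_add)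
  qed
  finally show ?thesis .
qed

definition level :: "nat set \<Rightarrow> (nat \<Rightarrow> nat) \<Rightarrow> nat \<Rightarrow> real set" where
  "level F \<sigma> n = (\<Union>w\<in>words F \<sigma> n. code w ` {u..v})"

lemma compact_level: "compact (level F \<sigma> n)"
  unfolding level_def
proof (intro compact_UN finite_words ballI compact_continuous_image)
  fix w
  have "code w y = code w 0 + y / b ^ length w" for y
    using code_diff[of w y 0] by simp
  then have eq: "code w = (\<lambda>y. code w 0 + y / b ^ length w)" by (rule ext)
  have "continuous_on {u..v} (\<lambda>y. code w 0 + y / b ^ length w)"
    using b by (intro continuous_intros) auto
  then show "continuous_on {u..v} (code w)" by (rule ssubst[OF eq])
qed simp

lemma level_mono:
  assumes \<sigma>: "\<forall>i. i \<notin> F \<longrightarrow> \<sigma> i < i" and "p \<le> n"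
  shows "level F \<sigma> n \<subseteq> level F \<sigma> p"
proof
  fix x assume "x \<in> level F \<sigma> n"
  then obtain w y where w: "w \<in> words F \<sigma> n" "y \<in> {u..v}" "x = code w y" unfolding level_def by auto
  have "set (drop p w) \<subseteq> S" using w set_drop_subset[of p w] by (auto simp: words_def)
  then have "code (drop p w) y \<in> {u..v}" using code_in w by blast
  moreover have "x = code (take p w) (code (drop p w) y)" using w by (metis append_take_drop_id code_append)
  moreover have "take p w \<in> words F \<sigma> p" using take_words[of F \<sigma> w n p] \<sigma> w assms(2) by blast
  ultimately show "x \<in> level F \<sigma> p" unfolding level_def by blast
qed

lemma level_unit: "level F \<sigma> n \<subseteq> {0..1}"
proof
  fix x assume "x \<in> level F \<sigma> n"
  then obtain w y where "set w \<subseteq> S" "y \<in> {u..v}" "x = code w y" unfolding level_def words_def by auto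
  then have "x \<in> {u..v}" using code_in by simp
  then show "x \<in> {0..1}" using uv by simp
qed

end

lemma diam_pow_eq: "0 < s \<Longrightarrow> diam_pow s X = ennreal (diameter X powr s)"
  by (simp add: diam_pow_def)

text \<open>Compactness is used twice: removing the open cover leaves nested compact sets with empty
  intersection, so some \<open>K n\<close> is covered already, and this \<open>K n\<close> has a
  finite subcover.\<close>

lemma compact_nest_finite_subcover:
  fixes K :: "nat \<Rightarrow> 'a::heine_borel set"
  assumes K: "\<And>n. compact (K n)" and mono: "\<And>m n. m \<le> n \<Longrightarrow> K n \<subseteq> K m"
    and cover: "(\<Inter>n. K n) \<subseteq> (\<Union>i. B i)" and B: "\<And>i::nat. open (B i)"
  shows "\<exists>n A. finite A \<and> K n \<subseteq> (\<Union>i\<in>A. B i)"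
proof -
  have "\<exists>n. K n - (\<Union>i. B i) = {}"
  proof (rule ccontr)
    assume no: "\<not> ?thesis"
    have "(\<Inter>n. K n - (\<Union>i. B i)) \<noteq> {}"
    proof (rule compact_nest)
      show "compact (K n - (\<Union>i. B i))" for n using K B by (intro compact_diff) auto
      show "K n - (\<Union>i. B i) \<subseteq> K m - (\<Union>i. B i)" if "m \<le> n" for m n using mono[OF that] by auto
    qed (use no in auto)
    then show False using cover by auto
  qed
  then obtain n where n: "K n \<subseteq> (\<Union>i. B i)" by auto
  show ?thesis
  proof (rule compactE_image[OF K[of n] B n])
    fix A :: "nat set" assume "finite A" "K n \<subseteq> (\<Union>i\<in>A. B i)"
    then show ?thesis by blast
  qed
qed

text \<open>
  A mass distribution principle without a measure: since the set is an intersection of compact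
  unions of boxes, it suffices to count the boxes of one level that meet each member of a
  finite cover.
\<close>

lemma hausdorff_measure_product_pos:
  fixes g :: "'n::finite \<Rightarrow> real \<Rightarrow> real" and X :: "(real^'n) set"
  assumes hs: "\<And>k. horseshoe (g k) (b k) (u k) (v k) (S k)"
    and \<sigma>: "\<And>k. \<forall>i. i \<notin> F k \<longrightarrow> \<sigma> k i < i"
    and X: "\<And>x. (\<And>k n. x $ k \<in> horseshoe.level (b k) (u k) (v k) (S k) (F k) (\<sigma> k) n) \<Longrightarrow> x \<in> X"
    and s: "0 < s" and c: "0 < c" and R: "0 < R"
    and scale: "\<And>r. 0 < r \<Longrightarrow> r \<le> R \<Longrightarrow> \<exists>p. (\<forall>k. r \<le> (v k - u k) / \<bar>b k\<bar> ^ p k) \<and>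
        c \<le> r powr s * (\<Prod>k\<in>UNIV. real (card (S k)) ^ card (F k \<inter> {..<p k}))"
  shows "hausdorff_measure s X \<noteq> 0"
proof
  assume null: "hausdorff_measure s X = 0"
  interpret h: horseshoe "g k" "b k" "u k" "v k" "S k" for k by (rule hs)
  let ?W = "\<lambda>k n. horseshoe.words (S k) (F k) (\<sigma> k) n"
  let ?K = "\<lambda>k n. horseshoe.level (b k) (u k) (v k) (S k) (F k) (\<sigma> k) n"
  define d where "d = CARD('n)"
  \<comment> \<open>The second bound makes the final chain of inequalities contradictory; the first
    keeps the enlarged radii below \<open>R\<close>.\<close>
  define e where "e = min (R powr s) (c / (2 * (5 ^ d * (2 powr s + 1))))"
  have e: "0 < e" "e \<le> R powr s" "5 ^ d * (2 powr s + 1) * e < c"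
  proof -
    define Y :: real where "Y = 5 ^ d * (2 powr s + 1)"
    have Y: "0 < Y" unfolding Y_def by (intro mult_pos_pos add_nonneg_pos) auto
    show "0 < e" "e \<le> R powr s" using R c Y unfolding e_def Y_def[symmetric] by auto
    have "Y * e \<le> Y * (c / (2 * Y))" using Y unfolding e_def Y_def[symmetric] by (intro mult_left_mono) auto
    also have "\<dots> = c / 2" using Y by simp
    also have "\<dots> < c" using c by simp
    finally show "5 ^ d * (2 powr s + 1) * e < c" unfolding Y_def .
  qed
  have "hausdorff_premeasure s (R / 2) X \<le> 0"
    using null R unfolding hausdorff_measure_def by (metis SUP_upper greaterThan_iff half_gt_zero)
  then have "hausdorff_premeasure s (R / 2) X < ennreal e" using e(1) by (simp add: ennreal_less_zero_iff)
  then obtain C where C: "C \<in> delta_covers (R / 2) X" "(\<Sum>i. diam_pow s (C i)) < ennreal e"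
    unfolding hausdorff_premeasure_def INF_less_iff by blast
  have CX: "X \<subseteq> (\<Union>i. C i)" and Cb: "\<And>i. bounded (C i)" "\<And>i. diameter (C i) \<le> R / 2"
    using C(1) unfolding delta_covers_def by auto
  \<comment> \<open>Twice the diameter lets an open ball about a point of \<open>C i\<close> contain
    \<open>C i\<close>. The other term supplies a positive radius when the diameter is 0, and its
    \<open>s\<close>-th powers add up to at most \<open>e\<close>.\<close>
  define \<rho> where "\<rho> i = max (2 * diameter (C i)) ((e * (1/2) ^ Suc i) powr (1 / s))" for i
  have d0: "0 \<le> diameter (C i)" for i by (rule diameter_ge_0[OF Cb(1)])
  have \<rho>0: "0 < \<rho> i" for i unfolding \<rho>_def using e(1) by (simp add: less_max_iff_disj)
  have \<rho>R: "\<rho> i \<le> R" for i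
  proof -
    have "e * (1/2) ^ Suc i \<le> e * 1" using e(1) by (intro mult_left_mono power_le_one) auto
    then have "e * (1/2) ^ Suc i \<le> R powr s" using e(2) by linarith
    moreover have "0 \<le> e * (1/2) ^ Suc i" using e(1) by simp
    ultimately have "(e * (1/2) ^ Suc i) powr (1 / s) \<le> (R powr s) powr (1 / s)"
      using s by (intro powr_mono2) (simp_all del: power_Suc)
    also have "\<dots> = R" using R s by (simp add: powr_powr)
    finally show ?thesis using Cb(2)[of i] unfolding \<rho>_def by simp
  qed
  have \<rho>s: "\<rho> i powr s \<le> 2 powr s * diameter (C i) powr s + e * (1/2) ^ Suc i" for i
  proof -
    have 1: "(2 * diameter (C i)) powr s = 2 powr s * diameter (C i) powr s" using d0 by (simp add: powr_mult)
    have 2: "((e * (1/2) ^ Suc i) powr (1 / s)) powr s = e * (1/2) ^ Suc i"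
      using e(1) s by (simp add: powr_powr)
    have 3: "0 \<le> e * (1/2) ^ Suc i" "0 \<le> 2 powr s * diameter (C i) powr s" using e(1) by auto
    show ?thesis
    proof (cases "2 * diameter (C i) \<le> (e * (1/2) ^ Suc i) powr (1 / s)")
      case True
      then have "\<rho> i powr s = e * (1/2) ^ Suc i" unfolding \<rho>_def by (simp only: max_absorb2 2)
      then show ?thesis using 3 by linarith
    next
      case False
      then have "\<rho> i powr s = 2 powr s * diameter (C i) powr s"
        unfolding \<rho>_def by (simp only: max_absorb1 1 not_le less_imp_le)
      then show ?thesis using 3 by linarith
    qed
  qed
  \<comment> \<open>If \<open>C i\<close> is empty, this centre is arbitrary and the inclusion below
    is vacuous.\<close>
  define z where "z i = (SOME x. x \<in> C i)" for i
  have ball: "C i \<subseteq> ball (z i) (\<rho> i)" for i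
  proof
    fix x assume x: "x \<in> C i"
    then have "z i \<in> C i" unfolding z_def by (rule someI)
    then have "dist (z i) x \<le> diameter (C i)" using x by (intro diameter_bounded_bound Cb(1))
    also have "\<dots> < \<rho> i"
    proof (cases "diameter (C i) = 0")
      case True
      then show ?thesis using \<rho>0 by simp
    next
      case False
      then show ?thesis using d0[of i] unfolding \<rho>_def by simp
    qed
    finally show "x \<in> ball (z i) (\<rho> i)" by simp
  qed
  define KK where "KK n = {x::real^'n. \<forall>k. x $ k \<in> ?K k n}" for n
  have "(\<Inter>n. KK n) \<subseteq> X" using X unfolding KK_def by blast
  moreover have "(\<Union>i. C i) \<subseteq> (\<Union>i. ball (z i) (\<rho> i))" by (rule UN_mono[OF order_refl ball])
  ultimately have cover: "(\<Inter>n. KK n) \<subseteq> (\<Union>i. ball (z i) (\<rho> i))" using CX by (meson order_trans)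
  have compK: "compact (KK n)" for n
  proof -
    have "KK n = (\<Inter>k. (\<lambda>x. x $ k) -` ?K k n)" unfolding KK_def by auto
    moreover have "closed ((\<lambda>x::real^'n. x $ k) -` ?K k n)" for k
      by (rule closed_vimage[OF compact_imp_closed[OF h.compact_level]])
        (intro continuous_on_component continuous_on_id)
    ultimately have "closed (KK n)" by (simp add: closed_INT)
    moreover have "KK n \<subseteq> cbox 0 1"
    proof
      fix x assume "x \<in> KK n"
      then have "x $ k \<in> {0..1}" for k using h.level_unit unfolding KK_def by blast
      then show "x \<in> cbox 0 1" by (simp add: mem_box_cart)
    qed
    ultimately show ?thesis by (metis compact_Int_closed compact_cbox inf.absorb_iff2)
  qed
  have monoK: "KK n \<subseteq> KK m" if "m \<le> n" for m n
  proof
    fix x assume "x \<in> KK n"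
    then show "x \<in> KK m" using h.level_mono[OF \<sigma> that] unfolding KK_def by blast
  qed
  from compact_nest_finite_subcover[OF compK monoK cover open_ball]
  obtain n0 A where A: "finite A" "KK n0 \<subseteq> (\<Union>i\<in>A. ball (z i) (\<rho> i))" by blast
  \<comment> \<open>Word lengths differ between coordinates: each is fitted so that the cylinder is
    at least as long as the radius, although the contraction ratios differ.\<close>
  have "\<forall>i. \<exists>p. (\<forall>k. \<rho> i \<le> (v k - u k) / \<bar>b k\<bar> ^ p k) \<and>
        c \<le> \<rho> i powr s * (\<Prod>k\<in>UNIV. real (card (S k)) ^ card (F k \<inter> {..<p k}))"
    using scale[OF \<rho>0 \<rho>R] by blast
  from choice[OF this] obtain p where p: "\<And>i k. \<rho> i \<le> (v k - u k) / \<bar>b k\<bar> ^ p i k"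
    "\<And>i. c \<le> \<rho> i powr s * (\<Prod>k\<in>UNIV. real (card (S k)) ^ card (F k \<inter> {..<p i k}))"
    by blast
  define n where "n = n0 + (\<Sum>i\<in>A. \<Sum>k\<in>UNIV. p i k)"
  have pn: "p i k \<le> n" if "i \<in> A" for i k
  proof -
    have "p i k \<le> (\<Sum>k\<in>UNIV. p i k)" by (intro member_le_sum) auto
    also have "\<dots> \<le> (\<Sum>i\<in>A. \<Sum>k\<in>UNIV. p i k)" using that A(1) by (intro member_le_sum) auto
    finally show ?thesis unfolding n_def by simp
  qed
  define T where "T i = Pi\<^sub>E UNIV (\<lambda>k. {w\<in>?W k n. \<bar>horseshoe.code (b k) w (u k) - z i $ k\<bar> < \<rho> i})" for i
  define tot where "tot = card (Pi\<^sub>E UNIV (\<lambda>k. ?W k n))"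
  have finW: "finite (?W k n)" for k by (rule h.finite_words)
  have finT: "finite (T i)" for i unfolding T_def using finW by (intro finite_PiE) auto
  have "Pi\<^sub>E UNIV (\<lambda>k. ?W k n) \<subseteq> (\<Union>i\<in>A. T i)"
  proof
    fix f assume f: "f \<in> Pi\<^sub>E UNIV (\<lambda>k. ?W k n)"
    define x where "x = (\<chi> k. horseshoe.code (b k) (f k) (u k))"
    have "x \<in> KK n"
      unfolding KK_def h.level_def x_def using f h.uv by (force simp: less_imp_le)
    then have "x \<in> KK n0" using monoK[of n0 n] unfolding n_def by auto
    then obtain i where i: "i \<in> A" "dist (z i) x < \<rho> i" using A(2) by auto
    have "\<bar>horseshoe.code (b k) (f k) (u k) - z i $ k\<bar> < \<rho> i" for k
      using component_le_norm_cart[of "x - z i" k] i(2) by (simp add: x_def dist_norm norm_minus_commute)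
    then show "f \<in> (\<Union>i\<in>A. T i)" using f i(1) unfolding T_def by auto
  qed
  then have "tot \<le> card (\<Union>i\<in>A. T i)" unfolding tot_def using A(1) finT by (intro card_mono) auto
  also have "\<dots> \<le> (\<Sum>i\<in>A. card (T i))" by (rule card_UN_le[OF A(1)])
  finally have tot_le: "real tot \<le> (\<Sum>i\<in>A. real (card (T i)))" by (metis of_nat_le_iff of_nat_sum)
  have tot_eq: "tot = (\<Prod>k\<in>UNIV. card (?W k n))" unfolding tot_def by (simp add: card_PiE)
  have tot0: "0 < real tot"
    unfolding tot_eq using h.card_words[OF \<sigma>] h.S by (simp add: card_gt_0_iff prod_pos)
  \<comment> \<open>The \<open>i\<close>-th ball is hit by at most the fraction
    \<open>5 ^ d * \<rho> i powr s / c\<close> of all tuples of words. Summed over the finite cover,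
    this is less than 1.\<close>
  have T: "c * real (card (T i)) \<le> 5 ^ d * real tot * \<rho> i powr s" if i: "i \<in> A" for i
  proof -
    let ?P = "\<Prod>k\<in>UNIV. card (S k) ^ card (F k \<inter> {..<p i k})"
    have "card (T i) * ?P = (\<Prod>k\<in>UNIV. card {w\<in>?W k n. \<bar>horseshoe.code (b k) w (u k) - z i $ k\<bar> < \<rho> i} * card (S k) ^ card (F k \<inter> {..<p i k}))"
      unfolding T_def by (simp add: card_PiE prod.distrib)
    also have "\<dots> \<le> (\<Prod>k\<in>UNIV. 5 * card (?W k n))"
      using h.card_words_hitting[OF \<sigma> \<rho>0 p(1) pn[OF i]] by (intro prod_mono) auto
    also have "\<dots> = 5 ^ d * tot" by (simp add: prod.distrib tot_eq d_def)
    finally have "real (card (T i) * ?P) \<le> real (5 ^ d * tot)" by (rule of_nat_mono)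
    then have 1: "real (card (T i)) * (\<Prod>k\<in>UNIV. real (card (S k)) ^ card (F k \<inter> {..<p i k})) \<le> 5 ^ d * real tot"
      by simp
    have "c * real (card (T i)) \<le> (\<rho> i powr s * (\<Prod>k\<in>UNIV. real (card (S k)) ^ card (F k \<inter> {..<p i k}))) * real (card (T i))"
      using p(2) by (intro mult_right_mono) auto
    also have "\<dots> = \<rho> i powr s * (real (card (T i)) * (\<Prod>k\<in>UNIV. real (card (S k)) ^ card (F k \<inter> {..<p i k})))"
      by (simp add: mult_ac)
    also have "\<dots> \<le> \<rho> i powr s * (5 ^ d * real tot)" using 1 by (intro mult_left_mono) auto
    finally show ?thesis by (simp add: mult_ac)
  qed
  have sum_diam: "(\<Sum>i\<in>A. diameter (C i) powr s) \<le> e"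
  proof -
    have "ennreal (\<Sum>i\<in>A. diameter (C i) powr s) = (\<Sum>i\<in>A. diam_pow s (C i))"
      by (simp add: diam_pow_eq[OF s] sum_ennreal)
    also have "\<dots> \<le> (\<Sum>i. diam_pow s (C i))" by (rule sum_le_suminf) (use A(1) in auto)
    also have "\<dots> \<le> ennreal e" using C(2) by (rule less_imp_le)
    finally show ?thesis using e(1) by (simp add: ennreal_le_iff)
  qed
  have sum_half: "(\<Sum>i\<in>A. (1/2::real) ^ Suc i) \<le> 1"
    using sum_le_suminf[OF sums_summable[OF power_half_series] A(1)] sums_unique[OF power_half_series] by simp
  have "(\<Sum>i\<in>A. \<rho> i powr s) \<le> (\<Sum>i\<in>A. 2 powr s * diameter (C i) powr s + e * (1/2) ^ Suc i)"
    using \<rho>s by (intro sum_mono)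
  also have "\<dots> = 2 powr s * (\<Sum>i\<in>A. diameter (C i) powr s) + e * (\<Sum>i\<in>A. (1/2) ^ Suc i)"
    by (simp add: sum.distrib sum_distrib_left)
  also have "\<dots> \<le> 2 powr s * e + e * 1"
    using sum_diam sum_half e(1) by (intro add_mono mult_left_mono) auto
  also have "\<dots> = (2 powr s + 1) * e" by (simp add: distrib_right)
  finally have sum_\<rho>: "(\<Sum>i\<in>A. \<rho> i powr s) \<le> (2 powr s + 1) * e" .
  have "c * real tot \<le> c * (\<Sum>i\<in>A. real (card (T i)))" using tot_le c by (intro mult_left_mono) auto
  also have "\<dots> \<le> (\<Sum>i\<in>A. 5 ^ d * real tot * \<rho> i powr s)"
    using T by (simp add: sum_distrib_left sum_mono)
  also have "\<dots> = 5 ^ d * real tot * (\<Sum>i\<in>A. \<rho> i powr s)" by (simp add: sum_distrib_left)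
  also have "\<dots> \<le> 5 ^ d * real tot * ((2 powr s + 1) * e)" using sum_\<rho> by (intro mult_left_mono) auto
  also have "\<dots> = 5 ^ d * (2 powr s + 1) * e * real tot" by (simp add: mult_ac)
  also have "\<dots> < c * real tot" using e(3) tot0 by (intro mult_strict_right_mono) auto
  finally show False by simp
qed

section \<open>The lower bound\<close>

text \<open>The block of copies makes the \<open>N\<close>-th image of \<open>x\<close> begin with
  the first \<open>Q\<close> symbols of \<open>x\<close>; both points lie in one cylinder of order
  \<open>Q\<close>.\<close>

lemma (in horseshoe) level_almost_returns:
  assumes block: "\<And>i. N \<le> i \<Longrightarrow> i < N + Q \<Longrightarrow> i \<notin> F \<and> \<sigma> i = i - N"
    and x: "x \<in> level F \<sigma> (N + Q)"
  shows "\<bar>(g ^^ N) x - x\<bar> \<le> (v - u) / \<bar>b\<bar> ^ Q"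
proof -
  obtain w y where w: "w \<in> words F \<sigma> (N + Q)" "y \<in> {u..v}" "x = code w y"
    using x unfolding level_def by auto
  have len: "length w = N + Q" and wS: "set w \<subseteq> S" using w(1) by (auto simp: words_def)
  have eq: "drop N w = take Q w"
  proof (rule nth_equalityI)
    fix i assume "i < length (drop N w)"
    then have i: "i < Q" using len by simp
    have "w ! (N + i) = w ! \<sigma> (N + i)" using w(1) i block[of "N + i"] by (simp add: words_def)
    then show "drop N w ! i = take Q w ! i" using i len block[of "N + i"] by simp
  qed (simp add: len)
  have "set (drop Q w) \<subseteq> S" using wS set_drop_subset[of Q w] by blast
  then have y': "code (drop Q w) y \<in> {u..v}" using code_in w(2) by blast
  have "(g ^^ N) x = code (take Q w) y"
    unfolding w(3) using iter_code[OF wS w(2), of N] len eq by simp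
  moreover have "x = code (take Q w) (code (drop Q w) y)"
    unfolding w(3) by (metis append_take_drop_id code_append)
  ultimately have "(g ^^ N) x - x = (y - code (drop Q w) y) / b ^ Q"
    using code_diff[of "take Q w" y "code (drop Q w) y"] len by simp
  then have "\<bar>(g ^^ N) x - x\<bar> = \<bar>y - code (drop Q w) y\<bar> / \<bar>b\<bar> ^ Q"
    by (simp add: abs_divide power_abs)
  also have "\<dots> \<le> (v - u) / \<bar>b\<bar> ^ Q"
    using y' w(2) by (intro divide_right_mono) (auto simp: abs_le_iff)
  finally show ?thesis .
qed

lemma horseshoe_branches:
  assumes "\<bar>\<beta>\<bar> > 1" "0 < m" "0 \<le> u" "u < v" "v \<le> 1" "branches \<beta> m {u..v} {u..v} \<noteq> {}"
  shows "horseshoe (beta_map \<beta> ^^ m) (\<beta> ^ m) u v (branches \<beta> m {u..v} {u..v})"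
proof
  show "1 < \<bar>\<beta> ^ m\<bar>" using assms by (simp add: power_abs one_less_power)
  show "finite (branches \<beta> m {u..v} {u..v})" using assms by (intro finite_branches) auto
qed (use assms in \<open>auto simp: branches_def\<close>)

text \<open>
  Between two consecutive values \<open>ln \<bar>\<beta> i\<bar> + t $ i\<close> every summand of \<open>rate\<close> is concave, so
  the quotient \<open>rate \<beta> t \<rho> / \<rho>\<close> is minimal at one of these values.
\<close>

lemma (in recurrence) rate_ge:
  assumes t: "\<And>i. 0 \<le> t $ i" and \<theta>: "\<And>i. \<theta> \<le> theta \<beta> t i" and \<rho>: "0 < \<rho>"
  shows "\<theta> * \<rho> \<le> rate \<beta> t \<rho>"
proof -
  define s where "s k = ln \<bar>\<beta> k\<bar> + t $ k" for k
  define f where "f k x = min x (max (ln \<bar>\<beta> k\<bar>) (x - t $ k))" for k x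
  have rate: "rate \<beta> t x = (\<Sum>k\<in>UNIV. f k x)" for x unfolding rate_def f_def ..
  have s0: "0 < s k" for k using log_expanding[of k] t[of k] by (simp add: s_def)
  have crit: "\<theta> * s i \<le> rate \<beta> t (s i)" for i
    using \<theta>[of i] s0[of i] unfolding theta_eq_rate[OF expanding t] s_def by (simp add: pos_le_divide_eq)
  have f1: "f k x = x - t $ k" if "s k \<le> x" for k x
    using that t[of k] unfolding f_def s_def by (simp add: min_def max_def)
  have f2: "f k x = min x (ln \<bar>\<beta> k\<bar>)" if "x \<le> s k" for k x
    using that t[of k] unfolding f_def s_def by (simp add: min_def max_def)
  \<comment> \<open>The last critical value up to \<rho>, or 0, where every summand of
    \<open>rate\<close> vanishes.\<close>
  define a where "a = Max (insert 0 (s ` {i. s i \<le> \<rho>}))"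
  have a: "0 \<le> a" "a \<le> \<rho>" "\<And>k. s k \<le> \<rho> \<Longrightarrow> s k \<le> a"
    using \<rho> unfolding a_def by auto
  have a_cases: "a = 0 \<or> (\<exists>i. a = s i)"
  proof -
    have "a \<in> insert 0 (s ` {i. s i \<le> \<rho>})" unfolding a_def by (rule Max_in) auto
    then show ?thesis by auto
  qed
  have ra: "\<theta> * a \<le> rate \<beta> t a"
  proof (cases "a = 0")
    case True
    have "f k 0 = 0" for k using log_expanding[of k] unfolding f_def by simp
    then show ?thesis unfolding True rate by simp
  next
    case False
    then show ?thesis using a_cases crit by auto
  qed
  show ?thesis
  proof (cases "\<forall>k. s k \<le> \<rho>")
    case True
    then have sa: "s k \<le> a" for k using a(3) by blast
    then have a0: "0 < a" using s0 less_le_trans by blast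
    \<comment> \<open>Beyond the last critical value \<open>rate\<close> has slope
      \<open>CARD('n)\<close>, so it is enough to know that \<theta> does not exceed this slope; the
      trivial bound at \<open>a\<close> shows it.\<close>
    have "rate \<beta> t a \<le> (\<Sum>k\<in>(UNIV::'n set). a)" unfolding rate f_def by (intro sum_mono) simp
    then have "\<theta> * a \<le> real CARD('n) * a" using ra by simp
    then have d: "\<theta> \<le> real CARD('n)" using a0 by simp
    have "rate \<beta> t \<rho> = (\<Sum>k\<in>UNIV. f k a + (\<rho> - a))"
      unfolding rate using f1 sa True by (intro sum.cong) auto
    also have "\<dots> = rate \<beta> t a + real CARD('n) * (\<rho> - a)" by (simp add: sum.distrib rate)
    also have "\<dots> \<ge> \<theta> * a + \<theta> * (\<rho> - a)"
      using ra d a(2) by (intro add_mono mult_right_mono) auto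
    finally show ?thesis by (simp add: algebra_simps)
  next
    case False
    define b where "b = Min (s ` {i. \<rho> < s i})"
    have ne: "s ` {i. \<rho> < s i} \<noteq> {}" using False by (auto simp: not_le)
    have b: "b \<in> s ` {i. \<rho> < s i}" unfolding b_def using ne by (intro Min_in) auto
    have bmin: "b \<le> s k" if "\<rho> < s k" for k using that unfolding b_def by simp
    have \<rho>b: "\<rho> < b" and rb: "\<theta> * b \<le> rate \<beta> t b" using b crit by auto
    \<comment> \<open>The weight that writes \<rho> as a convex combination of the neighbouring
      critical values \<open>a\<close> and \<open>b\<close>.\<close>
    define w where "w = (b - \<rho>) / (b - a)"
    have ab: "0 < b - a" using \<rho>b a(2) by simp
    have w: "0 \<le> w" "0 \<le> 1 - w" using \<rho>b a(2) ab unfolding w_def by (auto simp: divide_le_eq)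
    have comb: "w * a + (1 - w) * b = \<rho>"
    proof -
      have "w * a + (1 - w) * b = b - w * (b - a)" by (simp add: algebra_simps)
      also have "w * (b - a) = b - \<rho>" using ab unfolding w_def by simp
      finally show ?thesis by simp
    qed
    \<comment> \<open>Between neighbouring critical values a summand is either
      \<open>x - t $ k\<close> or \<open>min x (ln \<bar>\<beta> k\<bar>)\<close>, depending on the
      side of \<open>s k\<close>; both are concave.\<close>
    have conc: "w * f k a + (1 - w) * f k b \<le> f k \<rho>" for k
    proof (cases "s k \<le> \<rho>")
      case True
      then have e: "f k a = a - t $ k" "f k b = b - t $ k" "f k \<rho> = \<rho> - t $ k"
        using f1 a(3) \<rho>b by auto
      have "w * (a - t $ k) + (1 - w) * (b - t $ k) = w * a + (1 - w) * b - t $ k"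
        by (simp add: algebra_simps)
      then show ?thesis unfolding e comb by simp
    next
      case False
      then have k: "b \<le> s k" using bmin by simp
      then have e: "f k a = min a (ln \<bar>\<beta> k\<bar>)" "f k b = min b (ln \<bar>\<beta> k\<bar>)" "f k \<rho> = min \<rho> (ln \<bar>\<beta> k\<bar>)"
        using f2 a(2) \<rho>b by auto
      have "w * min a (ln \<bar>\<beta> k\<bar>) + (1 - w) * min b (ln \<bar>\<beta> k\<bar>) \<le> w * a + (1 - w) * b"
        using w by (intro add_mono mult_left_mono) auto
      moreover have "w * min a (ln \<bar>\<beta> k\<bar>) + (1 - w) * min b (ln \<bar>\<beta> k\<bar>) \<le> w * ln \<bar>\<beta> k\<bar> + (1 - w) * ln \<bar>\<beta> k\<bar>"
        using w by (intro add_mono mult_left_mono) auto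
      ultimately show ?thesis unfolding e comb by (simp add: algebra_simps)
    qed
    have "\<theta> * \<rho> = w * (\<theta> * a) + (1 - w) * (\<theta> * b)" unfolding comb[symmetric] by (simp add: algebra_simps)
    also have "\<dots> \<le> w * rate \<beta> t a + (1 - w) * rate \<beta> t b"
      using ra rb w by (intro add_mono mult_left_mono) auto
    also have "\<dots> = (\<Sum>k\<in>UNIV. w * f k a + (1 - w) * f k b)"
      by (simp add: rate sum.distrib sum_distrib_left)
    also have "\<dots> \<le> rate \<beta> t \<rho>" unfolding rate using conc by (intro sum_mono)
    finally show ?thesis .
  qed
qed

section \<open>Sparse return times and the positions of free symbols\<close>

lemma sparse_sequence:
  fixes G :: "nat \<Rightarrow> nat"
  assumes inf: "\<And>M. \<exists>N\<ge>M. P N" and \<epsilon>: "0 < (\<epsilon>::real)"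
  shows "\<exists>N. (\<forall>j. P (N j) \<and> 1 \<le> N j) \<and>
    (\<forall>j. N j < N (Suc j) \<and> G (N j) \<le> N (Suc j) \<and> real (G (N j)) \<le> \<epsilon> * real (N (Suc j)))"
proof -
  have "\<exists>N. \<forall>j. (P (N j) \<and> 1 \<le> N j) \<and>
    (N j < N (Suc j) \<and> G (N j) \<le> N (Suc j) \<and> real (G (N j)) \<le> \<epsilon> * real (N (Suc j)))"
  proof (rule dependent_nat_choice)
  show "\<exists>x. P x \<and> 1 \<le> x" using inf[of 1] by auto
  fix x :: nat
  obtain y where y: "x + 1 + G x + nat \<lceil>real (G x) / \<epsilon>\<rceil> \<le> y" "P y" using inf by blast
  have "real (G x) / \<epsilon> \<le> real y" using y(1) by linarith
  then have "real (G x) \<le> \<epsilon> * real y" using \<epsilon> by (simp add: pos_divide_le_eq mult.commute)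
  then show "\<exists>y. (P y \<and> 1 \<le> y) \<and> x < y \<and> G x \<le> y \<and> real (G x) \<le> \<epsilon> * real y" using y by auto
  qed
  then show ?thesis by blast
qed

definition forced_in :: "(nat \<Rightarrow> nat) \<Rightarrow> (nat \<Rightarrow> nat) \<Rightarrow> nat \<Rightarrow> nat \<Rightarrow> bool" where
  "forced_in N Q j i \<longleftrightarrow> N j \<le> i \<and> i < N j + Q (N j)"

definition free_positions :: "(nat \<Rightarrow> nat) \<Rightarrow> (nat \<Rightarrow> nat) \<Rightarrow> nat set" where
  "free_positions N Q = {i. \<forall>j. \<not> forced_in N Q j i}"

text \<open>For spaced return times the forced blocks are disjoint, so the choice of
  \<open>j\<close> is unambiguous; at positions in no block the value is arbitrary.\<close>

definition copied_position :: "(nat \<Rightarrow> nat) \<Rightarrow> (nat \<Rightarrow> nat) \<Rightarrow> nat \<Rightarrow> nat" where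
  "copied_position N Q i = i - N (SOME j. forced_in N Q j i)"

lemma copied_position_less:
  assumes "\<And>j. 1 \<le> N j" "i \<notin> free_positions N Q"
  shows "copied_position N Q i < i"
proof -
  have "\<exists>j. forced_in N Q j i" using assms(2) unfolding free_positions_def by blast
  then have "forced_in N Q (SOME j. forced_in N Q j i) i" by (rule someI_ex)
  then show ?thesis using assms(1)[of "SOME j. forced_in N Q j i"]
    unfolding forced_in_def copied_position_def by simp
qed

lemma forced_in_unique:
  assumes step: "\<And>j. N j + Q (N j) \<le> N (Suc j)" and "forced_in N Q j i" "forced_in N Q j' i"
  shows "j = j'"
proof -
  have mono: "N a \<le> N b" if "a \<le> b" for a b
    using that by (rule lift_Suc_mono_le[rotated]) (meson step le_add1 order_trans)
  have no: False if "a < b" "forced_in N Q a i" "forced_in N Q b i" for a b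
  proof -
    have "N a + Q (N a) \<le> N b" using step[of a] mono[of "Suc a" b] that(1) by simp
    then show False using that unfolding forced_in_def by simp
  qed
  show ?thesis using no[of j j'] no[of j' j] assms(2,3) by (cases j j' rule: linorder_cases) auto
qed

lemma block_position:
  assumes step: "\<And>j. N j + Q (N j) \<le> N (Suc j)" and i: "N j \<le> i" "i < N j + Q (N j)"
  shows "i \<notin> free_positions N Q \<and> copied_position N Q i = i - N j"
proof -
  have j: "forced_in N Q j i" using i unfolding forced_in_def by simp
  then have "forced_in N Q (SOME j. forced_in N Q j i) i" by (rule someI)
  then have "(SOME j. forced_in N Q j i) = j" using forced_in_unique[OF step _ j] by blast
  then show ?thesis using j unfolding free_positions_def copied_position_def by auto
qed

text \<open>Among positions below \<open>p\<close>, all blocks before the \<open>i\<close>-th end by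
  \<open>\<epsilon> * N i\<close>, later blocks start at or after \<open>p\<close>, and the
  \<open>i\<close>-th block removes just its part below \<open>p\<close>. The min-max is
  \<open>p\<close> minus the length of that part.\<close>

lemma card_free_positions:
  fixes \<epsilon> :: real
  assumes step: "\<And>j. N j \<le> N (Suc j)" and sparse: "\<And>j. real (N j + Q (N j)) \<le> \<epsilon> * real (N (Suc j))"
    and \<epsilon>: "0 \<le> \<epsilon>" and p: "p \<le> N (Suc i)"
  shows "min (real p) (max (real (N i)) (real p - real (Q (N i)))) - \<epsilon> * real (N i) - 1
    \<le> real (card (free_positions N Q \<inter> {..<p}))"
proof -
  have mono: "N a \<le> N b" if "a \<le> b" for a b
    using that by (rule lift_Suc_mono_le[rotated]) (rule step)
  let ?A = "free_positions N Q \<inter> {..<p}" and ?B = "{..<nat \<lceil>\<epsilon> * real (N i)\<rceil>}"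
    and ?C = "{N i..<min p (N i + Q (N i))}"
  have "{..<p} \<subseteq> ?A \<union> ?B \<union> ?C"
  proof
    fix x assume x: "x \<in> {..<p}"
    show "x \<in> ?A \<union> ?B \<union> ?C"
    proof (cases "x \<in> free_positions N Q")
      case False
      then obtain j where j: "N j \<le> x" "x < N j + Q (N j)" unfolding free_positions_def forced_in_def by auto
      consider "j < i" | "j = i" | "i < j" by linarith
      then show ?thesis
      proof cases
        case 1
        then have "real (N (Suc j)) \<le> real (N i)" using mono[of "Suc j" i] by simp
        then have "\<epsilon> * real (N (Suc j)) \<le> \<epsilon> * real (N i)" using \<epsilon> by (rule mult_left_mono)
        then have "real x < \<epsilon> * real (N i)" using sparse[of j] j(2) by linarith
        then have "x < nat \<lceil>\<epsilon> * real (N i)\<rceil>" by linarith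
        then show ?thesis by simp
      next
        case 2
        then show ?thesis using j x by simp
      next
        case 3
        then have "N (Suc i) \<le> N j" using mono by simp
        then show ?thesis using j p x by simp
      qed
    qed (use x in simp)
  qed
  then have "card {..<p} \<le> card (?A \<union> ?B \<union> ?C)" by (intro card_mono) auto
  also have "\<dots> \<le> card ?A + card ?B + card ?C"
    by (meson add_le_mono card_Un_le le_refl order_trans)
  finally have "real p \<le> real (card ?A) + real (nat \<lceil>\<epsilon> * real (N i)\<rceil>) + real (min p (N i + Q (N i)) - N i)"
    by simp
  moreover have "real (nat \<lceil>\<epsilon> * real (N i)\<rceil>) \<le> \<epsilon> * real (N i) + 1"
  proof -
    have "0 \<le> \<epsilon> * real (N i)" using \<epsilon> by simp
    then show ?thesis by linarith
  qed
  moreover have "real p - real (min p (N i + Q (N i)) - N i) = min (real p) (max (real (N i)) (real p - real (Q (N i))))"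
  proof (cases "p \<le> N i")
    case False
    then show ?thesis by (cases "p \<le> N i + Q (N i)") (auto simp: min_def max_def)
  qed (simp add: min_def max_def)
  ultimately show ?thesis by linarith
qed

text \<open>Rounding a good time \<open>n\<close> down to a multiple of \<open>m\<close> can only
  increase \<psi>. The rounding error in the exponent is absorbed by half of \<eta> once
  \<open>N\<close> is large.\<close>

lemma (in recurrence) often_psi_large:
  assumes t: "t \<in> exponent_acc_points \<psi>" and \<eta>: "0 < \<eta>" and m: "0 < m"
  shows "\<exists>N\<ge>M. \<forall>k. exp (- (real N * real m * (t $ k + \<eta>))) \<le> \<psi> k (real (m * N))"
proof -
  have t0: "0 \<le> t $ k" for k using acc_point_nonneg[OF t] .
  let ?K = "{x::real^'n. \<forall>k. x $ k < t $ k + \<eta> / 2}"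
  have "?K = (\<Inter>k. {x. x $ k < t $ k + \<eta> / 2})" by auto
  moreover have "open {x::real^'n. x $ k < t $ k + \<eta> / 2}" for k
    by (intro open_Collect_less continuous_on_component continuous_on_id continuous_on_const)
  ultimately have "open ?K" by (simp add: open_INT)
  moreover have "t \<in> ?K" using \<eta> by simp
  ultimately have inf: "\<exists>\<^sub>\<infinity>n. exponents \<psi> n \<in> ?K"
    using t unfolding exponent_acc_points_eq seq_acc_points_def by blast
  \<comment> \<open>Large enough for
    \<open>(N + 1) * (t $ k + \<eta> / 2) \<le> N * (t $ k + \<eta>)\<close> in every
    coordinate.\<close>
  define L where "L = (\<Sum>k\<in>UNIV. nat \<lceil>(2 * t $ k + \<eta>) / \<eta>\<rceil>) + M + 1"
  obtain n where n: "m * L \<le> n" "exponents \<psi> n \<in> ?K" using inf unfolding INFM_nat_le by blast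
  define N where "N = n div m"
  have NL: "L \<le> N" using n(1) m unfolding N_def by (simp add: less_eq_div_iff_mult_less_eq mult.commute)
  have n0: "0 < n" using n(1) m unfolding L_def by (cases n) auto
  have mN: "m * N \<le> n" unfolding N_def by simp
  have nm: "n \<le> m * (N + 1)" unfolding N_def using dividend_less_times_div[OF m, of n] by simp
  have "exp (- (real N * real m * (t $ k + \<eta>))) \<le> \<psi> k (real (m * N))" for k
  proof -
    have "nat \<lceil>(2 * t $ k + \<eta>) / \<eta>\<rceil> \<le> (\<Sum>k\<in>UNIV. nat \<lceil>(2 * t $ k + \<eta>) / \<eta>\<rceil>)"
      by (intro member_le_sum) auto
    then have "(2 * t $ k + \<eta>) / \<eta> \<le> real N" using NL unfolding L_def by linarith
    then have 1: "2 * t $ k + \<eta> \<le> real N * \<eta>" using \<eta> by (simp add: pos_divide_le_eq)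
    have "real n * exponents \<psi> n $ k \<le> real n * (t $ k + \<eta> / 2)"
      using n(2) by (intro mult_left_mono) (auto intro: less_imp_le)
    also have "\<dots> \<le> real (m * (N + 1)) * (t $ k + \<eta> / 2)"
      using of_nat_mono[OF nm, where 'a = real] t0[of k] \<eta> by (intro mult_right_mono) auto
    also have "\<dots> = real m * (real N * (t $ k + \<eta> / 2) + (t $ k + \<eta> / 2))" by (simp add: algebra_simps)
    also have "\<dots> \<le> real m * (real N * (t $ k + \<eta>))"
      using 1 by (intro mult_left_mono) (simp_all add: algebra_simps)
    finally have "exp (- (real N * real m * (t $ k + \<eta>))) \<le> exp (- real n * exponents \<psi> n $ k)"
      by (simp add: mult_ac)
    also have "\<dots> = \<psi> k (real n)" using psi_eq_exp[OF n0] by simp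
    also have "\<dots> \<le> \<psi> k (real (m * N))" by (rule psi_mono[OF mN])
    finally show ?thesis .
  qed
  moreover have "M \<le> N" using NL unfolding L_def by simp
  ultimately show ?thesis by blast
qed

text \<open>The common period is the product of the separate ones. The entropy loss is relative, so
  the same factor \<open>1 - \<kappa>\<close> can later be pulled out of the sum over
  coordinates.\<close>

lemma common_horseshoes:
  fixes \<beta> :: "'n::finite \<Rightarrow> real"
  assumes \<beta>: "\<And>k. \<bar>\<beta> k\<bar> > 1" and \<kappa>: "0 < \<kappa>"
  shows "\<exists>m u v. 0 < m \<and> (\<forall>k. 0 \<le> u k \<and> u k < v k \<and> v k \<le> 1 \<and>
    exp (real m * ((1 - \<kappa>) * ln \<bar>\<beta> k\<bar>)) \<le> real (card (branches (\<beta> k) m {u k..v k} {u k..v k})))"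
proof -
  have "\<exists>z. 0 < fst z \<and> 0 \<le> fst (snd z) \<and> fst (snd z) < snd (snd z) \<and> snd (snd z) \<le> 1 \<and>
    exp (real (fst z) * ((1 - \<kappa>) * ln \<bar>\<beta> k\<bar>))
      \<le> real (card (branches (\<beta> k) (fst z) {fst (snd z)..snd (snd z)} {fst (snd z)..snd (snd z)}))" for k
  proof (rule horseshoe_exists[OF \<beta>[of k], of "\<kappa> * ln \<bar>\<beta> k\<bar>"])
    show "0 < \<kappa> * ln \<bar>\<beta> k\<bar>" using \<kappa> \<beta>[of k] by simp
    fix m u v assume "0 < m" "0 \<le> u" "u < v" "v \<le> 1"
      "exp (real m * (ln \<bar>\<beta> k\<bar> - \<kappa> * ln \<bar>\<beta> k\<bar>)) \<le> real (card (branches (\<beta> k) m {u..v} {u..v}))"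
    then show ?thesis by (intro exI[of _ "(m, u, v)"]) (simp add: left_diff_distrib)
  qed
  then have "\<forall>k. \<exists>z. 0 < fst z \<and> 0 \<le> fst (snd z) \<and> fst (snd z) < snd (snd z) \<and> snd (snd z) \<le> 1 \<and>
    exp (real (fst z) * ((1 - \<kappa>) * ln \<bar>\<beta> k\<bar>))
      \<le> real (card (branches (\<beta> k) (fst z) {fst (snd z)..snd (snd z)} {fst (snd z)..snd (snd z)}))" by blast
  from choice[OF this] obtain z where z: "\<And>k. 0 < fst (z k) \<and> 0 \<le> fst (snd (z k)) \<and>
    fst (snd (z k)) < snd (snd (z k)) \<and> snd (snd (z k)) \<le> 1 \<and>
    exp (real (fst (z k)) * ((1 - \<kappa>) * ln \<bar>\<beta> k\<bar>))
      \<le> real (card (branches (\<beta> k) (fst (z k)) {fst (snd (z k))..snd (snd (z k))} {fst (snd (z k))..snd (snd (z k))}))"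
    by blast
  define M where "M k = fst (z k)" for k
  define u where "u k = fst (snd (z k))" for k
  define v where "v k = snd (snd (z k))" for k
  define m where "m = (\<Prod>k\<in>UNIV. M k)"
  have z: "0 < M k" "0 \<le> u k" "u k < v k" "v k \<le> 1"
    "exp (real (M k) * ((1 - \<kappa>) * ln \<bar>\<beta> k\<bar>)) \<le> real (card (branches (\<beta> k) (M k) {u k..v k} {u k..v k}))" for k
    using z[of k] unfolding M_def u_def v_def by auto
  have m0: "0 < m" unfolding m_def using z(1) by (intro prod_pos) auto
  have "exp (real m * ((1 - \<kappa>) * ln \<bar>\<beta> k\<bar>)) \<le> real (card (branches (\<beta> k) m {u k..v k} {u k..v k}))" for k
  proof -
    have "M k dvd m" unfolding m_def by (rule dvd_prodI) auto
    then obtain q where q: "m = M k * q" by blast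
    have "exp (real m * ((1 - \<kappa>) * ln \<bar>\<beta> k\<bar>)) = exp (real (M k) * ((1 - \<kappa>) * ln \<bar>\<beta> k\<bar>)) ^ q"
      unfolding q by (simp add: exp_of_nat_mult[symmetric] mult_ac)
    also have "\<dots> \<le> real (card (branches (\<beta> k) (M k) {u k..v k} {u k..v k})) ^ q"
      using z(5) by (intro power_mono) auto
    also have "\<dots> = real (card (branches (\<beta> k) (M k) {u k..v k} {u k..v k}) ^ q)" by simp
    also have "\<dots> \<le> real (card (branches (\<beta> k) m {u k..v k} {u k..v k}))"
      unfolding q using \<beta>[of k] z(2-4)[of k] by (intro of_nat_mono card_branches_power) auto
    finally show ?thesis .
  qed
  then show ?thesis using m0 z(2-4) by blast
qed

section \<open>Free symbols seen at a given scale and positivity of the measure\<close>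

context recurrence
begin

text \<open>Multiplying the free positions by \<open>ln \<bar>\<beta> k\<bar>\<close> puts all
  coordinates on a common scale. The main terms add up to \<open>N * rate \<beta> t (Z / N)\<close>,
  to which \<open>rate_ge\<close> applies; the remaining terms collect rounding and the losses
  \<eta> and \<epsilon>.\<close>

lemma weighted_free_count:
  fixes p :: "'n \<Rightarrow> nat" and fr :: "'n \<Rightarrow> real" and N :: nat and Q :: "'n \<Rightarrow> nat"
  assumes t: "\<And>k. 0 \<le> t $ k" and \<theta>: "\<And>i. \<theta> \<le> theta \<beta> t i" and N: "0 < N" and Z: "0 < Z"
    and fr: "\<And>k. min (real (p k)) (max (real N) (real (p k) - real (Q k))) - \<epsilon> * real N - 1 \<le> fr k"
    and p: "\<And>k. Z - a \<le> real (p k) * ln \<bar>\<beta> k\<bar>" and a: "0 \<le> a"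
    and Q: "\<And>k. real (Q k) * ln \<bar>\<beta> k\<bar> \<le> real N * (t $ k + \<eta>) + ln \<bar>\<beta> k\<bar>" and \<eta>: "0 \<le> \<eta>"
  shows "\<theta> * Z - real N * (real CARD('n) * \<eta> + \<epsilon> * (\<Sum>k\<in>UNIV. ln \<bar>\<beta> k\<bar>))
      - (real CARD('n) * a + 2 * (\<Sum>k\<in>UNIV. ln \<bar>\<beta> k\<bar>)) \<le> (\<Sum>k\<in>UNIV. fr k * ln \<bar>\<beta> k\<bar>)"
proof -
  have each: "min Z (max (real N * ln \<bar>\<beta> k\<bar>) (Z - real N * t $ k))
      - (real N * (\<eta> + \<epsilon> * ln \<bar>\<beta> k\<bar>) + (a + 2 * ln \<bar>\<beta> k\<bar>)) \<le> fr k * ln \<bar>\<beta> k\<bar>" for k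
  proof -
    let ?l = "ln \<bar>\<beta> k\<bar>"
    have l: "0 < ?l" by (rule log_expanding)
    have "(min (real (p k)) (max (real N) (real (p k) - real (Q k))) - \<epsilon> * real N - 1) * ?l \<le> fr k * ?l"
      using fr[of k] l by (intro mult_right_mono) auto
    moreover have "min (real (p k)) (max (real N) (real (p k) - real (Q k))) * ?l
        = min (real (p k) * ?l) (max (real N * ?l) (real (p k) * ?l - real (Q k) * ?l))"
      using l by (simp add: min_mult_distrib_right max_mult_distrib_right left_diff_distrib)
    moreover have "min Z (max (real N * ?l) (Z - real N * t $ k)) - a - real N * \<eta> - ?l
        \<le> min (real (p k) * ?l) (max (real N * ?l) (real (p k) * ?l - real (Q k) * ?l))"
    proof -
      have 0: "0 \<le> real N * \<eta>" using \<eta> by simp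
      have 1: "real (Q k) * ?l \<le> real N * t $ k + real N * \<eta> + ?l" using Q[of k] by (simp add: distrib_left)
      have 2: "max (real N * ?l) (Z - real N * t $ k) - a - real N * \<eta> - ?l
          \<le> max (real N * ?l) (real (p k) * ?l - real (Q k) * ?l)"
        using 0 1 p[of k] a l by linarith
      show ?thesis
      proof (rule min.boundedI)
        show "min Z (max (real N * ?l) (Z - real N * t $ k)) - a - real N * \<eta> - ?l \<le> real (p k) * ?l"
          using min.cobounded1[of Z "max (real N * ?l) (Z - real N * t $ k)"] p[of k] 0 l by linarith
        show "min Z (max (real N * ?l) (Z - real N * t $ k)) - a - real N * \<eta> - ?l
            \<le> max (real N * ?l) (real (p k) * ?l - real (Q k) * ?l)"
          using min.cobounded2[of Z "max (real N * ?l) (Z - real N * t $ k)"] 2 by linarith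
      qed
    qed
    ultimately have "min Z (max (real N * ?l) (Z - real N * t $ k)) - a - real N * \<eta> - ?l - \<epsilon> * real N * ?l - ?l \<le> fr k * ?l"
      by (simp only: left_diff_distrib mult_1)
    then show ?thesis by (simp only: distrib_left mult.assoc mult.left_commute[of \<epsilon>])
  qed
  have "\<theta> * (Z / real N) \<le> rate \<beta> t (Z / real N)"
    by (rule rate_ge[OF t \<theta>]) (use N Z in simp)
  then have "real N * (\<theta> * (Z / real N)) \<le> real N * rate \<beta> t (Z / real N)"
    by (rule mult_left_mono) simp
  also have "\<dots> = (\<Sum>k\<in>UNIV. min Z (max (real N * ln \<bar>\<beta> k\<bar>) (Z - real N * t $ k)))"
    using N unfolding rate_def sum_distrib_left
    by (simp add: min_mult_distrib_left max_mult_distrib_left right_diff_distrib)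
  finally have "\<theta> * Z \<le> (\<Sum>k\<in>UNIV. min Z (max (real N * ln \<bar>\<beta> k\<bar>) (Z - real N * t $ k)))"
    using N by simp
  moreover have "(\<Sum>k\<in>UNIV. min Z (max (real N * ln \<bar>\<beta> k\<bar>) (Z - real N * t $ k)))
      - (\<Sum>k\<in>UNIV. real N * (\<eta> + \<epsilon> * ln \<bar>\<beta> k\<bar>) + (a + 2 * ln \<bar>\<beta> k\<bar>)) \<le> (\<Sum>k\<in>UNIV. fr k * ln \<bar>\<beta> k\<bar>)"
    unfolding sum_subtractf[symmetric] using each by (intro sum_mono)
  moreover have "(\<Sum>k\<in>UNIV. real N * (\<eta> + \<epsilon> * ln \<bar>\<beta> k\<bar>) + (a + 2 * ln \<bar>\<beta> k\<bar>))
      = real N * (real CARD('n) * \<eta> + \<epsilon> * (\<Sum>k\<in>UNIV. ln \<bar>\<beta> k\<bar>))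
        + (real CARD('n) * a + 2 * (\<Sum>k\<in>UNIV. ln \<bar>\<beta> k\<bar>))"
    by (simp add: sum.distrib sum_distrib_left[symmetric])
  ultimately show ?thesis by linarith
qed

lemma hausdorff_measure_recurrent_set_pos:
  assumes t: "t \<in> exponent_acc_points \<psi>" and s: "0 < s" "s < \<theta>" and \<theta>: "\<And>i. \<theta> \<le> theta \<beta> t i"
  shows "hausdorff_measure s (recurrent_set \<beta> \<psi>) \<noteq> 0"
proof -
  let ?l = "\<lambda>k. ln \<bar>\<beta> k\<bar>"
  have t0: "0 \<le> t $ k" for k using acc_point_nonneg[OF t] .
  define d where "d = real CARD('n)"
  have d: "0 < d" unfolding d_def by (simp add: card_gt_0_iff)
  define l0 where "l0 = (MIN k. ?l k)"
  have l0: "0 < l0" "\<And>k. l0 \<le> ?l k" using log_expanding unfolding l0_def by auto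
  define L where "L = (\<Sum>k\<in>UNIV. ?l k)"
  have lL: "?l k \<le> L" for k unfolding L_def using log_expanding by (intro member_le_sum) (auto intro: less_imp_le)
  have L0: "0 < L" using lL[of undefined] log_expanding[of undefined] by linarith
  \<comment> \<open>The gap between \<open>s\<close> and \<theta> is split at the midpoint: \<kappa>
    brings the midpoint down to \<open>s\<close>, while \<eta> and \<epsilon> below each use up half
    of the upper part.\<close>
  define \<kappa> where "\<kappa> = (\<theta> - s) / (\<theta> + s)"
  have \<kappa>: "0 < \<kappa>" "(1 - \<kappa>) * ((\<theta> + s) / 2) = s" "0 < 1 - \<kappa>" using s by (auto simp: \<kappa>_def field_simps)
  define \<eta> where "\<eta> = l0 * (\<theta> - s) / (4 * d)"
  define \<epsilon> where "\<epsilon> = l0 * (\<theta> - s) / (4 * L)"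
  have \<eta>: "0 < \<eta>" and \<epsilon>: "0 < \<epsilon>" using l0 s d L0 unfolding \<eta>_def \<epsilon>_def by auto
  have loss: "d * \<eta> + \<epsilon> * L = l0 * ((\<theta> - s) / 2)" using d L0 unfolding \<eta>_def \<epsilon>_def by (simp add: field_simps)
  from common_horseshoes[of \<beta>, OF expanding \<kappa>(1)] obtain m u v where m: "0 < m"
    and muv: "\<forall>k. 0 \<le> u k \<and> u k < v k \<and> v k \<le> 1 \<and>
      exp (real m * ((1 - \<kappa>) * ?l k)) \<le> real (card (branches (\<beta> k) m {u k..v k} {u k..v k}))"
    by (elim exE conjE) (rule that; assumption)
  then have uv: "0 \<le> u k" "u k < v k" "v k \<le> 1"
    and card: "exp (real m * ((1 - \<kappa>) * ?l k)) \<le> real (card (branches (\<beta> k) m {u k..v k} {u k..v k}))" for k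
    by simp_all
  define S where "S k = branches (\<beta> k) m {u k..v k} {u k..v k}" for k
  define b where "b k = \<beta> k ^ m" for k
  define g where "g k = beta_map (\<beta> k) ^^ m" for k
  have S_pos: "0 < card (S k)" for k
    using card[of k] exp_gt_zero[of "real m * ((1 - \<kappa>) * ?l k)"] unfolding S_def[symmetric] by linarith
  have hs: "horseshoe (g k) (b k) (u k) (v k) (S k)" for k
    unfolding g_def b_def S_def
    using S_pos[of k] by (intro horseshoe_branches expanding m uv) (auto simp: S_def)
  have b: "\<bar>b k\<bar> ^ q = exp (real q * real m * ?l k)" for k q
  proof -
    have "\<bar>b k\<bar> ^ q = \<bar>\<beta> k\<bar> ^ (q * m)"
      by (simp add: b_def power_abs power_mult[symmetric] mult.commute)
    also have "\<dots> = exp (real (q * m) * ?l k)" using expanding[of k] by (simp add: exp_of_nat_mult del: of_nat_mult)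
    finally show ?thesis by simp
  qed
  \<comment> \<open>The least length for which the cylinder factor is strictly smaller than the
    lower bound on \<psi>; the added 1 makes it strict.\<close>
  define Q where "Q k N = nat \<lfloor>real N * (t $ k + \<eta>) / ?l k\<rfloor> + 1" for k N
  have Q: "real N * (t $ k + \<eta>) < real (Q k N) * ?l k" "real (Q k N) * ?l k \<le> real N * (t $ k + \<eta>) + ?l k" for k N
  proof -
    let ?q = "real N * (t $ k + \<eta>) / ?l k"
    have "0 \<le> ?q" using t0[of k] \<eta> log_expanding[of k] by simp
    then have "?q < real (Q k N)" "real (Q k N) \<le> ?q + 1" unfolding Q_def by linarith+
    then have *: "?q * ?l k < real (Q k N) * ?l k" "real (Q k N) * ?l k \<le> (?q + 1) * ?l k"
      using log_expanding[of k] by (simp_all only: mult_less_cancel_right_pos mult_le_cancel_right_pos)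
    have eq: "?q * ?l k = real N * (t $ k + \<eta>)" using log_expanding[of k] by simp
    show "real N * (t $ k + \<eta>) < real (Q k N) * ?l k" "real (Q k N) * ?l k \<le> real N * (t $ k + \<eta>) + ?l k"
      using * unfolding distrib_right eq by simp_all
  qed
  define G where "G n = n + (\<Sum>k\<in>UNIV. Q k n)" for n
  have QG: "n + Q k n \<le> G n" for k n
    unfolding G_def using member_le_sum[of k UNIV "\<lambda>k. Q k n"] by simp
  from sparse_sequence[OF often_psi_large[OF t \<eta> m] \<epsilon>, of G] obtain N
    where N': "\<forall>j. (\<forall>k. exp (- (real (N j) * real m * (t $ k + \<eta>))) \<le> \<psi> k (real (m * N j))) \<and> 1 \<le> N j"
      "\<forall>j. N j < N (Suc j) \<and> G (N j) \<le> N (Suc j) \<and> real (G (N j)) \<le> \<epsilon> * real (N (Suc j))"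
    by (elim exE conjE) (rule that; assumption)
  have N: "\<And>j k. exp (- (real (N j) * real m * (t $ k + \<eta>))) \<le> \<psi> k (real (m * N j))" "\<And>j. 1 \<le> N j"
    "\<And>j. N j < N (Suc j)" "\<And>j. G (N j) \<le> N (Suc j)" "\<And>j. real (G (N j)) \<le> \<epsilon> * real (N (Suc j))"
    using N' by simp_all
  have step: "N j + Q k (N j) \<le> N (Suc j)" for j k using QG[of "N j" k] N(4)[of j] by linarith
  have sparse: "real (N j + Q k (N j)) \<le> \<epsilon> * real (N (Suc j))" for j k
    using of_nat_mono[OF QG[of "N j" k], where 'a = real] N(5)[of j] by linarith
  have smono: "strict_mono N" using N(3) by (rule strict_monoI_Suc)
  define F where "F k = free_positions N (Q k)" for k
  define \<sigma> where "\<sigma> k = copied_position N (Q k)" for k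
  have \<sigma>: "\<forall>i. i \<notin> F k \<longrightarrow> \<sigma> k i < i" for k
    unfolding F_def \<sigma>_def using copied_position_less[of N] N(2) by blast
  have recur: "x \<in> recurrent_set \<beta> \<psi>"
    if x: "\<And>k n. x $ k \<in> horseshoe.level (b k) (u k) (v k) (S k) (F k) (\<sigma> k) n" for x :: "real^'n"
  proof -
    have unit: "x $ k \<in> {0..1}" for k using horseshoe.level_unit[OF hs] x by blast
    have close: "\<bar>(beta_map (\<beta> k) ^^ (m * N j)) (x $ k) - x $ k\<bar> < \<psi> k (real (m * N j))" for j k
    proof -
      have "\<bar>(g k ^^ N j) (x $ k) - x $ k\<bar> \<le> (v k - u k) / \<bar>b k\<bar> ^ Q k (N j)"
        using block_position[of N "Q k", OF step] unfolding F_def \<sigma>_def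
        by (intro horseshoe.level_almost_returns[OF hs _ x]) (auto simp: F_def \<sigma>_def)
      also have "\<dots> \<le> 1 / \<bar>b k\<bar> ^ Q k (N j)" using uv(1,3)[of k] by (intro divide_right_mono) auto
      also have "\<dots> = exp (- (real m * (real (Q k (N j)) * ?l k)))" unfolding b by (simp add: exp_minus divide_inverse mult_ac)
      also have "\<dots> < exp (- (real (N j) * real m * (t $ k + \<eta>)))"
        using mult_strict_left_mono[OF Q(1)[of "N j" k], of "real m"] m by (simp add: mult_ac)
      also have "\<dots> \<le> \<psi> k (real (m * N j))" by (rule N(1))
      finally show ?thesis unfolding g_def by (simp add: funpow_mult)
    qed
    have "\<exists>\<^sub>\<infinity>n::nat. \<forall>k. \<bar>(beta_map (\<beta> k) ^^ n) (x $ k) - x $ k\<bar> < \<psi> k (real n)"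
      unfolding INFM_nat_le
    proof
      fix M
      have "M \<le> N M" using seq_suble[OF smono] .
      also have "\<dots> \<le> m * N M" using m by simp
      finally show "\<exists>n\<ge>M. \<forall>k. \<bar>(beta_map (\<beta> k) ^^ n) (x $ k) - x $ k\<bar> < \<psi> k (real n)"
        using close[where j = M] by blast
    qed
    then show ?thesis unfolding recurrent_set_def using unit by blast
  qed
  define c1 where "c1 = (\<Sum>k\<in>UNIV. - ln (v k - u k))"
  have lvu: "ln (v k - u k) \<le> 0" for k using uv[of k] by simp
  have c1: "0 \<le> c1" "- ln (v k - u k) \<le> c1" for k
  proof -
    show "0 \<le> c1" unfolding c1_def using lvu by (intro sum_nonneg) simp
    show "- ln (v k - u k) \<le> c1" unfolding c1_def using lvu by (intro member_le_sum) auto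
  qed
  define a where "a = c1 + L"
  define B where "B = d * a + 2 * L"
  \<comment> \<open>Small enough that, below this radius, some coordinate needs words reaching past
    the initial return time \<open>N 0\<close>.\<close>
  define r0 where "r0 = exp (- (real m * (a + real (N 0) * L + 1)))"
  show ?thesis
  proof (rule hausdorff_measure_product_pos[OF hs \<sigma> recur s(1), where c = "exp (- (real m * (1 - \<kappa>) * B))" and R = r0])
    fix r :: real assume r: "0 < r" "r \<le> r0"
    define Z where "Z = - ln r / real m"
    have lnr: "ln r = - (real m * Z)" using m by (simp add: Z_def)
    have Za: "a + real (N 0) * L + 1 \<le> Z"
    proof -
      have "ln r \<le> ln r0" using r unfolding r0_def by (subst ln_le_cancel_iff) auto
      then have "real m * (a + real (N 0) * L + 1) \<le> real m * Z" unfolding r0_def lnr by simp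
      then show ?thesis using m by simp
    qed
    have a0: "0 \<le> a" using c1(1) L0 by (simp add: a_def)
    have NL0: "0 \<le> real (N 0) * L" using L0 by simp
    have Z0: "0 < Z" using Za a0 NL0 by linarith
    \<comment> \<open>The longest word whose cylinder in coordinate \<open>k\<close> still has
      length at least \<open>r\<close>, in logarithmic form.\<close>
    define p where "p k = nat \<lfloor>(Z + ln (v k - u k) / real m) / ?l k\<rfloor>" for k
    have p: "real (p k) * ?l k \<le> Z + ln (v k - u k) / real m" "Z - a \<le> real (p k) * ?l k" "real (p k) * ?l k \<le> Z" for k
    proof -
      let ?y = "Z + ln (v k - u k) / real m"
      have "- c1 \<le> ln (v k - u k) / real m"
      proof -
        have "c1 * 1 \<le> c1 * real m" using c1(1) m by (intro mult_left_mono) auto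
        then have "- c1 * real m \<le> ln (v k - u k)" using c1(2)[of k] by simp
        then show ?thesis using m by (simp add: pos_le_divide_eq)
      qed
      then have y: "Z - c1 \<le> ?y" "0 \<le> ?y" using Za NL0 L0 unfolding a_def by linarith+
      have "0 \<le> ?y / ?l k" using y(2) log_expanding[of k] by simp
      then have "real (p k) \<le> ?y / ?l k" "?y / ?l k \<le> real (p k) + 1" unfolding p_def by linarith+
      then have *: "real (p k) * ?l k \<le> ?y" "?y \<le> (real (p k) + 1) * ?l k"
        using log_expanding[of k] by (simp_all add: pos_le_divide_eq pos_divide_le_eq)
      show "real (p k) * ?l k \<le> ?y" by (rule *(1))
      show "Z - a \<le> real (p k) * ?l k" using *(2) y(1) lL[of k] unfolding a_def by (simp add: distrib_right)
      have "ln (v k - u k) / real m \<le> 0" using lvu[of k] by (simp add: divide_nonpos_nonneg)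
      then show "real (p k) * ?l k \<le> Z" using *(1) by linarith
    qed
    have not0: "\<not> (\<forall>k. p k \<le> N 0)"
    proof
      assume "\<forall>k. p k \<le> N 0"
      then have "real (p k) * ?l k \<le> real (N 0) * L" for k
        using lL[of k] log_expanding[of k] by (intro mult_mono) auto
      then show False using p(2)[of undefined] Za by (smt (verit))
    qed
    have "\<forall>k. p k \<le> N (\<Sum>k\<in>UNIV. p k)"
    proof
      fix k
      have "p k \<le> (\<Sum>k\<in>UNIV. p k)" by (intro member_le_sum) auto
      also have "\<dots> \<le> N (\<Sum>k\<in>UNIV. p k)" using seq_suble[OF smono] .
      finally show "p k \<le> N (\<Sum>k\<in>UNIV. p k)" .
    qed
    \<comment> \<open>The return time relevant at this scale: exceeded by the word length in some
      coordinate, while the next return time is exceeded in none.\<close>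
    then obtain i where i: "\<not> (\<forall>k. p k \<le> N i)" "\<forall>k. p k \<le> N (Suc i)"
      using last_before[of "\<lambda>i. \<not> (\<forall>k. p k \<le> N i)" 0 "\<Sum>k\<in>UNIV. p k"] not0 by auto
    define fr where "fr k = card (F k \<inter> {..<p k})" for k
    have fr: "min (real (p k)) (max (real (N i)) (real (p k) - real (Q k (N i)))) - \<epsilon> * real (N i) - 1 \<le> real (fr k)" for k
      unfolding fr_def F_def
      using N(3) sparse \<epsilon> i(2) by (intro card_free_positions) (auto intro: less_imp_le)
    have Ni: "0 < N i" using N(2)[of i] by simp
    have "\<theta> * Z - real (N i) * (real CARD('n) * \<eta> + \<epsilon> * (\<Sum>k\<in>UNIV. ?l k))
      - (real CARD('n) * a + 2 * (\<Sum>k\<in>UNIV. ?l k)) \<le> (\<Sum>k\<in>UNIV. real (fr k) * ?l k)"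
      by (rule weighted_free_count[OF t0 \<theta> Ni Z0 fr p(2) a0 Q(2) less_imp_le[OF \<eta>]])
    then have "\<theta> * Z - real (N i) * (l0 * ((\<theta> - s) / 2)) - B \<le> (\<Sum>k\<in>UNIV. real (fr k) * ?l k)"
      unfolding loss[symmetric] B_def d_def L_def .
    \<comment> \<open>Losses proportional to the return time become losses proportional to
      \<open>Z\<close>, because some word is longer than \<open>N i\<close>.\<close>
    moreover have "real (N i) * (l0 * ((\<theta> - s) / 2)) \<le> Z * ((\<theta> - s) / 2)"
    proof -
      obtain k where k: "N i < p k" using i(1) by (auto simp: not_le)
      have "real (N i) * l0 \<le> real (p k) * ?l k" using k l0 by (intro mult_mono) auto
      also have "\<dots> \<le> Z" by (rule p(3))
      finally have "real (N i) * l0 * ((\<theta> - s) / 2) \<le> Z * ((\<theta> - s) / 2)" using s by (intro mult_right_mono) auto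
      then show ?thesis by (simp only: mult.assoc)
    qed
    moreover have "\<theta> * Z - Z * ((\<theta> - s) / 2) = (\<theta> + s) / 2 * Z" by (simp add: field_simps)
    ultimately have "(\<theta> + s) / 2 * Z - B \<le> (\<Sum>k\<in>UNIV. real (fr k) * ?l k)" by linarith
    then have "real m * (1 - \<kappa>) * ((\<theta> + s) / 2 * Z - B) \<le> real m * (1 - \<kappa>) * (\<Sum>k\<in>UNIV. real (fr k) * ?l k)"
      using \<kappa>(3) by (intro mult_left_mono) auto
    also have "real m * (1 - \<kappa>) * ((\<theta> + s) / 2 * Z - B) = real m * ((1 - \<kappa>) * ((\<theta> + s) / 2)) * Z - real m * (1 - \<kappa>) * B"
      by (simp add: algebra_simps)
    finally have key: "real m * s * Z - real m * (1 - \<kappa>) * B \<le> real m * (1 - \<kappa>) * (\<Sum>k\<in>UNIV. real (fr k) * ?l k)"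
      unfolding \<kappa>(2) .
    have prod: "exp (real m * (1 - \<kappa>) * (\<Sum>k\<in>UNIV. real (fr k) * ?l k)) \<le> (\<Prod>k\<in>UNIV. real (card (S k)) ^ fr k)"
    proof -
      have "exp (real m * (1 - \<kappa>) * (\<Sum>k\<in>UNIV. real (fr k) * ?l k)) = (\<Prod>k\<in>UNIV. exp (real m * ((1 - \<kappa>) * ?l k)) ^ fr k)"
        by (simp add: sum_distrib_left exp_sum exp_of_nat_mult[symmetric] mult_ac)
      also have "\<dots> \<le> (\<Prod>k\<in>UNIV. real (card (S k)) ^ fr k)"
        using card unfolding S_def by (intro prod_mono conjI power_mono) auto
      finally show ?thesis .
    qed
    have rs: "r powr s = exp (- (real m * s * Z))" using r(1) by (simp add: powr_def lnr)
    have "exp (- (real m * (1 - \<kappa>) * B)) = exp (- (real m * s * Z)) * exp (real m * s * Z - real m * (1 - \<kappa>) * B)"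
      by (simp add: exp_add[symmetric])
    also have "\<dots> \<le> exp (- (real m * s * Z)) * (\<Prod>k\<in>UNIV. real (card (S k)) ^ fr k)"
      using key by (intro mult_left_mono order_trans[OF _ prod]) auto
    finally have c: "exp (- (real m * (1 - \<kappa>) * B)) \<le> r powr s * (\<Prod>k\<in>UNIV. real (card (S k)) ^ card (F k \<inter> {..<p k}))"
      unfolding rs fr_def .
    have "r \<le> (v k - u k) / \<bar>b k\<bar> ^ p k" for k
    proof -
      have "real m * (real (p k) * ?l k) \<le> real m * (Z + ln (v k - u k) / real m)"
        using p(1)[of k] by (rule mult_left_mono) simp
      also have "\<dots> = - ln r + ln (v k - u k)" using m by (simp add: lnr distrib_left)
      finally have "ln r \<le> ln (v k - u k) - real (p k) * real m * ?l k" by (simp add: mult_ac)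
      then have "exp (ln r) \<le> exp (ln (v k - u k) - real (p k) * real m * ?l k)" by simp
      then show ?thesis using r(1) uv(2)[of k] by (simp add: exp_diff b)
    qed
    then show "\<exists>p. (\<forall>k. r \<le> (v k - u k) / \<bar>b k\<bar> ^ p k) \<and>
        exp (- (real m * (1 - \<kappa>) * B)) \<le> r powr s * (\<Prod>k\<in>UNIV. real (card (S k)) ^ card (F k \<inter> {..<p k}))"
      using c by blast
  qed (auto simp: r0_def)
qed

end

section \<open>From null and non-null measures to the dimension formula\<close>

lemma hausdorff_measure_null_mono:
  assumes "0 \<le> s" "s < s'" and null: "hausdorff_measure s A = 0"
  shows "hausdorff_measure s' A = 0"
proof -
  have "hausdorff_premeasure s' \<delta> A \<le> 0" if \<delta>: "0 < \<delta>" for \<delta>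
  proof -
    \<comment> \<open>With diameters at most 1, raising the exponent does not increase the weights,
      so only such fine covers are compared.\<close>
    have "hausdorff_premeasure s' \<delta> A \<le> hausdorff_premeasure s (min \<delta> 1) A"
      unfolding hausdorff_premeasure_def
    proof (rule INF_mono)
      fix C assume C: "C \<in> delta_covers (min \<delta> 1) A"
      have "diam_pow s' (C i) \<le> diam_pow s (C i)" for i
      proof -
        have "bounded (C i)" "diameter (C i) \<le> 1" using C unfolding delta_covers_def by auto
        moreover from this have "0 \<le> diameter (C i)" by (simp add: diameter_ge_0)
        ultimately have "diameter (C i) powr s' \<le> diameter (C i) powr s" "diameter (C i) powr s' \<le> 1"
          using assms(1,2) by (auto intro: powr_mono' powr_le1)
        then show ?thesis using assms(1,2) unfolding diam_pow_def
          by (auto intro: ennreal_leI simp flip: ennreal_1)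
      qed
      then have "(\<Sum>i. diam_pow s' (C i)) \<le> (\<Sum>i. diam_pow s (C i))" by (intro suminf_le) auto
      moreover have "C \<in> delta_covers \<delta> A" using C unfolding delta_covers_def by auto
      ultimately show "\<exists>C'\<in>delta_covers \<delta> A. (\<Sum>i. diam_pow s' (C' i)) \<le> (\<Sum>i. diam_pow s (C i))" by blast
    qed
    also have "\<dots> \<le> hausdorff_measure s A" unfolding hausdorff_measure_def using \<delta> by (intro SUP_upper) auto
    finally show ?thesis using null by simp
  qed
  then show ?thesis unfolding hausdorff_measure_def by simp
qed

theorem theorem1p7:
  fixes T :: "real^'n^'n"
    and \<beta> :: "'n::finite \<Rightarrow> real"
    and \<psi> :: "'n \<Rightarrow> real \<Rightarrow> real"
  assumes T_diagonal: "T = (\<chi> i j. if i = j then \<beta> i else 0)"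
    and eigenvalues: "\<And>i. \<bar>\<beta> i\<bar> > 1"
    and psi_pos: "\<And>i x. 0 \<le> x \<Longrightarrow> \<psi> i x > 0"
    and psi_noninc: "\<And>i. antimono_on {0..} (\<psi> i)"
    and U_bounded: "bounded (exponent_acc_points \<psi>)"
    and U_nonempty: "exponent_acc_points \<psi> \<noteq> {}"
  shows "hausdorff_dim (recurrent_set \<beta> \<psi>) =
           (SUP t\<in>exponent_acc_points \<psi>. ereal (MIN i. theta \<beta> t i))"
proof -
  interpret recurrence \<beta> \<psi>
    using eigenvalues psi_pos psi_noninc by unfold_locales
  let ?U = "exponent_acc_points \<psi>"
  let ?\<theta> = "\<lambda>t. MIN i. theta \<beta> t i"
  let ?R = "recurrent_set \<beta> \<psi>"
  have theta_pos: "0 < theta \<beta> t i" if t: "t \<in> ?U" for t i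
  proof -
    have t0: "0 \<le> t $ k" for k using acc_point_nonneg[OF t] .
    have "0 < ln \<bar>\<beta> i\<bar> + t $ i" using log_expanding[of i] t0[of i] by simp
    then show ?thesis unfolding theta_eq_rate[OF eigenvalues t0] by (simp add: rate_pos[OF eigenvalues])
  qed
  have min_pos: "0 < ?\<theta> t" if "t \<in> ?U" for t using theta_pos[OF that] by simp
  show ?thesis
  proof (rule antisym)
    show "hausdorff_dim ?R \<le> (SUP t\<in>?U. ereal (?\<theta> t))"
    proof (rule ccontr)
      assume "\<not> ?thesis"
      \<comment> \<open>Two intermediate values are taken because the covering argument needs room
        between the exponent \<open>s1\<close> of the number of cubes and the dimension
        \<open>s\<close>.\<close>
      then obtain s1 where s1: "(SUP t\<in>?U. ereal (?\<theta> t)) < ereal s1" "ereal s1 < hausdorff_dim ?R"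
        using ereal_dense2 by (metis not_le)
      obtain s where s: "ereal s1 < ereal s" "ereal s < hausdorff_dim ?R"
        using ereal_dense2[OF s1(2)] by blast
      have lt: "?\<theta> t < s1" if "t \<in> ?U" for t
        using le_less_trans[OF SUP_upper[OF that] s1(1)] by simp
      have "\<exists>i. theta \<beta> t i < s1" if "t \<in> ?U" for t
        using lt[OF that] by (simp add: Min_less_iff)
      \<comment> \<open>An accumulation point exists and all its \<open>theta\<close> values are
        positive.\<close>
      moreover have "0 < s1" using U_nonempty lt min_pos by (metis ex_in_conv less_trans)
      ultimately have "hausdorff_measure s ?R = 0"
        using s(1) by (intro hausdorff_measure_recurrent_set[OF U_bounded U_nonempty, of s1]) auto
      then have "hausdorff_dim ?R \<le> ereal s"
        unfolding hausdorff_dim_def using \<open>0 < s1\<close> s(1) by (intro INF_lower) auto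
      then show False using s(2) by simp
    qed
    show "(SUP t\<in>?U. ereal (?\<theta> t)) \<le> hausdorff_dim ?R"
      unfolding hausdorff_dim_def
    proof (intro SUP_least INF_greatest)
      fix t s assume t: "t \<in> ?U" and "s \<in> {s. 0 \<le> s \<and> hausdorff_measure s ?R = 0}"
      then have s: "0 \<le> s" "hausdorff_measure s ?R = 0" by auto
      show "ereal (?\<theta> t) \<le> ereal s"
      proof (rule ccontr)
        assume "\<not> ?thesis"
        then have "s < ?\<theta> t" by (simp only: ereal_less_eq not_le)
        \<comment> \<open>Passing to a larger exponent makes it strictly positive, as the lower
          bound requires, even when \<open>s = 0\<close>.\<close>
        from dense[OF this] obtain s' where s': "s < s'" "s' < ?\<theta> t" by (elim exE conjE)
        have "hausdorff_measure s' ?R = 0" by (rule hausdorff_measure_null_mono[OF s(1) s'(1) s(2)])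
        moreover have "hausdorff_measure s' ?R \<noteq> 0"
          by (rule hausdorff_measure_recurrent_set_pos[OF t _ s'(2)]) (use s(1) s'(1) in auto)
        ultimately show False by simp
      qed
    qed
  qed
qed

end
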